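(* There exist a domain $D \subset \hat{\mathbb{C}}$ and an exhaustion $\Phi=(D_j)$ of $D$ such that the associated sequence $(f_j)$ of normalized conformal maps $f_j : D_j \to \tilde D_j$ onto circle domains converges locally uniformly in $D$ to a conformal map $f_\Phi : D \to f_\Phi(D)$, and $\mathcal{C}(f_\Phi(D))$ contains uncountably many non-trivial elements.
   Context: $\hat{\mathbb{C}}$ is the Riemann sphere; a domain is a connected open set. For a domain $G\subset\hat{\mathbb{C}}$, $\mathcal{C}(G)$ denotes the set of connected components of $\hat{\mathbb{C}}\setminus G$; an element $p\in\mathcal{C}(G)$ is non-trivial if $\operatorname{diam}(p)>0$ (i.e. $p$ is not a single point). A circle domain is a domain $G$ such that every element of $\mathcal{C}(G)$ is a closed disk or a point. An exhaustion of a domain $D\subset\hat{\mathbb{C}}$ is a sequence $\Phi=(D_j)_{j\ge 1}$ of domains $D_j\subset D$, each bounded by finitely many disjoint Jordan curves in $D$, with $D_j\subset D_{j+1}$ for all $j$ and $D=\bigcup_j D_j$. Fix distinct points $a_0,a_1,a_2\in D_1$. By Koebe's theorem, for each $j$ there is a unique conformal map $f_j:D_j\to\tilde D_j$ onto a circle domain $\tilde D_j\subset\hat{\mathbb{C}}$ with $f_j(a_k)=a_k$ for $k=0,1,2$. The sequence $(f_j)$ always has subsequences converging locally uniformly in $D$ to conformal maps; if the whole sequence converges, its limit is denoted $f_\Phi$. *)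

theory Defs
  imports "HOL-Complex_Analysis.Complex_Analysis"
begin

section \<open>The Riemann sphere as a metric space\<close>

datatype riemann_sphere = Fin complex | Infty

text \<open>Inverse stereographic projection onto the unit sphere of $\mathbb{C}\times\mathbb{R}$, with
  \<open>Infty\<close> going to the north pole. The metric below is the chordal metric:
  \<open>dist (Fin z) (Fin w) = 2 * norm (z - w) / (sqrt (1 + (norm z)^2) * sqrt (1 + (norm w)^2))\<close>,
  so the diameter of the sphere is 2.\<close>

fun to_unit_sphere :: "riemann_sphere \<Rightarrow> complex \<times> real" where
  "to_unit_sphere (Fin z) =
     (of_real (2 / (1 + (norm z)\<^sup>2)) * z, ((norm z)\<^sup>2 - 1) / ((norm z)\<^sup>2 + 1))"
| "to_unit_sphere Infty = (0, 1)"

lemma inj_to_unit_sphere: "inj to_unit_sphere"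
proof (rule injI)
  have pos: "1 + (norm z)\<^sup>2 > 0" for z :: complex
    by (simp add: add_pos_nonneg)
  have ne: "((norm z)\<^sup>2 - 1) / ((norm z)\<^sup>2 + 1) \<noteq> 1" for z :: complex
    using pos[of z] by (simp add: divide_eq_eq)
  fix p q assume eq: "to_unit_sphere p = to_unit_sphere q"
  show "p = q"
  proof (cases p)
    case (Fin z)
    show ?thesis
    proof (cases q)
      case (Fin w)
      have e1: "of_real (2 / (1 + (norm z)\<^sup>2)) * z = of_real (2 / (1 + (norm w)\<^sup>2)) * w"
        and e2: "((norm z)\<^sup>2 - 1) / ((norm z)\<^sup>2 + 1) = ((norm w)\<^sup>2 - 1) / ((norm w)\<^sup>2 + 1)"
        using eq \<open>p = Fin z\<close> \<open>q = Fin w\<close> by (simp_all only: to_unit_sphere.simps prod.inject)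
      have inj_aux: "a = b" if "(a - 1) / (a + 1) = (b - 1) / (b + 1)" "1 + a > 0" "1 + b > 0"
        for a b :: real
        using that by (simp add: frac_eq_eq) (simp add: algebra_simps)
      have "(norm z)\<^sup>2 = (norm w)\<^sup>2"
        using inj_aux[OF e2 pos pos] .
      with e1 have "of_real (2 / (1 + (norm w)\<^sup>2)) * z = of_real (2 / (1 + (norm w)\<^sup>2)) * w"
        by (simp only:)
      moreover have "2 / (1 + (norm w)\<^sup>2) \<noteq> 0"
        using pos[of w] by auto
      ultimately have "z = w"
        by (simp only: mult_cancel_left of_real_eq_0_iff) simp
      then show ?thesis
        using \<open>p = Fin z\<close> \<open>q = Fin w\<close> by (simp only:)
    next
      case Infty
      then show ?thesis
        using eq ne[of z] \<open>p = Fin z\<close> by (simp only: to_unit_sphere.simps prod.inject simp_thms)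
    qed
  next
    case Infty
    show ?thesis
    proof (cases q)
      case (Fin w)
      then show ?thesis
        using eq[symmetric] ne[of w] \<open>p = Infty\<close> by (simp only: to_unit_sphere.simps prod.inject simp_thms)
    qed (use \<open>p = Infty\<close> in simp)
  qed
qed

instantiation riemann_sphere :: metric_space
begin

definition dist_riemann_sphere :: "riemann_sphere \<Rightarrow> riemann_sphere \<Rightarrow> real" where
  "dist_riemann_sphere p q = dist (to_unit_sphere p) (to_unit_sphere q)"

definition uniformity_riemann_sphere :: "(riemann_sphere \<times> riemann_sphere) filter" where
  "uniformity_riemann_sphere = (INF e\<in>{0<..}. principal {(p, q). dist p q < e})"

definition open_riemann_sphere :: "riemann_sphere set \<Rightarrow> bool" where
  "open_riemann_sphere U \<longleftrightarrow> (\<forall>p\<in>U. eventually (\<lambda>(p', q). p' = p \<longrightarrow> q \<in> U) uniformity)"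

instance
proof
  show "dist p q = 0 \<longleftrightarrow> p = q" for p q :: riemann_sphere
    by (simp add: dist_riemann_sphere_def inj_eq[OF inj_to_unit_sphere])
  show "dist p q \<le> dist p r + dist q r" for p q r :: riemann_sphere
    unfolding dist_riemann_sphere_def by (rule dist_triangle2)
qed (simp_all add: uniformity_riemann_sphere_def open_riemann_sphere_def)

end

section \<open>Holomorphic and conformal maps between subsets of the sphere\<close>

fun fin_part :: "riemann_sphere \<Rightarrow> complex" where
  "fin_part (Fin z) = z"
| "fin_part Infty = 0"

fun sphere_inv :: "riemann_sphere \<Rightarrow> riemann_sphere" where
  "sphere_inv (Fin z) = (if z = 0 then Infty else Fin (1 / z))"
| "sphere_inv Infty = Fin 0"

text \<open>The atlas consists of the charts \<open>z\<close> and \<open>1/z\<close>; their inverses are \<open>\<lambda>z. \<phi> (Fin z)\<close> for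
  \<open>\<phi> \<in> {id, sphere_inv}\<close>. All four coordinate expressions of \<open>f\<close> have to be holomorphic where
  they are defined, a set that is open when \<open>G\<close> is open and \<open>f\<close> is continuous on \<open>G\<close>.\<close>

definition sphere_holomorphic_on ::
    "(riemann_sphere \<Rightarrow> riemann_sphere) \<Rightarrow> riemann_sphere set \<Rightarrow> bool" where
  "sphere_holomorphic_on f G \<longleftrightarrow> continuous_on G f \<and>
     (\<forall>\<phi>\<in>{id, sphere_inv}. \<forall>\<psi>\<in>{id, sphere_inv}.
        (\<lambda>z. fin_part (\<psi> (f (\<phi> (Fin z)))))
          holomorphic_on {z. \<phi> (Fin z) \<in> G \<and> \<psi> (f (\<phi> (Fin z))) \<noteq> Infty})"

definition conformal_map ::
    "(riemann_sphere \<Rightarrow> riemann_sphere) \<Rightarrow> riemann_sphere set \<Rightarrow> riemann_sphere set \<Rightarrow> bool" where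
  "conformal_map f G H \<longleftrightarrow> sphere_holomorphic_on f G \<and> bij_betw f G H"

section \<open>Circle domains and exhaustions\<close>

definition sphere_domain :: "riemann_sphere set \<Rightarrow> bool" where
  "sphere_domain G \<longleftrightarrow> open G \<and> connected G \<and> G \<noteq> {}"

definition complement_components :: "riemann_sphere set \<Rightarrow> riemann_sphere set set" where
  "complement_components G = components (- G)"

definition nontrivial :: "riemann_sphere set \<Rightarrow> bool" where
  "nontrivial p \<longleftrightarrow> diameter p > 0"

text \<open>Closed spherical caps. In the plane these are the closed Euclidean disks, the closed
  half-planes with \<open>Infty\<close> added, and the complements of open Euclidean disks with \<open>Infty\<close>
  added.\<close>

definition closed_disk :: "riemann_sphere set \<Rightarrow> bool" where
  "closed_disk B \<longleftrightarrow> (\<exists>c r. 0 < r \<and> r < 2 \<and> B = cball c r)"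

definition circle_domain :: "riemann_sphere set \<Rightarrow> bool" where
  "circle_domain G \<longleftrightarrow> sphere_domain G \<and>
     (\<forall>p\<in>complement_components G. closed_disk p \<or> (\<exists>x. p = {x}))"

definition jordan_curve :: "riemann_sphere set \<Rightarrow> bool" where
  "jordan_curve J \<longleftrightarrow> (\<exists>g. simple_path g \<and> pathfinish g = pathstart g \<and> path_image g = J)"

text \<open>The sequence is indexed from \<open>0\<close>, so its first domain is \<open>\<Phi> 0\<close>.\<close>

definition exhaustion :: "riemann_sphere set \<Rightarrow> (nat \<Rightarrow> riemann_sphere set) \<Rightarrow> bool" where
  "exhaustion D \<Phi> \<longleftrightarrow>
     (\<forall>j. sphere_domain (\<Phi> j) \<and> \<Phi> j \<subseteq> D \<and> \<Phi> j \<subseteq> \<Phi> (Suc j) \<and>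
        (\<exists>\<J>. finite \<J> \<and> pairwise disjnt \<J> \<and>
           (\<forall>J\<in>\<J>. jordan_curve J \<and> J \<subseteq> D) \<and> frontier (\<Phi> j) = \<Union>\<J>)) \<and>
     D = (\<Union>j. \<Phi> j)"

definition normalized_circle_map ::
    "riemann_sphere \<Rightarrow> riemann_sphere \<Rightarrow> riemann_sphere \<Rightarrow> riemann_sphere set \<Rightarrow>
     (riemann_sphere \<Rightarrow> riemann_sphere) \<Rightarrow> bool" where
  "normalized_circle_map a0 a1 a2 G f \<longleftrightarrow>
     (\<exists>H. circle_domain H \<and> conformal_map f G H) \<and> f a0 = a0 \<and> f a1 = a1 \<and> f a2 = a2"

text \<open>For increasing open sets exhausting \<open>D\<close>, a compact subset of \<open>D\<close> lies in all but finitely many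
  of them, so for maps given only on such sets the values elsewhere do not affect this notion.\<close>

definition converges_locally_uniformly_on ::
    "riemann_sphere set \<Rightarrow> (nat \<Rightarrow> riemann_sphere \<Rightarrow> riemann_sphere) \<Rightarrow>
     (riemann_sphere \<Rightarrow> riemann_sphere) \<Rightarrow> bool" where
  "converges_locally_uniformly_on D f g \<longleftrightarrow>
     (\<forall>K. compact K \<and> K \<subseteq> D \<longrightarrow> uniform_limit K f g sequentially)"

end

theory Submission
  imports Defs
begin

text \<open>
The domain is constructed together with its circle domains. Let \<open>H\<^sub>n\<close> be a disc from which finitely many closed
discs have been removed, and let \<open>\<phi>\<^sub>n\<close> be univalent near the closure of \<open>H\<^sub>n\<close>, mapping this closure into \<open>H\<^sub>n\<^sub>+\<^sub>1\<close>. If \<open>\<phi>\<^sub>n\<^sub>+\<^sub>1\<close> is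
sufficiently close to the identity on the image of \<open>\<phi>\<^sub>n\<close>, then the compositions \<open>\<phi>\<^sub>m \<circ> \<dots> \<circ> \<phi>\<^sub>n\<close> converge, as \<open>m\<close> grows, to a univalent map \<open>F\<^sub>n\<close>
(\<open>limit_map\<close>, \<open>limit_inj\<close>), and \<open>F\<^sub>n = F\<^sub>n\<^sub>+\<^sub>1 \<circ> \<phi>\<^sub>n\<close>. Hence the domains \<open>D\<^sub>n = F\<^sub>n(H\<^sub>n)\<close> increase to a domain \<open>D\<close>, the boundary curves of \<open>D\<^sub>n\<close>
lie in \<open>D\<^sub>n\<^sub>+\<^sub>1\<close>, and \<open>F\<^sub>n\<close> has an inverse that maps \<open>D\<^sub>n\<close> conformally onto the circle domain \<open>H\<^sub>n\<close>. On \<open>D\<^sub>k\<close> this inverse is \<open>\<phi>\<^sub>n\<^sub>-\<^sub>1 \<circ> \<dots> \<circ> \<phi>\<^sub>k \<circ> F\<^sub>k\<^sup>-\<^sup>1\<close>,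
which tends to \<open>F\<^sub>k \<circ> F\<^sub>k\<^sup>-\<^sup>1\<close>, the identity (\<open>inverse_uniform\<close>). The normalization at three points only adds Moebius transformations
that tend to the identity as well (\<open>normalized_maps_exist\<close>). So the limit is the identity of \<open>D\<close>, whatever the three
points are, and it remains to arrange that the complement of \<open>D\<close> has uncountably many non-trivial components.

This is possible although the discs removed from \<open>H\<^sub>n\<close> are tiny, because a univalent map can be close to the identity away
from a segment and nevertheless turn a few tiny holes around that segment into a hole that contains it. To see this,
enclose the segment in a rectangle whose boundary is lined with small, almost touching discs, and remove these discs. The squeezing
map contracts the interior of the rectangle to a neighbourhood of a point beside the segment and leaves the exterior
almost fixed; through the gaps between the discs the two parts of the image are connected by thin tentacles. It is given by an
explicit formula in which logarithms with short branch cuts open gaps in the indicator function of the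
rectangle (\<open>gap_potential\<close>, \<open>squeeze\<close>). At a gap its derivative stays in a half-plane no matter how narrow the gap is (\<open>squeeze_slope_near_V\<close>),
and in the limit of closing gaps the images of different points are disjoint; compactness then gives
univalence (\<open>squeeze_univalent\<close>). The image omits the segment, and the circle around the disc at the left end of the rectangle becomes
a loop around it (\<open>generation_step\<close>).

Starting from one segment \<open>[0, 1] \<times> {y}\<close>, each step replaces every segment by two parallel ones so close to it that the images of the earlier
charts, even after the small later corrections, do not reach them (\<open>stages_exist\<close>). A binary sequence \<open>\<sigma>\<close> selects a nested choice
of heights, and the segment at the limit height, \<open>branch \<sigma>\<close>, lies in the complement of \<open>D\<close> (\<open>branch_avoids\<close>). When two
sequences separate at some step, the image of a boundary circle of that step is a loop in \<open>D\<close> that winds once around one branch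
and not around the other (\<open>branch_separation\<close>). Thus different sequences belong to different components, all of them
of positive diameter (\<open>uncountable_components\<close>).
\<close>

section \<open>A wall with a gap\<close>

text \<open>For small \<open>d\<close> this is close to 0 away from the origin. Its branch cut is the segment
from \<open>- \<i> d\<close> to \<open>\<i> d\<close>, and the jump across the cut is 1. Added to the
indicator function of the left half-plane, it opens a gap of half-width \<open>d\<close> in the wall formed by
the imaginary axis.\<close>

definition gap_potential :: "real \<Rightarrow> complex \<Rightarrow> complex" where
  "gap_potential d s = \<i> / (2 * pi) * Ln ((s - \<i> * d) / (s + \<i> * d))"

text \<open>The analytic continuation of that sum through the gap: the argument of the logarithm is turned by
half a revolution, so that the cut consists of the two rays of the imaginary axis beyond \<open>\<plusminus>
\<i> d\<close>.\<close>

definition gap_step :: "real \<Rightarrow> complex \<Rightarrow> complex" where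
  "gap_step d s = 1/2 + \<i> / (2 * pi) * Ln ((\<i> * d - s) / (\<i> * d + s))"

lemma Im_cross_quotient:
  "Im ((s - \<i> * d) / (s + \<i> * of_real d)) = - 2 * d * Re s / (cmod (s + \<i> * d))\<^sup>2"
  "Re ((s - \<i> * d) / (s + \<i> * of_real d)) = ((cmod s)\<^sup>2 - d\<^sup>2) / (cmod (s + \<i> * d))\<^sup>2"
  unfolding Im_divide Re_divide cmod_power2
  by (simp_all add: power2_eq_square algebra_simps)

lemma gap_step_eq:
  assumes "d > 0" "Re s \<noteq> 0 \<or> \<bar>Im s\<bar> < d"
  shows "gap_step d s = of_bool (Re s \<le> 0) + gap_potential d s"
proof -
  define u where "u = (s - \<i> * d) / (s + \<i> * of_real d)"
  have nz: "s + \<i> * of_real d \<noteq> 0" "s - \<i> * of_real d \<noteq> 0"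
    using assms by (auto simp: complex_eq_iff)
  hence u0: "u \<noteq> 0" by (simp add: u_def)
  have pos: "(cmod (s + \<i> * d))\<^sup>2 > 0" using nz by simp
  have mu: "(\<i> * d - s) / (\<i> * of_real d + s) = - u"
    using nz by (simp add: u_def field_simps)
  have Imu: "Im u = - 2 * d * Re s / (cmod (s + \<i> * d))\<^sup>2"
    and Reu: "Re u = ((cmod s)\<^sup>2 - d\<^sup>2) / (cmod (s + \<i> * d))\<^sup>2"
    unfolding u_def by (rule Im_cross_quotient)+
  show ?thesis
  proof (cases "Re s > 0")
    case True
    hence "Im u < 0" using Imu assms pos by (simp add: divide_less_0_iff)
    hence "Ln (-u) = Ln u + \<i> * pi" using u0 by (subst Ln_minus) auto
    thus ?thesis using True unfolding gap_step_def gap_potential_def mu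
      by (simp add: u_def[symmetric] field_simps)
  next
    case False
    have "\<not> (Im u \<le> 0 \<and> \<not> (Re u < 0 \<and> Im u = 0))"
    proof (cases "Re s < 0")
      case True
      hence "Im u > 0" using Imu assms pos by (simp add: zero_less_divide_iff mult_neg_pos mult_pos_neg divide_neg_pos)
      thus ?thesis by auto
    next
      case False
      with \<open>\<not> Re s > 0\<close> have r: "Re s = 0" by simp
      hence im: "\<bar>Im s\<bar> < d" using assms by auto
      have "(cmod s)\<^sup>2 = (Im s)\<^sup>2" using r by (simp add: cmod_def)
      moreover have "(Im s)\<^sup>2 < d\<^sup>2" using im assms power2_strict_mono[of "Im s" d] by simp
      ultimately have "Re u < 0" using Reu pos by (simp add: divide_less_0_iff)
      moreover have "Im u = 0" using Imu r by simp
      ultimately show ?thesis by simp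
    qed
    hence "Ln (-u) = Ln u - \<i> * pi" using u0 by (subst Ln_minus) auto
    hence "gap_step d s = 1 + \<i> / (2 * pi) * Ln u"
      unfolding gap_step_def mu by (simp only: right_diff_distrib) simp
    thus ?thesis using False unfolding gap_potential_def u_def by simp
  qed
qed

lemma gap_quotient_not_nonpos:
  assumes "d > 0" "Re s \<noteq> 0 \<or> \<bar>Im s\<bar> > d"
  shows "(s - \<i> * d) / (s + \<i> * of_real d) \<notin> \<real>\<^sub>\<le>\<^sub>0"
proof -
  have nz: "s + \<i> * of_real d \<noteq> 0" "s - \<i> * of_real d \<noteq> 0"
    using assms by (auto simp: complex_eq_iff)
  hence pos: "(cmod (s + \<i> * d))\<^sup>2 > 0" by simp
  show ?thesis
  proof (cases "Re s = 0")
    case True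
    hence "\<bar>Im s\<bar> > d" using assms by auto
    moreover have "(cmod s)\<^sup>2 = (Im s)\<^sup>2" using True by (simp add: cmod_def)
    ultimately have "(cmod s)\<^sup>2 > d\<^sup>2"
      using assms power2_strict_mono[of d "Im s"] power2_strict_mono[of "Im s" d] by simp
    hence "Re ((s - \<i> * d) / (s + \<i> * of_real d)) > 0"
      using pos Im_cross_quotient(2)[of s d] by simp
    thus ?thesis by (auto simp: complex_nonpos_Reals_iff)
  next
    case False
    hence "Im ((s - \<i> * d) / (s + \<i> * of_real d)) \<noteq> 0"
      using pos assms Im_cross_quotient(1)[of s d] by simp
    thus ?thesis by (auto simp: complex_nonpos_Reals_iff)
  qed
qed

lemma quotient_log_deriv:
  fixes A B :: complex
  assumes "A \<noteq> 0" "B \<noteq> 0"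
  shows "inverse (A / B) * ((A' * B - A * B') / (B * B)) = (A' * B - A * B') / (A * B)"
  using assms by (simp add: field_simps)

lemma gap_potential_deriv:
  fixes s :: complex
  assumes "d > 0" "Re s \<noteq> 0 \<or> \<bar>Im s\<bar> > d"
  shows "(gap_potential d has_field_derivative - d / (pi * (s\<^sup>2 + d\<^sup>2))) (at s)"
proof -
  have nz: "s + \<i> * of_real d \<noteq> 0" "s - \<i> * of_real d \<noteq> 0"
    using assms by (auto simp: complex_eq_iff)
  have sq: "s\<^sup>2 + (of_real d)\<^sup>2 = (s - \<i> * d) * (s + \<i> * of_real d)"
    by (simp add: algebra_simps power2_eq_square)
  have "((\<lambda>s. (s - \<i> * d) / (s + \<i> * of_real d)) has_field_derivative
      ((1 * (s + \<i> * d) - (s - \<i> * d) * 1) / ((s + \<i> * of_real d) * (s + \<i> * of_real d)))) (at s)"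
    by (rule derivative_eq_intros refl nz | simp)+
  from DERIV_chain2[OF has_field_derivative_Ln[OF gap_quotient_not_nonpos[OF assms]] this]
  have "((\<lambda>s. Ln ((s - \<i> * d) / (s + \<i> * of_real d))) has_field_derivative
      (2 * \<i> * d / ((s - \<i> * d) * (s + \<i> * of_real d)))) (at s)"
    by (rule DERIV_cong) (subst quotient_log_deriv[OF nz(2,1)], simp)
  from DERIV_cmult[OF this, of "\<i> / (2 * pi)"]
  show ?thesis
    unfolding gap_potential_def[abs_def]
    by (rule DERIV_cong) (use sq in \<open>simp add: field_simps\<close>)
qed

lemma gap_step_quotient_not_nonpos:
  assumes "d > 0" "Re s \<noteq> 0 \<or> \<bar>Im s\<bar> < d"
  shows "(\<i> * d - s) / (\<i> * of_real d + s) \<notin> \<real>\<^sub>\<le>\<^sub>0"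
proof -
  have nz: "s + \<i> * of_real d \<noteq> 0" "s - \<i> * of_real d \<noteq> 0"
    using assms by (auto simp: complex_eq_iff)
  hence pos: "(cmod (s + \<i> * d))\<^sup>2 > 0" by simp
  have mu: "(\<i> * d - s) / (\<i> * of_real d + s) = - ((s - \<i> * d) / (s + \<i> * of_real d))"
    using nz by (simp add: field_simps)
  show ?thesis
  proof (cases "Re s = 0")
    case True
    hence "\<bar>Im s\<bar> < d" using assms by auto
    moreover have "(cmod s)\<^sup>2 = (Im s)\<^sup>2" using True by (simp add: cmod_def)
    ultimately have "(cmod s)\<^sup>2 < d\<^sup>2"
      using assms power2_strict_mono[of d "Im s"] power2_strict_mono[of "Im s" d] by simp
    hence "Re ((s - \<i> * d) / (s + \<i> * of_real d)) < 0"
      using pos Im_cross_quotient(2)[of s d] by (simp add: divide_less_0_iff)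
    thus ?thesis unfolding mu by (auto simp: complex_nonpos_Reals_iff)
  next
    case False
    hence "Im ((s - \<i> * d) / (s + \<i> * of_real d)) \<noteq> 0"
      using pos assms Im_cross_quotient(1)[of s d] by simp
    thus ?thesis unfolding mu by (auto simp: complex_nonpos_Reals_iff)
  qed
qed

lemma gap_step_deriv:
  fixes s :: complex
  assumes "d > 0" "Re s \<noteq> 0 \<or> \<bar>Im s\<bar> < d"
  shows "(gap_step d has_field_derivative - d / (pi * (s\<^sup>2 + d\<^sup>2))) (at s)"
proof -
  have nz: "\<i> * of_real d + s \<noteq> 0" "\<i> * of_real d - s \<noteq> 0"
    using assms by (auto simp: complex_eq_iff)
  have sq: "s\<^sup>2 + (of_real d)\<^sup>2 = - ((\<i> * d - s) * (\<i> * of_real d + s))"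
    by (simp add: algebra_simps power2_eq_square)
  have "((\<lambda>s. (\<i> * d - s) / (\<i> * of_real d + s)) has_field_derivative
      ((- 1 * (\<i> * d + s) - (\<i> * d - s) * 1) / ((\<i> * of_real d + s) * (\<i> * of_real d + s)))) (at s)"
    by (rule derivative_eq_intros refl nz | simp)+
  from DERIV_chain2[OF has_field_derivative_Ln[OF gap_step_quotient_not_nonpos[OF assms]] this]
  have "((\<lambda>s. Ln ((\<i> * d - s) / (\<i> * of_real d + s))) has_field_derivative
      (- 2 * \<i> * d / ((\<i> * d - s) * (\<i> * of_real d + s)))) (at s)"
    by (rule DERIV_cong) (subst quotient_log_deriv[OF nz(2,1)], simp)
  from DERIV_add[OF DERIV_const[of "1/2"] DERIV_cmult[OF this, of "\<i> / (2 * pi)"]]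
  show ?thesis
    unfolding gap_step_def[abs_def]
    by (rule DERIV_cong) (simp add: sq)
qed

text \<open>The real part is \<open>1/2\<close> minus an argument divided by \<open>2 \<pi>\<close>, so it
stays between its values on the two sides of the wall.\<close>

lemma Re_gap_step:
  assumes "d > 0" "Re s \<noteq> 0 \<or> \<bar>Im s\<bar> < d"
  shows "0 \<le> Re (gap_step d s)" "Re (gap_step d s) \<le> 1"
proof -
  define q where "q = (\<i> * d - s) / (\<i> * of_real d + s)"
  have "Re (gap_step d s) = 1/2 - Im (Ln q) / (2 * pi)"
    unfolding gap_step_def q_def[symmetric] by (simp add: Re_divide Im_divide power2_eq_square)
  moreover have "\<bar>Im (Ln q)\<bar> \<le> pi"
    using gap_step_quotient_not_nonpos[OF assms] Im_Ln_le_pi[of q] mpi_less_Im_Ln[of q]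
    unfolding q_def[symmetric] by (cases "q = 0") auto
  hence "\<bar>Im (Ln q) / (2 * pi)\<bar> \<le> 1 / 2"
    by (simp add: field_simps)
  ultimately show "0 \<le> Re (gap_step d s)" "Re (gap_step d s) \<le> 1" by linarith+
qed

text \<open>In a flat cone about the real axis the points \<open>\<plusminus> \<i> d\<close> are almost
equally far away, so the modulus of the quotient under the logarithm is almost 1, uniformly in
\<open>d\<close>.\<close>

lemma Im_gap_step:
  assumes "d > 0" "0 < k" "k \<le> 1/16" "\<bar>Im s\<bar> \<le> k * \<bar>Re s\<bar>"
  shows "\<bar>Im (gap_step d s)\<bar> \<le> 2 * k"
proof -
  define x y where "x = Re s" and "y = Im s"
  have yk: "\<bar>y\<bar> \<le> k * \<bar>x\<bar>" using assms by (simp add: x_def y_def)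
  \<comment> \<open>the squared distances from \<open>s\<close> to \<open>\<i> d\<close> and to \<open>- \<i> d\<close>\<close>
  define P where "P = x\<^sup>2 + (d - y)\<^sup>2"
  define Q where "Q = x\<^sup>2 + (d + y)\<^sup>2"
  have dy: "2 * (d * \<bar>y\<bar>) \<le> k * (x\<^sup>2 + d\<^sup>2)"
  proof -
    have "2 * (d * \<bar>y\<bar>) \<le> 2 * (d * (k * \<bar>x\<bar>))" using yk assms by (intro mult_left_mono) auto
    also have "\<dots> = k * (2 * \<bar>x\<bar> * d)" by simp
    also have "\<dots> \<le> k * (x\<^sup>2 + d\<^sup>2)"
      using sum_squares_bound[of "\<bar>x\<bar>" d] assms by (intro mult_left_mono) auto
    finally show ?thesis .
  qed
  have pq: "P \<ge> (1 - k) * (x\<^sup>2 + d\<^sup>2)" "Q \<ge> (1 - k) * (x\<^sup>2 + d\<^sup>2)"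
  proof -
    have "2 * (d * y) \<le> k * (x\<^sup>2 + d\<^sup>2)" "- (2 * (d * y)) \<le> k * (x\<^sup>2 + d\<^sup>2)"
      using dy assms by (auto simp: abs_if split: if_splits)
        (smt (verit) mult_nonneg_nonneg zero_le_power2 mult_less_0_iff mult_pos_neg)+
    moreover have "P = x\<^sup>2 + d\<^sup>2 + y\<^sup>2 - 2 * (d * y)" "Q = x\<^sup>2 + d\<^sup>2 + y\<^sup>2 + 2 * (d * y)"
      unfolding P_def Q_def power2_sum power2_diff by simp_all
    moreover have "(1 - k) * (x\<^sup>2 + d\<^sup>2) = x\<^sup>2 + d\<^sup>2 - k * (x\<^sup>2 + d\<^sup>2)"
      by (simp add: left_diff_distrib)
    moreover have "y\<^sup>2 \<ge> 0" by simp
    ultimately have "P - (1 - k) * (x\<^sup>2 + d\<^sup>2) \<ge> 0" "Q - (1 - k) * (x\<^sup>2 + d\<^sup>2) \<ge> 0"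
      by linarith+
    thus "P \<ge> (1 - k) * (x\<^sup>2 + d\<^sup>2)" "Q \<ge> (1 - k) * (x\<^sup>2 + d\<^sup>2)" by simp_all
  qed
  have S: "x\<^sup>2 + d\<^sup>2 > 0" using assms by (simp add: add_nonneg_pos)
  have PQ0: "P > 0" "Q > 0"
    using pq mult_pos_pos[of "1 - k" "x\<^sup>2 + d\<^sup>2"] S assms by linarith+
  have bd: "\<bar>P - Q\<bar> \<le> 2 * k * (x\<^sup>2 + d\<^sup>2)"
  proof -
    have "\<bar>P - Q\<bar> = 4 * (d * \<bar>y\<bar>)"
      unfolding P_def Q_def power2_sum power2_diff using assms by (simp add: abs_mult)
    thus ?thesis using dy by simp
  qed
  have k2: "2 * k / (1 - k) \<le> 4 * k" using assms by (simp add: field_simps)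
  have r1: "P / Q \<le> 1 + 4 * k" "Q / P \<le> 1 + 4 * k"
  proof -
    have "2 * k * (x\<^sup>2 + d\<^sup>2) \<le> 4 * k * ((1 - k) * (x\<^sup>2 + d\<^sup>2))"
      using assms S mult_right_mono[of "1/2" "1 - k" "4 * k * (x\<^sup>2 + d\<^sup>2)"] by (simp add: algebra_simps)
    hence "\<bar>P - Q\<bar> \<le> 4 * k * P" "\<bar>P - Q\<bar> \<le> 4 * k * Q"
      using bd mult_left_mono[OF pq(1), of "4 * k"] mult_left_mono[OF pq(2), of "4 * k"] assms by linarith+
    thus "P / Q \<le> 1 + 4 * k" "Q / P \<le> 1 + 4 * k"
      using PQ0 by (simp_all add: field_simps abs_le_iff)
  qed
  define q where "q = (\<i> * d - s) / (\<i> * of_real d + s)"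
  have n1: "(cmod (\<i> * d - s))\<^sup>2 = P" "(cmod (\<i> * d + s))\<^sup>2 = Q"
    unfolding cmod_power2 P_def Q_def x_def y_def by simp_all
  have q0: "q \<noteq> 0" using n1 PQ0 unfolding q_def by auto
  have "(cmod q)\<^sup>2 = P / Q"
    unfolding q_def norm_divide power_divide n1 ..
  hence "2 * ln (cmod q) = ln (P / Q)"
    using q0 ln_realpow[of "cmod q" 2] by simp
  moreover have "ln (P / Q) \<le> 4 * k"
    using r1(1) PQ0 ln_le_minus_one[of "P / Q"] by simp
  moreover have "ln (P / Q) = - ln (Q / P)" using PQ0 by (simp add: ln_div)
  moreover have "ln (Q / P) \<le> 4 * k"
    using r1(2) PQ0 ln_le_minus_one[of "Q / P"] by simp
  ultimately have "\<bar>ln (cmod q)\<bar> \<le> 2 * k" by linarith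
  hence "\<bar>ln (cmod q) / (2 * pi)\<bar> \<le> 2 * k / (2 * pi)"
    by (simp add: field_simps)
  also have "\<dots> \<le> 2 * k" using assms pi_gt3 by (simp add: field_simps)
  finally have "\<bar>ln (cmod q) / (2 * pi)\<bar> \<le> 2 * k" .
  moreover have "Im (gap_step d s) = ln (cmod q) / (2 * pi)"
    unfolding gap_step_def q_def[symmetric] using q0 by (simp add: Re_divide Im_divide power2_eq_square)
  ultimately show ?thesis by simp
qed

section \<open>Squeezing convex bodies with gaps in their walls\<close>

text \<open>The tube lemma for filters: a local statement that holds jointly for small parameters and nearby
points becomes uniform over a compact set.\<close>

lemma compact_eventually_ball:
  fixes K :: "'a::topological_space set" and A :: "'b filter"
  assumes "compact K" "\<And>x. x \<in> K \<Longrightarrow> \<forall>\<^sub>F p in A \<times>\<^sub>F nhds x. snd p \<in> K \<longrightarrow> P (fst p) (snd p)"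
  shows "\<forall>\<^sub>F d in A. \<forall>x\<in>K. P d x"
proof -
  have "\<exists>U D. open U \<and> x \<in> U \<and> eventually D A \<and> (\<forall>d y. D d \<longrightarrow> y \<in> U \<longrightarrow> y \<in> K \<longrightarrow> P d y)" if xK: "x \<in> K" for x
  proof -
    obtain D G where "eventually D A" "eventually G (nhds x)" "\<forall>d y. D d \<longrightarrow> G y \<longrightarrow> y \<in> K \<longrightarrow> P d y"
      using assms(2)[OF xK] unfolding eventually_prod_filter by auto
    moreover obtain U where "open U" "x \<in> U" "\<forall>y\<in>U. G y"
      using \<open>eventually G (nhds x)\<close> unfolding eventually_nhds by auto
    ultimately show ?thesis by blast
  qed
  then obtain U D where U: "\<And>x. x \<in> K \<Longrightarrow> open (U x) \<and> x \<in> U x \<and> eventually (D x) A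
      \<and> (\<forall>d y. D x d \<longrightarrow> y \<in> U x \<longrightarrow> y \<in> K \<longrightarrow> P d y)"
    by metis
  obtain K' where K': "K' \<subseteq> K" "finite K'" "K \<subseteq> (\<Union>x\<in>K'. U x)"
    using compactE_image[OF assms(1), of K U] U by blast
  have "\<forall>\<^sub>F d in A. \<forall>x\<in>K'. D x d"
    using K' U by (intro eventually_ball_finite) auto
  thus ?thesis
    by (rule eventually_mono) (use K' U in blast)
qed

text \<open>All estimates of the squeezing map are joint: the gap width tends to 0 from the right while the
point moves towards \<open>z\<close>.\<close>

abbreviation gap_filter :: "complex \<Rightarrow> (real \<times> complex) filter" where
  "gap_filter z \<equiv> at_right 0 \<times>\<^sub>F nhds z"

lemma gap_filter_fst: "(fst \<longlongrightarrow> (0::real)) (gap_filter z)"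
  by (rule filterlim_compose[OF _ filterlim_fst, where g = "\<lambda>x. x"]) (simp add: tendsto_ident_at)

lemma gap_filter_snd: "(snd \<longlongrightarrow> z) (gap_filter z)"
  by (rule filterlim_snd)

lemma gap_filter_pos: "\<forall>\<^sub>F p in gap_filter z. fst p > 0"
  using filterlim_fst[of "at_right (0::real)" "nhds z"] eventually_at_right_less[of "0::real"]
  unfolding filterlim_iff by blast

lemma gap_filter_nhds: "eventually Q (nhds z) \<Longrightarrow> \<forall>\<^sub>F p in gap_filter z. Q (snd p)"
  using filterlim_snd[of "nhds z" "at_right (0::real)"] unfolding filterlim_iff by blast

text \<open>The common derivative of \<open>gap_potential d\<close> and \<open>gap_step d\<close>.\<close>

definition gap_slope :: "real \<Rightarrow> complex \<Rightarrow> complex" where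
  "gap_slope d s = - of_real d / (of_real pi * (s\<^sup>2 + (of_real d)\<^sup>2))"

text \<open>A compact set \<open>K\<close> meets the boundaries of the disjoint convex bodies \<open>P
i\<close> only in finitely many points \<open>V i\<close>, the gaps. Near a gap \<open>v\<close> the body is a
half-plane with outward unit normal \<open>e v\<close>, and \<open>K\<close> lies in every double cone about
this normal: \<open>K\<close> passes from the inside to the outside through two opposite cusps with common
vertex \<open>v\<close>. The point \<open>b i\<close> is the centre towards which the body is going to be
contracted.\<close>

locale gapped_walls =
  fixes I :: "'i set" and b :: "'i \<Rightarrow> complex" and P :: "'i \<Rightarrow> complex set"
    and V :: "'i \<Rightarrow> complex set" and e :: "complex \<Rightarrow> complex" and K :: "complex set"
  assumes finite_I: "finite I" and compact_K: "compact K"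
    and convex_P: "i \<in> I \<Longrightarrow> convex (P i)" and compact_P: "i \<in> I \<Longrightarrow> compact (P i)"
    and b_interior: "i \<in> I \<Longrightarrow> b i \<in> interior (P i)"
    and disjoint_P: "i \<in> I \<Longrightarrow> j \<in> I \<Longrightarrow> i \<noteq> j \<Longrightarrow> P i \<inter> P j = {}"
    and finite_V: "i \<in> I \<Longrightarrow> finite (V i)" and V_frontier: "i \<in> I \<Longrightarrow> V i \<subseteq> frontier (P i)"
    and norm_e: "i \<in> I \<Longrightarrow> v \<in> V i \<Longrightarrow> norm (e v) = 1"
    and P_near_V: "i \<in> I \<Longrightarrow> v \<in> V i \<Longrightarrow> \<forall>\<^sub>F z in nhds v. z \<in> P i \<longleftrightarrow> Re ((z - v) * cnj (e v)) \<le> 0"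
    and K_frontier: "i \<in> I \<Longrightarrow> K \<inter> frontier (P i) \<subseteq> V i"
    and K_near_V: "i \<in> I \<Longrightarrow> v \<in> V i \<Longrightarrow> k > 0 \<Longrightarrow>
       \<forall>\<^sub>F z in nhds v. z \<in> K \<longrightarrow> \<bar>Im ((z - v) * cnj (e v))\<bar> \<le> k * \<bar>Re ((z - v) * cnj (e v))\<bar>"
begin

definition coord :: "complex \<Rightarrow> complex \<Rightarrow> complex" where
  "coord v z = (z - v) * cnj (e v)"

text \<open>For small \<open>d\<close> this is nearly 1 in \<open>P i\<close> and nearly 0 outside. Each
summand makes it holomorphic across one gap of the wall.\<close>

definition potential :: "'i \<Rightarrow> real \<Rightarrow> complex \<Rightarrow> complex" where
  "potential i d z = of_bool (z \<in> P i) + (\<Sum>v\<in>V i. gap_potential d (coord v z))"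

definition potential_slope :: "'i \<Rightarrow> real \<Rightarrow> complex \<Rightarrow> complex" where
  "potential_slope i d z = (\<Sum>v\<in>V i. gap_slope d (coord v z) * cnj (e v))"

text \<open>Inside \<open>P i\<close> the term with index \<open>i\<close> replaces \<open>z - b i\<close> by
\<open>(z - b i) * exp (- L)\<close>, up to a small error; outside all bodies the map is nearly the identity;
at a gap the two regimes are joined by a thin tentacle of the image. The parameter \<open>L\<close> deforms
the identity (\<open>L = 0\<close>) into this map.\<close>

definition squeeze :: "real \<Rightarrow> real \<Rightarrow> complex \<Rightarrow> complex" where
  "squeeze L d z = z + (\<Sum>i\<in>I. (z - b i) * (exp (- L * potential i d z) - 1))"

definition squeeze_slope :: "real \<Rightarrow> real \<Rightarrow> complex \<Rightarrow> complex" where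
  "squeeze_slope L d z = 1 + (\<Sum>i\<in>I. exp (- L * potential i d z) - 1
      + (z - b i) * (- L * potential_slope i d z * exp (- L * potential i d z)))"

lemma coord_tendsto: "((\<lambda>p. coord v (snd p)) \<longlongrightarrow> coord v z) (gap_filter z)"
  unfolding coord_def by (intro tendsto_intros gap_filter_snd)

lemma coord_deriv: "(coord v has_field_derivative cnj (e v)) (at z)"
  unfolding coord_def by (rule derivative_eq_intros refl | simp)+

lemma norm_coord: "i \<in> I \<Longrightarrow> v \<in> V i \<Longrightarrow> norm (coord v z) = dist z v"
  by (simp add: coord_def norm_mult norm_e dist_norm)

lemma coord_eq_0: "i \<in> I \<Longrightarrow> v \<in> V i \<Longrightarrow> coord v z = 0 \<longleftrightarrow> z = v"
proof -
  assume "i \<in> I" "v \<in> V i"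
  hence "norm (coord v z) = 0 \<longleftrightarrow> z = v" by (simp only: norm_coord dist_eq_0_iff)
  thus ?thesis by simp
qed

lemma gap_potential_tendsto:
  assumes "coord v z \<noteq> 0"
  shows "((\<lambda>p. gap_potential (fst p) (coord v (snd p))) \<longlongrightarrow> 0) (gap_filter z)"
proof -
  have "((\<lambda>p. \<i> / (2 * pi) * Ln ((coord v (snd p) - \<i> * of_real (fst p)) / (coord v (snd p) + \<i> * of_real (fst p))))
      \<longlongrightarrow> \<i> / (2 * pi) * Ln ((coord v z - \<i> * of_real 0) / (coord v z + \<i> * of_real 0))) (gap_filter z)"
    by (intro tendsto_intros coord_tendsto gap_filter_fst) (use assms in auto)
  thus ?thesis using assms by (simp add: gap_potential_def)
qed

lemma gap_slope_tendsto:
  assumes "coord v z \<noteq> 0"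
  shows "((\<lambda>p. gap_slope (fst p) (coord v (snd p)) * cnj (e v)) \<longlongrightarrow> 0) (gap_filter z)"
proof -
  have "((\<lambda>p. - of_real (fst p) / (pi * ((coord v (snd p))\<^sup>2 + (of_real (fst p))\<^sup>2)) * cnj (e v))
      \<longlongrightarrow> - of_real 0 / (pi * ((coord v z)\<^sup>2 + (of_real 0)\<^sup>2)) * cnj (e v)) (gap_filter z)"
    by (intro tendsto_intros coord_tendsto gap_filter_fst) (use assms in auto)
  thus ?thesis by (simp add: gap_slope_def)
qed

lemma gap_potential_deriv_ev:
  assumes "coord v z \<noteq> 0"
  shows "\<forall>\<^sub>F p in gap_filter z. ((\<lambda>w. gap_potential (fst p) (coord v w)) has_field_derivative
            gap_slope (fst p) (coord v (snd p)) * cnj (e v)) (at (snd p))"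
proof -
  have "((\<lambda>p. norm (coord v (snd p)) - fst p) \<longlongrightarrow> norm (coord v z) - 0) (gap_filter z)"
    by (intro tendsto_intros coord_tendsto gap_filter_fst)
  hence "\<forall>\<^sub>F p in gap_filter z. norm (coord v (snd p)) - fst p > 0"
    using assms by (intro order_tendstoD) auto
  with gap_filter_pos show ?thesis
  proof eventually_elim
    case (elim p)
    have "Re (coord v (snd p)) \<noteq> 0 \<or> \<bar>Im (coord v (snd p))\<bar> > fst p"
      using elim by (auto simp: cmod_def)
    from DERIV_chain2[OF gap_potential_deriv[OF elim(1) this] coord_deriv]
    show ?case by (simp add: gap_slope_def)
  qed
qed

lemma notin_frontier_ev:
  assumes "z \<notin> frontier (P i)"
  shows "\<forall>\<^sub>F w in nhds z. w \<in> P i \<longleftrightarrow> z \<in> P i"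
proof (cases "z \<in> P i")
  case True
  hence "z \<in> interior (P i)" using assms closure_subset by (auto simp: frontier_def)
  thus ?thesis using True interior_subset[of "P i"] open_interior
    by (auto simp: eventually_nhds)
next
  case False
  hence "z \<in> - closure (P i)" using assms interior_subset by (auto simp: frontier_def)
  moreover have "open (- closure (P i))" by auto
  ultimately show ?thesis using False closure_subset[of "P i"]
    unfolding eventually_nhds by blast
qed

lemma V_coord_ne:
  assumes "i \<in> I" "z \<notin> frontier (P i)" "v \<in> V i"
  shows "coord v z \<noteq> 0"
proof -
  have "v \<in> frontier (P i)" using V_frontier[OF assms(1)] assms(3) by blast
  thus ?thesis using coord_eq_0[OF assms(1,3), of z] assms(2) by auto
qed

lemma potential_tendsto:
  assumes "i \<in> I" "z \<notin> frontier (P i)"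
  shows "((\<lambda>p. potential i (fst p) (snd p)) \<longlongrightarrow> of_bool (z \<in> P i)) (gap_filter z)"
proof -
  have "((\<lambda>p. of_bool (z \<in> P i) + (\<Sum>v\<in>V i. gap_potential (fst p) (coord v (snd p))))
      \<longlongrightarrow> of_bool (z \<in> P i) + (\<Sum>v\<in>V i. 0 :: complex)) (gap_filter z)"
    by (intro tendsto_intros gap_potential_tendsto V_coord_ne[OF assms])
  moreover have "\<forall>\<^sub>F p in gap_filter z. potential i (fst p) (snd p) =
      of_bool (z \<in> P i) + (\<Sum>v\<in>V i. gap_potential (fst p) (coord v (snd p)))"
    using gap_filter_nhds[OF notin_frontier_ev[OF assms(2)]]
    by eventually_elim (simp add: potential_def)
  ultimately show ?thesis
    by (simp add: tendsto_cong)
qed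

lemma potential_slope_tendsto:
  assumes "i \<in> I" "z \<notin> frontier (P i)"
  shows "((\<lambda>p. potential_slope i (fst p) (snd p)) \<longlongrightarrow> 0) (gap_filter z)"
proof -
  have "((\<lambda>p. potential_slope i (fst p) (snd p)) \<longlongrightarrow> (\<Sum>v\<in>V i. 0 :: complex)) (gap_filter z)"
    unfolding potential_slope_def
    by (intro tendsto_intros gap_slope_tendsto V_coord_ne[OF assms])
  thus ?thesis by simp
qed

lemma potential_deriv_ev:
  assumes "i \<in> I" "z \<notin> frontier (P i)"
  shows "\<forall>\<^sub>F p in gap_filter z. (potential i (fst p) has_field_derivative
            potential_slope i (fst p) (snd p)) (at (snd p))"
proof -
  obtain U where U: "open U" "z \<in> U" "\<And>w. w \<in> U \<Longrightarrow> w \<in> P i \<longleftrightarrow> z \<in> P i"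
    using notin_frontier_ev[OF assms(2)] unfolding eventually_nhds by auto
  have "\<forall>\<^sub>F p in gap_filter z. \<forall>v\<in>V i. ((\<lambda>w. gap_potential (fst p) (coord v w)) has_field_derivative
            gap_slope (fst p) (coord v (snd p)) * cnj (e v)) (at (snd p))"
    using finite_V[OF assms(1)]
    by (intro eventually_ball_finite ballI gap_potential_deriv_ev V_coord_ne[OF assms]) auto
  moreover have "\<forall>\<^sub>F p in gap_filter z. snd p \<in> U"
    using U by (intro gap_filter_nhds) (auto simp: eventually_nhds)
  ultimately show ?thesis
  proof eventually_elim
    case (elim p)
    have "((\<lambda>w. of_bool (z \<in> P i) + (\<Sum>v\<in>V i. gap_potential (fst p) (coord v w))) has_field_derivative
        0 + (\<Sum>v\<in>V i. gap_slope (fst p) (coord v (snd p)) * cnj (e v))) (at (snd p))"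
      by (intro derivative_intros) (use elim in auto)
    hence "((\<lambda>w. of_bool (z \<in> P i) + (\<Sum>v\<in>V i. gap_potential (fst p) (coord v w))) has_field_derivative
        potential_slope i (fst p) (snd p)) (at (snd p))"
      by (simp add: potential_slope_def)
    thus ?case
      by (rule has_field_derivative_transform_within_open[OF _ U(1)])
         (use elim in simp, simp add: potential_def U(3))
  qed
qed

lemma V_not_frontier_other:
  assumes "i \<in> I" "v \<in> V i" "j \<in> I" "j \<noteq> i"
  shows "v \<notin> P j" "v \<notin> frontier (P j)"
proof -
  have "v \<in> P i" using assms V_frontier compact_P compact_imp_closed frontier_subset_closed by blast
  thus "v \<notin> P j" using disjoint_P[of i j] assms by auto
  thus "v \<notin> frontier (P j)" using compact_P[of j] compact_imp_closed frontier_subset_closed assms by blast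
qed

definition other_potential :: "'i \<Rightarrow> complex \<Rightarrow> real \<Rightarrow> complex \<Rightarrow> complex" where
  "other_potential i v d z = (\<Sum>w\<in>V i - {v}. gap_potential d (coord w z))"

lemma other_potential_tendsto:
  assumes "i \<in> I" "v \<in> V i"
  shows "((\<lambda>p. other_potential i v (fst p) (snd p)) \<longlongrightarrow> 0) (gap_filter v)"
proof -
  have "((\<lambda>p. other_potential i v (fst p) (snd p)) \<longlongrightarrow> (\<Sum>w\<in>V i - {v}. 0 :: complex)) (gap_filter v)"
    unfolding other_potential_def
    by (intro tendsto_intros gap_potential_tendsto) (use assms coord_eq_0 in auto)
  thus ?thesis by simp
qed

lemma other_slope_tendsto:
  assumes "i \<in> I" "v \<in> V i"
  shows "((\<lambda>p. \<Sum>w\<in>V i - {v}. gap_slope (fst p) (coord w (snd p)) * cnj (e w)) \<longlongrightarrow> 0) (gap_filter v)"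
proof -
  have "((\<lambda>p. \<Sum>w\<in>V i - {v}. gap_slope (fst p) (coord w (snd p)) * cnj (e w)) \<longlongrightarrow> (\<Sum>w\<in>V i - {v}. 0 :: complex)) (gap_filter v)"
    by (intro tendsto_intros gap_slope_tendsto) (use assms coord_eq_0 in auto)
  thus ?thesis by simp
qed

text \<open>The points near the gap at \<open>v\<close> from which the wall can be crossed
analytically.\<close>

definition off_cut :: "complex \<Rightarrow> real \<times> complex \<Rightarrow> bool" where
  "off_cut v p \<longleftrightarrow> Re (coord v (snd p)) \<noteq> 0 \<or> \<bar>Im (coord v (snd p))\<bar> < fst p"

text \<open>Near \<open>v\<close> the indicator function of \<open>P i\<close> is that of a half-plane, so
together with the potential of \<open>v\<close> it forms \<open>gap_step\<close>; the other gaps contribute a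
small holomorphic function.\<close>

lemma potential_near_V:
  assumes "i \<in> I" "v \<in> V i"
  shows "\<forall>\<^sub>F p in gap_filter v. off_cut v p \<longrightarrow>
           potential i (fst p) (snd p) = gap_step (fst p) (coord v (snd p)) + other_potential i v (fst p) (snd p)
           \<and> (potential i (fst p) has_field_derivative potential_slope i (fst p) (snd p)) (at (snd p))"
proof -
  obtain U where U: "open U" "v \<in> U" "\<And>z. z \<in> U \<Longrightarrow> z \<in> P i \<longleftrightarrow> Re (coord v z) \<le> 0"
    using P_near_V[OF assms] unfolding eventually_nhds coord_def by auto
  have "\<forall>\<^sub>F p in gap_filter v. \<forall>w\<in>V i - {v}. ((\<lambda>z. gap_potential (fst p) (coord w z)) has_field_derivative
            gap_slope (fst p) (coord w (snd p)) * cnj (e w)) (at (snd p))"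
    using finite_V[OF assms(1)] coord_eq_0[OF assms(1), of _ v]
    by (intro eventually_ball_finite ballI gap_potential_deriv_ev) auto
  moreover have "\<forall>\<^sub>F p in gap_filter v. snd p \<in> U"
    using U by (intro gap_filter_nhds) (auto simp: eventually_nhds)
  ultimately show ?thesis using gap_filter_pos
  proof eventually_elim
    case (elim p)
    define d where "d = fst p"
    have dpos: "d > 0" using elim by (simp add: d_def)
    have fin: "finite (V i)" using finite_V assms by simp
    define N where "N = U \<inter> {z. Re (coord v z) \<noteq> 0 \<or> \<bar>Im (coord v z)\<bar> < d}"
    have "open {z. Re (coord v z) \<noteq> 0 \<or> \<bar>Im (coord v z)\<bar> < d}"
      unfolding coord_def by (intro open_Collect_disj open_Collect_neq open_Collect_less continuous_intros)
    hence N: "open N" unfolding N_def using U by auto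
    have eq: "potential i d z = gap_step d (coord v z) + other_potential i v d z" if "z \<in> N" for z
    proof -
      have "potential i d z = of_bool (Re (coord v z) \<le> 0) + gap_potential d (coord v z) + other_potential i v d z"
        using that U(3)[of z] fin assms
        unfolding potential_def other_potential_def N_def
        by (simp add: sum.remove[of "V i" v])
      also have "of_bool (Re (coord v z) \<le> 0) + gap_potential d (coord v z) = gap_step d (coord v z)"
        using gap_step_eq[OF dpos, of "coord v z"] that unfolding N_def by auto
      finally show ?thesis .
    qed
    show ?case
    proof
      assume "off_cut v p"
      hence pN: "snd p \<in> N" using elim by (auto simp: N_def off_cut_def d_def)
      have "((\<lambda>z. gap_step d (coord v z)) has_field_derivative gap_slope d (coord v (snd p)) * cnj (e v)) (at (snd p))"
        using DERIV_chain2[OF gap_step_deriv[OF dpos] coord_deriv, of v "snd p"] pN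
        by (auto simp: N_def gap_slope_def)
      moreover have "(other_potential i v d has_field_derivative (\<Sum>w\<in>V i - {v}. gap_slope d (coord w (snd p)) * cnj (e w))) (at (snd p))"
        unfolding other_potential_def by (intro derivative_intros) (use elim in \<open>auto simp: d_def\<close>)
      ultimately have "((\<lambda>z. gap_step d (coord v z) + other_potential i v d z) has_field_derivative
          gap_slope d (coord v (snd p)) * cnj (e v) + (\<Sum>w\<in>V i - {v}. gap_slope d (coord w (snd p)) * cnj (e w))) (at (snd p))"
        by (intro derivative_intros)
      also have "gap_slope d (coord v (snd p)) * cnj (e v) + (\<Sum>w\<in>V i - {v}. gap_slope d (coord w (snd p)) * cnj (e w))
          = potential_slope i d (snd p)"
        unfolding potential_slope_def using fin assms by (simp add: sum.remove[of "V i" v])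
      finally have "(potential i d has_field_derivative potential_slope i d (snd p)) (at (snd p))"
        by (rule has_field_derivative_transform_within_open[OF _ N pN]) (use eq in auto)
      thus "potential i (fst p) (snd p) = gap_step (fst p) (coord v (snd p)) + other_potential i v (fst p) (snd p)
           \<and> (potential i (fst p) has_field_derivative potential_slope i (fst p) (snd p)) (at (snd p))"
        using eq[OF pN] by (simp add: d_def)
    qed
  qed
qed

lemma K_off_cut:
  assumes "i \<in> I" "v \<in> V i"
  shows "\<forall>\<^sub>F p in gap_filter v. snd p \<in> K \<longrightarrow> off_cut v p"
proof -
  have "\<forall>\<^sub>F p in gap_filter v. snd p \<in> K \<longrightarrow> \<bar>Im (coord v (snd p))\<bar> \<le> 1 * \<bar>Re (coord v (snd p))\<bar>"
    using K_near_V[OF assms, of 1] unfolding coord_def by (intro gap_filter_nhds) auto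
  thus ?thesis using gap_filter_pos
    by eventually_elim (auto simp: off_cut_def)
qed

text \<open>The set \<open>K\<close> touches the walls only at gaps, and there its cusps avoid the
cut.\<close>

lemma potential_deriv_K:
  assumes "i \<in> I" "z \<in> K"
  shows "\<forall>\<^sub>F p in gap_filter z. snd p \<in> K \<longrightarrow>
           (potential i (fst p) has_field_derivative potential_slope i (fst p) (snd p)) (at (snd p))"
proof (cases "z \<in> frontier (P i)")
  case True
  hence "z \<in> V i" using K_frontier assms by blast
  from potential_near_V[OF assms(1) this] K_off_cut[OF assms(1) this] show ?thesis
    by eventually_elim auto
next
  case False
  from potential_deriv_ev[OF assms(1) this] show ?thesis by eventually_elim auto
qed

lemma squeeze_deriv:
  assumes "\<And>i. i \<in> I \<Longrightarrow> (potential i d has_field_derivative potential_slope i d z) (at z)"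
  shows "(squeeze L d has_field_derivative squeeze_slope L d z) (at z)"
proof -
  have "((\<lambda>z. (z - b i) * (exp (- L * potential i d z) - 1)) has_field_derivative
      (exp (- L * potential i d z) - 1
      + (z - b i) * (- L * potential_slope i d z * exp (- L * potential i d z)))) (at z)" if "i \<in> I" for i
  proof -
    have "((\<lambda>z. exp (- L * potential i d z)) has_field_derivative
        exp (- L * potential i d z) * (- L * potential_slope i d z)) (at z)"
      using DERIV_chain2[OF DERIV_exp DERIV_cmult[OF assms[OF that], of "- L"]] by simp
    from DERIV_mult[OF DERIV_diff[OF DERIV_ident DERIV_const] DERIV_diff[OF this DERIV_const]]
    show ?thesis by (rule DERIV_cong) simp
  qed
  thus ?thesis
    unfolding squeeze_def[abs_def] squeeze_slope_def
    by (intro derivative_intros) auto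
qed

end

section \<open>The derivative of the squeezing map near a gap\<close>

text \<open>Univalence criterion in the style of Noshiro and Warschawski. Only the derivative in the direction
of the segment enters, so the multiplier \<open>c\<close> may depend on the two points.\<close>

lemma Re_strict_increase_along_segment:
  fixes f f' :: "complex \<Rightarrow> complex"
  assumes "\<And>\<xi>. \<xi> \<in> closed_segment z w \<Longrightarrow> (f has_field_derivative f' \<xi>) (at \<xi>)"
    and "\<And>\<xi>. \<xi> \<in> closed_segment z w \<Longrightarrow> Re (c * f' \<xi> * (w - z)) > 0"
  shows "Re (c * f z) < Re (c * f w)"
proof -
  define g where "g = (\<lambda>t. Re (c * f (z + of_real t * (w - z))))"
  have "\<exists>y. (g has_real_derivative y) (at t) \<and> y > 0" if t: "0 \<le> t" "t \<le> 1" for t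
  proof -
    have mem: "z + of_real t * (w - z) \<in> closed_segment z w"
      using t unfolding in_segment by (intro exI[of _ t]) (auto simp: algebra_simps scaleR_conv_of_real)
    have "((\<lambda>t. z + of_real t * (w - z)) has_vector_derivative (w - z)) (at t)"
      by (auto intro!: derivative_eq_intros simp: has_vector_derivative_def algebra_simps scaleR_conv_of_real)
    from field_vector_diff_chain_at[OF this assms(1)[OF mem]]
    have "((\<lambda>t. f (z + of_real t * (w - z))) has_vector_derivative (w - z) * f' (z + of_real t * (w - z))) (at t)"
      by (simp add: o_def)
    hence "((\<lambda>t. c * f (z + of_real t * (w - z))) has_vector_derivative c * ((w - z) * f' (z + of_real t * (w - z)))) (at t)"
      by (rule has_vector_derivative_mult_right)
    hence "(g has_real_derivative Re (c * ((w - z) * f' (z + of_real t * (w - z))))) (at t)"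
      unfolding g_def by (intro has_field_derivative_Re)
    moreover have "Re (c * ((w - z) * f' (z + of_real t * (w - z)))) > 0"
      using assms(2)[OF mem] by (simp add: mult_ac)
    ultimately show ?thesis by blast
  qed
  hence "g 0 < g 1" by (rule DERIV_pos_imp_increasing[OF zero_less_one])
  thus ?thesis by (simp add: g_def)
qed

lemma perturbed_quotient:
  fixes D p Z t :: complex
  assumes "p \<noteq> 0" "Z \<noteq> 0" "1 + t \<noteq> 0"
  shows "- D / (p * (Z * (1 + t))) + D / (p * Z) = D / (p * Z) * (t / (1 + t))"
proof -
  have "t / (1 + t) = 1 - 1 / (1 + t)" using assms(3) by (simp add: field_simps)
  thus ?thesis using assms by (simp add: right_diff_distrib)
qed

text \<open>For nearly real \<open>s\<close> the slope is close to the negative of the Poisson kernel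
\<open>q\<close> at \<open>Re s\<close>; the error is relative, hence uniform in \<open>d\<close>.\<close>

lemma gap_slope_estimate:
  assumes "d > 0" "0 < k" "k \<le> 1/16" "\<bar>Im s\<bar> \<le> k * \<bar>Re s\<bar>"
  defines "q \<equiv> d / (pi * ((Re s)\<^sup>2 + d\<^sup>2))"
  shows "norm (gap_slope d s + q) \<le> 6 * k * q" "q > 0"
proof -
  define x y where "x = Re s" and "y = Im s"
  have S: "x\<^sup>2 + d\<^sup>2 > 0" using assms by (simp add: add_nonneg_pos)
  define t where "t = (2 * \<i> * x * y - y\<^sup>2) / (x\<^sup>2 + d\<^sup>2)"
  have yk: "\<bar>y\<bar> \<le> k * \<bar>x\<bar>" using assms by (simp add: x_def y_def)
  have s: "s = x + \<i> * y" by (simp add: x_def y_def complex_eq)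
  have S': "complex_of_real (x\<^sup>2 + d\<^sup>2) \<noteq> 0" using S by (metis of_real_eq_0_iff less_irrefl)
  have sq: "s\<^sup>2 + (of_real d)\<^sup>2 = of_real (x\<^sup>2 + d\<^sup>2) * (1 + t)"
    unfolding t_def using S' by (simp add: s field_simps power2_eq_square)
  have "norm (2 * \<i> * of_real x * of_real y - (of_real y)\<^sup>2 :: complex) \<le> 2 * \<bar>x\<bar> * \<bar>y\<bar> + y\<^sup>2"
    by (rule order_trans[OF norm_triangle_ineq4]) (simp add: norm_mult norm_power)
  also have "\<dots> \<le> 2 * \<bar>x\<bar> * (k * \<bar>x\<bar>) + (k * \<bar>x\<bar>)\<^sup>2"
    using yk power_mono[OF yk, of 2] by (intro add_mono mult_left_mono) auto
  also have "\<dots> = (2 * k + k * k) * x\<^sup>2" by (simp add: algebra_simps power2_eq_square)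
  also have "\<dots> \<le> (3 * k) * (x\<^sup>2 + d\<^sup>2)"
    using assms mult_left_le[of k k] by (intro mult_mono) auto
  finally have t: "norm t \<le> 3 * k"
    unfolding t_def norm_divide using S by (simp add: pos_divide_le_eq flip: of_real_power of_real_add)
  have "norm (1 + t) \<ge> 1 - norm t" using norm_diff_ineq[of 1 t] by simp
  hence n1: "norm (1 + t) \<ge> 1/2" using t assms by linarith
  hence n0: "1 + t \<noteq> 0" by auto
  show "q > 0" using assms S by (simp add: q_def x_def)
  have "gap_slope d s + q = q * (t / (1 + t))"
    using perturbed_quotient[of "of_real pi" "of_real (x\<^sup>2 + d\<^sup>2)" t "of_real d"] S' n0
    unfolding gap_slope_def sq q_def x_def[symmetric] by simp
  hence "norm (gap_slope d s + q) = q * (norm t / norm (1 + t))"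
    using \<open>q > 0\<close> by (simp add: norm_mult norm_divide)
  also have "norm t / norm (1 + t) \<le> 3 * k / (1/2)"
    using t n1 assms by (intro frac_le) auto
  finally show "norm (gap_slope d s + q) \<le> 6 * k * q" using \<open>q > 0\<close> by (simp add: mult_ac)
qed

text \<open>The numbers 1 and \<open>a\<close> make an angle of at most 45 degrees with \<open>1 + a\<close>,
so the combinations \<open>1 + l a\<close> have a component along \<open>1 + a\<close> that is proportional to
\<open>1 + l\<close> and absorbs the perturbations.\<close>

lemma cone_positive:
  assumes a: "norm a = 1" "Re a \<ge> 0" and l: "l \<ge> 0" and T: "norm (T - (1 + of_real l * a)) \<le> (1 + l) / 10"
    and u: "norm (u - 1) \<le> 1/10"
  shows "Re (cnj (1 + a) * T * u) > 0"
proof -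
  define M where "M = 1 + of_real l * a"
  have nM: "norm M \<le> 1 + l"
    unfolding M_def by (rule order_trans[OF norm_triangle_ineq]) (use a l in \<open>simp add: norm_mult\<close>)
  have "norm T \<le> norm M + norm (T - M)" by (metis add.commute diff_add_cancel norm_triangle_ineq)
  hence nT: "norm T \<le> (1 + l) * (11/10)" using nM T by (simp add: M_def field_simps)
  have "norm (1 + a) \<le> 2" using norm_triangle_ineq[of 1 a] a by simp
  hence n2: "norm (cnj (1 + a)) \<le> 2" by (simp only: complex_mod_cnj)
  have "norm (T * (u - 1)) \<le> ((1 + l) * (11/10)) * (1/10)"
    unfolding norm_mult using nT u l by (intro mult_mono) auto
  hence "norm ((T - M) + T * (u - 1)) \<le> (1 + l) / 10 + ((1 + l) * (11/10)) * (1/10)"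
    using T unfolding M_def[symmetric] by (intro order_trans[OF norm_triangle_ineq] add_mono)
  hence "norm (cnj (1 + a) * ((T - M) + T * (u - 1))) \<le> 2 * ((1 + l) / 10 + ((1 + l) * (11/10)) * (1/10))"
    unfolding norm_mult using n2 l by (intro mult_mono) auto
  hence "Re (cnj (1 + a) * ((T - M) + T * (u - 1))) \<ge> - (2 * ((1 + l) / 10 + ((1 + l) * (11/10)) * (1/10)))"
    using abs_Re_le_cmod[of "cnj (1 + a) * ((T - M) + T * (u - 1))"] by linarith
  moreover have "Re (cnj (1 + a) * M) \<ge> 1 + l"
  proof -
    have "(Im a)\<^sup>2 = 1 - (Re a)\<^sup>2" using cmod_power2[of a] a(1) by simp
    moreover have "Re (cnj (1 + a) * M) = (1 + Re a) * (1 + l * Re a) + l * (Im a)\<^sup>2"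
      unfolding M_def by (simp add: power2_eq_square)
    ultimately have "Re (cnj (1 + a) * M) = (1 + Re a) * (1 + l * Re a) + l * (1 - (Re a)\<^sup>2)"
      by (simp only:)
    also have "\<dots> = 1 + l + Re a + l * Re a" by (simp add: algebra_simps power2_eq_square)
    finally have "Re (cnj (1 + a) * M) = 1 + l + Re a + l * Re a" .
    thus ?thesis using a(2) l by simp
  qed
  moreover have "cnj (1 + a) * T * u = cnj (1 + a) * M + cnj (1 + a) * ((T - M) + T * (u - 1))"
    by (simp add: algebra_simps)
  hence "Re (cnj (1 + a) * T * u) = Re (cnj (1 + a) * M) + Re (cnj (1 + a) * ((T - M) + T * (u - 1)))"
    by (metis plus_complex.sel(1))
  ultimately show ?thesis using l by (simp add: field_simps)
qed

lemma exp_unit_part: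
  fixes w :: complex
  shows "norm (exp w / of_real (norm (exp w)) - 1) \<le> \<bar>Im w\<bar>"
proof -
  have "exp w = of_real (norm (exp w)) * cis (Im w)"
    unfolding norm_exp_eq_Re by (rule exp_eq_polar)
  moreover have "norm (exp w) \<noteq> 0" by simp
  ultimately have "exp w / of_real (norm (exp w)) = cis (Im w)"
    by (metis nonzero_mult_div_cancel_left of_real_eq_0_iff)
  moreover have "norm (cis (Im w) - 1) \<le> \<bar>Im w\<bar>"
  proof -
    have "norm (cis (Im w) - 1) = 2 * \<bar>sin (Im w / 2)\<bar>"
      using dist_exp_i_1[of "Im w"] by (simp add: dist_norm cis_conv_exp)
    also have "\<dots> \<le> 2 * \<bar>Im w / 2\<bar>" using abs_sin_x_le_abs_x[of "Im w / 2"] by linarith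
    finally show ?thesis by simp
  qed
  ultimately show ?thesis by simp
qed

context gapped_walls begin

definition axis :: "'i \<Rightarrow> complex \<Rightarrow> complex" where
  "axis i v = (v - b i) * cnj (e v) / norm (v - b i)"

lemma V_in_P: "i \<in> I \<Longrightarrow> v \<in> V i \<Longrightarrow> v \<in> P i"
  using V_frontier compact_P compact_imp_closed frontier_subset_closed by blast

lemma V_ne_b: "i \<in> I \<Longrightarrow> v \<in> V i \<Longrightarrow> v \<noteq> b i"
  using V_frontier b_interior by (auto simp: frontier_def)

text \<open>The direction from the centre to the gap in the coordinates in which the outward normal is 1; its
real part is nonnegative because the convex body lies on the inner side of its tangent at the gap.\<close>

lemma axis:
  assumes "i \<in> I" "v \<in> V i"
  shows "norm (axis i v) = 1" "Re (axis i v) \<ge> 0"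
proof -
  have n: "norm (v - b i) > 0" using V_ne_b[OF assms] by simp
  show "norm (axis i v) = 1" using n norm_e[OF assms] by (simp add: axis_def norm_mult norm_divide)
  obtain U where U: "open U" "v \<in> U" "\<And>z. z \<in> U \<Longrightarrow> z \<in> P i \<longleftrightarrow> Re (coord v z) \<le> 0"
    using P_near_V[OF assms] unfolding eventually_nhds coord_def by auto
  have "((\<lambda>t. v + of_real t * (b i - v)) \<longlongrightarrow> v + of_real 0 * (b i - v)) (at_right (0::real))"
    by (intro tendsto_intros)
  hence "\<forall>\<^sub>F t in at_right (0::real). v + of_real t * (b i - v) \<in> U"
    using U by (intro topological_tendstoD) auto
  moreover have "\<forall>\<^sub>F t in at_right (0::real). t < 1" "\<forall>\<^sub>F t in at_right (0::real). 0 < t"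
    by (auto simp: eventually_at_right_less eventually_at_right_field intro: exI[of _ "1::real"])
  ultimately have "\<forall>\<^sub>F t in at_right (0::real). v + of_real t * (b i - v) \<in> U \<and> t < 1 \<and> 0 < t"
    by eventually_elim auto
  then obtain t where t: "v + of_real t * (b i - v) \<in> U" "t < 1" "0 < (t::real)"
    using eventually_happens[OF _ ] by (metis (no_types, lifting) trivial_limit_at_right_real)
  have "b i \<in> P i" using b_interior[OF assms(1)] interior_subset by blast
  hence "(1 - t) *\<^sub>R v + t *\<^sub>R b i \<in> P i"
    using convexD_alt[OF convex_P[OF assms(1)] V_in_P[OF assms]] t by auto
  also have "(1 - t) *\<^sub>R v + t *\<^sub>R b i = v + of_real t * (b i - v)"
    by (simp add: scaleR_conv_of_real algebra_simps)
  finally have "Re (coord v (v + of_real t * (b i - v))) \<le> 0" using U t by blast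
  moreover have "Re (coord v (v + of_real t * (b i - v))) = - (t * Re ((v - b i) * cnj (e v)))"
    by (simp add: coord_def algebra_simps)
  ultimately have "Re ((v - b i) * cnj (e v)) \<ge> 0" using t
    by (simp add: zero_le_mult_iff)
  thus "Re (axis i v) \<ge> 0" using n unfolding axis_def by (simp add: Re_divide_of_real)
qed

text \<open>The contribution of the bodies other than \<open>P i\<close>, which is negligible near a gap of
\<open>P i\<close>.\<close>

definition rest_slope :: "'i \<Rightarrow> real \<Rightarrow> real \<Rightarrow> complex \<Rightarrow> complex" where
  "rest_slope i L d z = (\<Sum>j\<in>I - {i}. exp (- L * potential j d z) - 1
      + (z - b j) * (- L * potential_slope j d z * exp (- L * potential j d z)))"

lemma squeeze_slope_split:
  assumes "i \<in> I"
  shows "squeeze_slope L d z = exp (- L * potential i d z) * (1 - L * (z - b i) * potential_slope i d z)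
           + rest_slope i L d z"
  unfolding squeeze_slope_def rest_slope_def sum.remove[OF finite_I assms]
  by (simp add: algebra_simps)

lemma rest_slope_tendsto:
  assumes "i \<in> I" "v \<in> V i"
  shows "((\<lambda>p. rest_slope i L (fst p) (snd p)) \<longlongrightarrow> 0) (gap_filter v)"
proof -
  have "((\<lambda>p. exp (- L * potential j (fst p) (snd p)) - 1 + (snd p - b j) *
      (- L * potential_slope j (fst p) (snd p) * exp (- L * potential j (fst p) (snd p)))) \<longlongrightarrow> 0) (gap_filter v)"
    if "j \<in> I - {i}" for j
  proof -
    have A: "((\<lambda>p. potential j (fst p) (snd p)) \<longlongrightarrow> 0) (gap_filter v)"
      using potential_tendsto[of j v] V_not_frontier_other[OF assms, of j] that by simp
    have B: "((\<lambda>p. potential_slope j (fst p) (snd p)) \<longlongrightarrow> 0) (gap_filter v)"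
      using potential_slope_tendsto[of j v] V_not_frontier_other[OF assms, of j] that by simp
    have "((\<lambda>p. exp (- L * potential j (fst p) (snd p)) - 1 + (snd p - b j) *
      (- L * potential_slope j (fst p) (snd p) * exp (- L * potential j (fst p) (snd p)))) \<longlongrightarrow>
       exp (- L * (0::complex)) - 1 + (v - b j) * (- L * (0::complex) * exp (- L * (0::complex)))) (gap_filter v)"
      by (intro tendsto_add tendsto_diff tendsto_mult tendsto_exp tendsto_const A B gap_filter_snd)
    thus ?thesis by simp
  qed
  hence "((\<lambda>p. rest_slope i L (fst p) (snd p)) \<longlongrightarrow> (\<Sum>j\<in>I - {i}. 0)) (gap_filter v)"
    unfolding rest_slope_def of_real_minus by (intro tendsto_sum)
  thus ?thesis by simp
qed

lemma squeeze_deriv_near_V: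
  assumes "i \<in> I" "v \<in> V i"
  shows "\<forall>\<^sub>F p in gap_filter v. off_cut v p \<longrightarrow> (\<forall>L.
           (squeeze L (fst p) has_field_derivative squeeze_slope L (fst p) (snd p)) (at (snd p)))"
proof -
  have "\<forall>\<^sub>F p in gap_filter v. \<forall>j\<in>I. off_cut v p \<longrightarrow>
           (potential j (fst p) has_field_derivative potential_slope j (fst p) (snd p)) (at (snd p))"
  proof (intro eventually_ball_finite ballI finite_I)
    fix j assume j: "j \<in> I"
    show "\<forall>\<^sub>F p in gap_filter v. off_cut v p \<longrightarrow>
           (potential j (fst p) has_field_derivative potential_slope j (fst p) (snd p)) (at (snd p))"
    proof (cases "j = i")
      case True
      thus ?thesis using potential_near_V[OF assms] by (auto elim: eventually_mono)
    next
      case False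
      thus ?thesis using potential_deriv_ev[OF j V_not_frontier_other(2)[OF assms j]]
        by (auto elim: eventually_mono)
    qed
  qed
  thus ?thesis by eventually_elim (auto intro: squeeze_deriv)
qed

text \<open>In the cusps at a gap the derivative is, up to a positive factor and a small relative error, of
the form \<open>1 + l a\<close> with \<open>a = axis i v\<close> and some \<open>l \<ge> 0\<close> that is
large in the middle of a narrow gap: the 1 comes from the contraction and \<open>l a\<close> from the
tentacle, which points along \<open>a\<close>. As \<open>a\<close> has nonnegative real part, the derivative
stays in the half-plane with normal \<open>1 + a\<close> for all widths of the gap. The extra factor
\<open>u\<close> leaves room for directions that are not exactly normal to the wall.\<close>

lemma squeeze_slope_near_V:
  assumes "i \<in> I" "v \<in> V i" and L: "L > 0"
  obtains k where "0 < k" "k \<le> 1/16"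
    "\<forall>\<^sub>F p in gap_filter v. \<bar>Im (coord v (snd p))\<bar> \<le> k * \<bar>Re (coord v (snd p))\<bar> \<longrightarrow>
       (\<forall>u. norm (u - 1) \<le> k \<longrightarrow> Re (cnj (1 + axis i v) * squeeze_slope L (fst p) (snd p) * u) > 0)"
proof
  define a m where "a = axis i v" and "m = norm (v - b i)"
  have m: "m > 0" using V_ne_b[OF assms(1,2)] by (simp add: m_def)
  \<comment> \<open>the bound on \<open>L * k\<close> keeps the rotation by \<open>exp (- L * potential i d z)\<close> below \<open>1/100\<close> in the cone\<close>
  define k where "k = min (1/2000) (1 / (400 * L))"
  have k: "0 < k" "k \<le> 1/2000" "L * k \<le> 1/400" using L by (auto simp: k_def min_def field_simps)
  show "0 < k" "k \<le> 1/16" using k by auto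
  define other' where "other' = (\<lambda>d z. \<Sum>w\<in>V i - {v}. gap_slope d (coord w z) * cnj (e w))"
  have "((\<lambda>p. L * norm (other_potential i v (fst p) (snd p))) \<longlongrightarrow> L * norm (0::complex)) (gap_filter v)"
    by (intro tendsto_mult tendsto_const tendsto_norm other_potential_tendsto assms)
  hence o1: "\<forall>\<^sub>F p in gap_filter v. L * norm (other_potential i v (fst p) (snd p)) < 1/400"
    by (rule order_tendstoD) simp
  have "((\<lambda>p. L * norm (snd p - b i) * norm (other' (fst p) (snd p))) \<longlongrightarrow> L * norm (v - b i) * norm (0::complex)) (gap_filter v)"
    unfolding other'_def
    by (intro tendsto_mult tendsto_const tendsto_norm tendsto_diff gap_filter_snd other_slope_tendsto assms)
  hence o2: "\<forall>\<^sub>F p in gap_filter v. L * norm (snd p - b i) * norm (other' (fst p) (snd p)) < 1/400"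
    by (rule order_tendstoD) simp
  have "((\<lambda>p. norm (rest_slope i L (fst p) (snd p))) \<longlongrightarrow> norm (0::complex)) (gap_filter v)"
    by (intro tendsto_norm rest_slope_tendsto assms)
  hence o3: "\<forall>\<^sub>F p in gap_filter v. norm (rest_slope i L (fst p) (snd p)) < exp (- L - 1) / 100"
    by (rule order_tendstoD) simp
  have "((\<lambda>p. norm (coord v (snd p))) \<longlongrightarrow> norm (coord v v)) (gap_filter v)"
    by (intro tendsto_norm coord_tendsto)
  hence o4: "\<forall>\<^sub>F p in gap_filter v. norm (coord v (snd p)) < m / 2000"
    by (rule order_tendstoD) (use m in \<open>simp add: coord_def\<close>)
  show "\<forall>\<^sub>F p in gap_filter v. \<bar>Im (coord v (snd p))\<bar> \<le> k * \<bar>Re (coord v (snd p))\<bar> \<longrightarrow>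
       (\<forall>u. norm (u - 1) \<le> k \<longrightarrow> Re (cnj (1 + axis i v) * squeeze_slope L (fst p) (snd p) * u) > 0)"
    using o1 o2 o3 o4 gap_filter_pos potential_near_V[OF assms(1,2)]
  proof eventually_elim
    case (elim p)
    define d z s where "d = fst p" and "z = snd p" and "s = coord v z"
    show ?case
    proof (intro impI allI)
      fix u :: complex
      assume "\<bar>Im (coord v (snd p))\<bar> \<le> k * \<bar>Re (coord v (snd p))\<bar>" and u: "norm (u - 1) \<le> k"
      hence cone: "\<bar>Im s\<bar> \<le> k * \<bar>Re s\<bar>" by (simp add: s_def z_def)
      have dpos: "d > 0" using elim by (simp add: d_def)
      have off: "off_cut v p" using cone dpos by (auto simp: off_cut_def s_def z_def d_def)
      have pot: "potential i d z = gap_step d s + other_potential i v d z"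
        using elim(6) off by (simp add: d_def z_def s_def)
      define E where "E = exp (- L * potential i d z)"
      have k16: "k \<le> 1/16" using k by simp
      define q where "q = d / (pi * ((Re s)\<^sup>2 + d\<^sup>2))"
      have q: "norm (gap_slope d s + q) \<le> 6 * k * q" "q > 0"
        using gap_slope_estimate[OF dpos k(1) k16 cone] by (simp_all add: q_def)
      define l where "l = L * m * q"
      have l: "l \<ge> 0" using L m q by (simp add: l_def)
      \<comment> \<open>the derivative is \<open>E * X\<close> plus the small contribution of the other bodies, and \<open>X\<close> is close to \<open>1 + l * a\<close>\<close>
      define X where "X = 1 - L * (z - b i) * potential_slope i d z"
      have ps: "potential_slope i d z = gap_slope d s * cnj (e v) + other' d z"
        unfolding potential_slope_def other'_def s_def
        using finite_V[OF assms(1)] assms(2) by (simp add: sum.remove[of "V i" v])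
      have zb: "(z - b i) * cnj (e v) = m * a + s"
      proof -
        have "m * a = (v - b i) * cnj (e v)" using m by (simp add: a_def axis_def m_def)
        thus ?thesis by (simp add: s_def coord_def algebra_simps)
      qed
      have XX: "X - (1 + l * a) = - (L * ((m * a + s) * (gap_slope d s + q))) + L * s * q - L * (z - b i) * other' d z"
      proof -
        have "X = 1 - L * (((z - b i) * cnj (e v)) * gap_slope d s) - L * (z - b i) * other' d z"
          unfolding X_def ps by (simp add: algebra_simps)
        thus ?thesis unfolding zb by (simp add: l_def algebra_simps)
      qed
      have ns: "norm s \<le> m / 2000" using elim(4) by (simp add: s_def z_def)
      have nq: "norm (complex_of_real q) = q" using q by simp
      have "norm (X - (1 + l * a)) \<le> L * ((m + m / 2000) * (6 * k * q)) + L * (m / 2000) * q + 1/400"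
      proof -
        have na: "norm a = 1" using axis[OF assms(1,2)] by (simp add: a_def)
        have "norm (m * a + s) \<le> m + m / 2000"
          by (rule order_trans[OF norm_triangle_ineq]) (use na ns m in \<open>simp add: norm_mult\<close>)
        hence 1: "norm (L * ((m * a + s) * (gap_slope d s + q))) \<le> L * ((m + m / 2000) * (6 * k * q))"
          unfolding norm_mult using q L m k by (intro mult_mono) auto
        have 2: "norm (L * s * q) \<le> L * (m / 2000) * q"
          unfolding norm_mult using ns L q m by (intro mult_mono) auto
        have 3: "norm (L * (z - b i) * other' d z) \<le> 1/400"
          using elim(2) L by (simp add: norm_mult d_def z_def)
        have "norm (- A + B - C) \<le> norm A + norm B + norm C" for A B C :: complex
          using norm_triangle_ineq4[of "- A + B" C] norm_triangle_ineq[of "- A" B] by simp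
        thus ?thesis unfolding XX using 1 2 3 by (meson add_mono order_trans)
      qed
      also have "L * ((m + m / 2000) * (6 * k * q)) + L * (m / 2000) * q = l * (6 * k * (2001/2000) + 1/2000)"
        by (simp add: l_def algebra_simps)
      also have "\<dots> \<le> l * (1/100)" using l k by (intro mult_left_mono) auto
      finally have nX: "norm (X - (1 + l * a)) \<le> (1 + l) / 100" by simp
      have na: "norm a = 1" "Re a \<ge> 0" using axis[OF assms(1,2)] by (simp_all add: a_def)
      have "norm (1 + l * a) \<le> 1 + l"
        by (rule order_trans[OF norm_triangle_ineq]) (use na l in \<open>simp add: norm_mult\<close>)
      hence nX2: "norm X \<le> (1 + l) * (101/100)"
        using nX norm_triangle_ineq[of "1 + l * a" "X - (1 + l * a)"] by (simp add: field_simps)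
      have nondeg: "Re s \<noteq> 0 \<or> \<bar>Im s\<bar> < d" using cone dpos by auto
      have "\<bar>Im (other_potential i v d z)\<bar> \<le> norm (other_potential i v d z)" by (rule abs_Im_le_cmod)
      hence "L * \<bar>Im (other_potential i v d z)\<bar> \<le> 1/400"
        using elim(1) mult_left_mono[of "\<bar>Im (other_potential i v d z)\<bar>" "norm (other_potential i v d z)" L] L
        unfolding d_def z_def by linarith
      moreover have "L * \<bar>Im (gap_step d s)\<bar> \<le> L * (2 * k)"
        using Im_gap_step[OF dpos k(1) k16 cone] L by (intro mult_left_mono) auto
      moreover have "L * \<bar>Im (potential i d z)\<bar> \<le> L * \<bar>Im (gap_step d s)\<bar> + L * \<bar>Im (other_potential i v d z)\<bar>"
        unfolding pot using L by (simp flip: distrib_left)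
      ultimately have "L * \<bar>Im (potential i d z)\<bar> \<le> 1/100" using k by linarith
      hence "\<bar>Im (- L * potential i d z)\<bar> \<le> 1/100" using L by (simp add: abs_mult)
      hence nE: "norm (E / norm E - 1) \<le> 1/100"
        using exp_unit_part[of "- L * potential i d z"] by (simp add: E_def)
      have "Re (other_potential i v d z) \<le> norm (other_potential i v d z)" by (rule complex_Re_le_cmod)
      hence "L * Re (other_potential i v d z) \<le> 1"
        using elim(1) mult_left_mono[of "Re (other_potential i v d z)" "norm (other_potential i v d z)" L] L
        unfolding d_def z_def by linarith
      moreover have "L * Re (gap_step d s) \<le> L" using Re_gap_step[OF dpos nondeg] L by simp
      ultimately have "L * Re (potential i d z) \<le> L + 1" unfolding pot by (simp add: distrib_left)
      hence lowE: "norm E \<ge> exp (- L - 1)" by (simp add: E_def)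
      have E0: "norm E > 0" by (simp add: E_def)
      define G where "G = rest_slope i L d z"
      have nG: "norm (G / norm E) \<le> 1/100"
      proof -
        have "norm G \<le> exp (- L - 1) / 100" using elim(3) by (simp add: G_def d_def z_def)
        also have "\<dots> \<le> norm E / 100" using lowE by simp
        finally show ?thesis using E0 by (simp add: norm_divide field_simps)
      qed
      define T where "T = E / norm E * X + G / norm E"
      have slope: "squeeze_slope L d z = norm E * T"
      proof -
        have "squeeze_slope L d z = E * X + G"
          unfolding squeeze_slope_split[OF assms(1)] E_def X_def G_def by simp
        thus ?thesis using E0 by (simp add: T_def distrib_left)
      qed
      have "T - (1 + l * a) = (E / norm E - 1) * X + (X - (1 + l * a)) + G / norm E"
        by (simp add: T_def algebra_simps)
      hence "norm (T - (1 + l * a)) \<le> norm (E / norm E - 1) * norm X + norm (X - (1 + l * a)) + norm (G / norm E)"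
        by (metis norm_mult norm_triangle_mono norm_triangle_ineq order_refl add_mono)
      also have "\<dots> \<le> (1/100) * ((1 + l) * (101/100)) + (1 + l) / 100 + 1/100"
        using nE nX nX2 nG by (intro add_mono mult_mono) auto
      also have "\<dots> \<le> (1 + l) / 10" using l by (simp add: field_simps)
      finally have "Re (cnj (1 + a) * T * u) > 0"
        using k u by (intro cone_positive[OF na l]) auto
      hence "norm E * Re (cnj (1 + a) * T * u) > 0" using E0 by simp
      also have "norm E * Re (cnj (1 + a) * T * u) = Re (of_real (norm E) * (cnj (1 + a) * T * u))"
        by (simp only: Re_complex_of_real Im_complex_of_real times_complex.sel)
      also have "of_real (norm E) * (cnj (1 + a) * T * u) = cnj (1 + a) * squeeze_slope L d z * u"
        by (simp add: slope)
      finally show "Re (cnj (1 + axis i v) * squeeze_slope L (fst p) (snd p) * u) > 0"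
        by (simp add: a_def d_def z_def)
    qed
  qed
qed

end

section \<open>Limits of the squeezing map\<close>

lemma gap_filterD:
  assumes "\<forall>\<^sub>F p in gap_filter z. Q (fst p) (snd p)"
  obtains U D where "open U" "z \<in> U" "eventually D (at_right 0)" "\<And>d w. D d \<Longrightarrow> w \<in> U \<Longrightarrow> Q d w"
proof -
  obtain D G where DG: "eventually D (at_right 0)" "eventually G (nhds z)" "\<forall>d y. D d \<longrightarrow> G y \<longrightarrow> Q d y"
    using assms unfolding eventually_prod_filter by auto
  obtain U where "open U" "z \<in> U" "\<forall>y\<in>U. G y"
    using DG(2) unfolding eventually_nhds by auto
  with DG that show ?thesis by blast
qed

lemma gap_filter_pair:
  assumes "\<forall>\<^sub>F p in gap_filter x. Q (fst p) (snd p)" "\<forall>\<^sub>F p in gap_filter y. R (fst p) (snd p)"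
  shows "\<forall>\<^sub>F p in at_right 0 \<times>\<^sub>F nhds (x, y). Q (fst p) (fst (snd p)) \<and> R (fst p) (snd (snd p))"
proof -
  obtain U D where U: "open U" "x \<in> U" "eventually D (at_right 0)" "\<And>d w. D d \<Longrightarrow> w \<in> U \<Longrightarrow> Q d w"
    using gap_filterD[OF assms(1)] by metis
  obtain U' D' where U': "open U'" "y \<in> U'" "eventually D' (at_right 0)" "\<And>d w. D' d \<Longrightarrow> w \<in> U' \<Longrightarrow> R d w"
    using gap_filterD[OF assms(2)] by metis
  have "eventually (\<lambda>d. D d \<and> D' d) (at_right 0)" using U U' eventually_conj by blast
  moreover have "eventually (\<lambda>q. q \<in> U \<times> U') (nhds (x, y))"
    unfolding eventually_nhds using U U' by (intro exI[of _ "U \<times> U'"]) (auto intro: open_Times)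
  ultimately show ?thesis
    unfolding eventually_prod_filter
    using U(4) U'(4) by (intro exI[of _ "\<lambda>d. D d \<and> D' d"] exI[of _ "\<lambda>q. q \<in> U \<times> U'"]) auto
qed

context gapped_walls begin

text \<open>Contains every limit point that \<open>potential i d w\<close> has when \<open>d\<close> tends to
0 and \<open>w\<close> tends to \<open>z\<close> in \<open>K\<close>; at a gap this may be any number between
the values on the two sides.\<close>

definition depth :: "'i \<Rightarrow> complex \<Rightarrow> real set" where
  "depth i z = (if z \<in> V i then {0..1} else if z \<in> P i then {1} else {0})"

lemma depth_bounds: "r \<in> depth i z \<Longrightarrow> 0 \<le> r \<and> r \<le> 1"
  by (auto simp: depth_def split: if_splits)

text \<open>At a gap the imaginary part of \<open>gap_step\<close> is small in the cusps, so only its real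
part survives, and that lies between 0 and 1.\<close>

lemma potential_near_depth:
  assumes "i \<in> I" "z0 \<in> K" "\<epsilon> > 0"
  shows "\<forall>\<^sub>F p in gap_filter z0. snd p \<in> K \<longrightarrow>
           (\<exists>r\<in>depth i z0. norm (potential i (fst p) (snd p) - of_real r) < \<epsilon>)"
proof (cases "z0 \<in> V i")
  case True
  define k where "k = min (1/16) (\<epsilon> / 8)"
  have k: "0 < k" "k \<le> 1/16" "k \<le> \<epsilon> / 8" using assms by (auto simp: k_def)
  have "\<forall>\<^sub>F p in gap_filter z0. snd p \<in> K \<longrightarrow> \<bar>Im (coord z0 (snd p))\<bar> \<le> k * \<bar>Re (coord z0 (snd p))\<bar>"
    using gap_filter_nhds[OF K_near_V[OF assms(1) True k(1)]] by (simp add: coord_def)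
  moreover have "\<forall>\<^sub>F p in gap_filter z0. norm (other_potential i z0 (fst p) (snd p)) < \<epsilon> / 2"
    using tendsto_norm[OF other_potential_tendsto[OF assms(1) True]] assms
    by (intro order_tendstoD(2)[where y = 0]) auto
  ultimately show ?thesis using potential_near_V[OF assms(1) True] K_off_cut[OF assms(1) True] gap_filter_pos
  proof eventually_elim
    case (elim p)
    show ?case
    proof
      assume "snd p \<in> K"
      define t where "t = gap_step (fst p) (coord z0 (snd p))"
      have off: "off_cut z0 p" using elim \<open>snd p \<in> K\<close> by simp
      have "\<bar>Im t\<bar> \<le> 2 * k"
        unfolding t_def using elim \<open>snd p \<in> K\<close> k by (intro Im_gap_step) auto
      moreover have "0 \<le> Re t" "Re t \<le> 1"
        unfolding t_def using Re_gap_step elim off unfolding off_cut_def by auto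
      moreover have "potential i (fst p) (snd p) - of_real (Re t) = \<i> * Im t + other_potential i z0 (fst p) (snd p)"
        using elim off complex_eq[of t] by (simp add: t_def[symmetric] algebra_simps)
      moreover have "norm (\<i> * Im t + other_potential i z0 (fst p) (snd p)) \<le> \<bar>Im t\<bar> + norm (other_potential i z0 (fst p) (snd p))"
        by (rule order_trans[OF norm_triangle_ineq]) (simp add: norm_mult)
      ultimately show "\<exists>r\<in>depth i z0. norm (potential i (fst p) (snd p) - of_real r) < \<epsilon>"
        using elim k True assms by (intro bexI[of _ "Re t"]) (auto simp: depth_def)
    qed
  qed
next
  case False
  hence "z0 \<notin> frontier (P i)" using K_frontier assms by blast
  from tendstoD[OF potential_tendsto[OF assms(1) this] assms(3)] show ?thesis
    by eventually_elim (use False in \<open>auto simp: depth_def dist_norm\<close>)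
qed

text \<open>Contains the limit points of \<open>squeeze L d w\<close> for \<open>L \<in> A\<close> when
\<open>d\<close> tends to 0 and \<open>w\<close> tends to \<open>z\<close> in \<open>K\<close>. For a single
\<open>L\<close> this is one point unless \<open>z\<close> is a gap, in which case it is the whole tentacle, a
radial segment that ends at \<open>z\<close>.\<close>

definition shade :: "real set \<Rightarrow> complex \<Rightarrow> complex set" where
  "shade A z = (\<Union>i\<in>{i\<in>I. z \<in> P i}. (\<lambda>(L, r). b i + (z - b i) * exp (- of_real (L * r))) ` (A \<times> depth i z))
      \<union> (if z \<in> (\<Union>i\<in>I. P i) then {} else {z})"

lemma compact_shade: "compact A \<Longrightarrow> compact (shade A z)"
  unfolding shade_def
proof (intro compact_Un compact_UN compact_continuous_image)
  show "finite {i \<in> I. z \<in> P i}" using finite_I by simp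
  show "compact A \<Longrightarrow> compact (A \<times> depth i z)" for i by (intro compact_Times) (auto simp: depth_def)
qed (auto intro!: continuous_intros simp: case_prod_unfold)

lemma shade_mono: "A \<subseteq> B \<Longrightarrow> shade A z \<subseteq> shade B z"
  unfolding shade_def by (intro Un_mono UN_mono image_mono Sigma_mono order_refl)

lemma V_subset_P: "i \<in> I \<Longrightarrow> V i \<subseteq> P i"
  using V_in_P by blast

text \<open>The bodies are disjoint, so at most one of them moves a given point.\<close>

lemma shade_sum:
  assumes "\<And>i. i \<in> I \<Longrightarrow> r i \<in> depth i z" "L \<in> A"
  shows "z + (\<Sum>i\<in>I. (z - b i) * (exp (- of_real (L * r i)) - 1)) \<in> shade A z"
proof (cases "\<exists>i\<in>I. z \<in> P i")
  case True
  then obtain i where i: "i \<in> I" "z \<in> P i" by blast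
  have "r j = 0" if "j \<in> I - {i}" for j
    using assms(1)[of j] disjoint_P[of i j] V_subset_P[of j] i that by (auto simp: depth_def split: if_splits)
  hence "(\<Sum>i\<in>I. (z - b i) * (exp (- of_real (L * r i)) - 1)) = (z - b i) * (exp (- of_real (L * r i)) - 1)"
    unfolding sum.remove[OF finite_I i(1)] by simp
  hence "z + (\<Sum>i\<in>I. (z - b i) * (exp (- of_real (L * r i)) - 1)) = (case (L, r i) of (L, r) \<Rightarrow> b i + (z - b i) * exp (- of_real (L * r)))"
    by (simp add: algebra_simps)
  moreover have "(L, r i) \<in> A \<times> depth i z" using assms i by auto
  ultimately have "z + (\<Sum>i\<in>I. (z - b i) * (exp (- of_real (L * r i)) - 1))
      \<in> (\<lambda>(L, r). b i + (z - b i) * exp (- of_real (L * r))) ` (A \<times> depth i z)"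
    by (rule image_eqI)
  thus ?thesis unfolding shade_def using i by blast
next
  case False
  hence "r j = 0" if "j \<in> I" for j
    using assms(1)[of j] V_subset_P[of j] that by (auto simp: depth_def split: if_splits)
  thus ?thesis using False by (auto simp: shade_def)
qed

text \<open>The map is a continuous function of the potentials, and these are close to numbers in
\<open>depth\<close>, with errors that do not depend on \<open>L\<close>.\<close>

lemma squeeze_near_shade:
  assumes z0: "z0 \<in> K" and e: "\<epsilon> > 0" and M: "M \<ge> 0"
  shows "\<forall>\<^sub>F p in gap_filter z0. snd p \<in> K \<longrightarrow>
           (\<forall>L\<in>{0..M}. \<exists>w\<in>shade {L} z0. dist (squeeze L (fst p) (snd p)) w < \<epsilon>)"
proof -
  define B where "B = 1 + (\<Sum>i\<in>I. norm (z0 - b i))"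
  have B: "B \<ge> 1" unfolding B_def by (simp add: sum_nonneg)
  define n where "n = real (card I)"
  define \<eta> where "\<eta> = min 1 (\<epsilon> / (2 * B))"
  have \<eta>: "0 < \<eta>" "\<eta> \<le> 1" "\<eta> * B \<le> \<epsilon> / 2" using e B by (auto simp: \<eta>_def min_def field_simps)
  have "((\<lambda>w::complex. exp w - 1) \<longlongrightarrow> exp 0 - 1) (nhds 0)"
    by (intro tendsto_intros filterlim_ident)
  hence "\<forall>\<^sub>F w::complex in nhds 0. dist (exp w - 1) 0 < \<eta>"
    using tendstoD[OF _ \<eta>(1)] by fastforce
  then obtain \<rho> where \<rho>: "\<rho> > 0" "\<And>w::complex. norm w < \<rho> \<Longrightarrow> norm (exp w - 1) < \<eta>"
    unfolding eventually_nhds_metric by (auto simp: dist_norm)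
  define \<rho>' where "\<rho>' = \<rho> / (M + 1)"
  have \<rho>': "\<rho>' > 0" "M * \<rho>' < \<rho>" using \<rho> M by (auto simp: \<rho>'_def field_simps)
  have "\<forall>\<^sub>F p in gap_filter z0. \<forall>i\<in>I. snd p \<in> K \<longrightarrow>
           (\<exists>r\<in>depth i z0. norm (potential i (fst p) (snd p) - of_real r) < \<rho>')"
    by (intro eventually_ball_finite finite_I ballI potential_near_depth z0 \<rho>')
  moreover have "\<forall>\<^sub>F p in gap_filter z0. dist (snd p) z0 < \<epsilon> / (2 * (1 + 3 * n))"
    using tendstoD[OF gap_filter_snd] e by (simp add: n_def add_pos_nonneg)
  ultimately show ?thesis
  proof eventually_elim
    case (elim p)
    show ?case
    proof (intro impI ballI)
      fix L assume zK: "snd p \<in> K" and L: "L \<in> {0..M}"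
      define d z where "d = fst p" and "z = snd p"
      obtain r where r: "\<And>i. i \<in> I \<Longrightarrow> r i \<in> depth i z0" "\<And>i. i \<in> I \<Longrightarrow> norm (potential i d z - of_real (r i)) < \<rho>'"
        using elim(1) zK unfolding d_def z_def by metis
      define w where "w = z0 + (\<Sum>i\<in>I. (z0 - b i) * (exp (- of_real (L * r i)) - 1))"
      have summand: "norm ((z - b i) * (exp (- L * potential i d z) - 1) - (z0 - b i) * (exp (- of_real (L * r i)) - 1))
          \<le> 3 * norm (z - z0) + norm (z0 - b i) * \<eta>" if i: "i \<in> I" for i
      proof -
        define h where "h = - L * (potential i d z - of_real (r i))"
        define x where "x = exp (- complex_of_real (L * r i))"
        have "norm h = L * norm (potential i d z - of_real (r i))"
          using L by (simp add: h_def norm_mult)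
        also have "\<dots> \<le> M * \<rho>'" using L r(2)[OF i] by (intro mult_mono) auto
        finally have nh: "norm (exp h - 1) < \<eta>" using \<rho> \<rho>' by auto
        have "norm x = exp (- (L * r i))" by (simp add: x_def norm_exp_eq_Re)
        also have "\<dots> \<le> 1" using L depth_bounds[OF r(1)[OF i]] by simp
        finally have nx: "norm x \<le> 1" .
        have ex: "exp (- L * potential i d z) = x * exp h"
          by (simp add: x_def h_def algebra_simps flip: exp_add)
        have "norm (x * exp h - 1) \<le> norm x * norm (exp h) + 1"
          by (rule order_trans[OF norm_triangle_ineq4]) (simp add: norm_mult)
        also have "\<dots> \<le> 1 * 2 + 1"
        proof -
          have "norm (exp h) \<le> norm (exp h - 1) + 1" using norm_triangle_ineq[of "exp h - 1" 1] by simp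
          thus ?thesis using nx nh \<eta> by (intro add_mono mult_mono) auto
        qed
        finally have n3: "norm (x * exp h - 1) \<le> 3" by simp
        have "(z - b i) * (exp (- L * potential i d z) - 1) - (z0 - b i) * (x - 1)
            = (z - z0) * (x * exp h - 1) + (z0 - b i) * (x * (exp h - 1))"
          unfolding ex by (simp add: algebra_simps)
        also have "norm \<dots> \<le> norm (z - z0) * norm (x * exp h - 1) + norm (z0 - b i) * (norm x * norm (exp h - 1))"
          by (rule order_trans[OF norm_triangle_ineq]) (simp add: norm_mult)
        also have "\<dots> \<le> norm (z - z0) * 3 + norm (z0 - b i) * (1 * \<eta>)"
          using n3 nx nh by (intro add_mono mult_mono mult_left_mono) auto
        finally show ?thesis by (simp add: x_def mult_ac)
      qed
      have "norm (squeeze L d z - w) = norm ((z - z0) + (\<Sum>i\<in>I. (z - b i) * (exp (- L * potential i d z) - 1) - (z0 - b i) * (exp (- of_real (L * r i)) - 1)))"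
        unfolding squeeze_def w_def by (simp add: sum_subtractf add_diff_add)
      also have "\<dots> \<le> norm (z - z0) + (\<Sum>i\<in>I. 3 * norm (z - z0) + norm (z0 - b i) * \<eta>)"
        by (intro order_trans[OF norm_triangle_ineq] add_mono order_refl sum_norm_le summand)
      also have "\<dots> = (1 + 3 * n) * norm (z - z0) + (\<Sum>i\<in>I. norm (z0 - b i)) * \<eta>"
        by (simp add: sum.distrib n_def algebra_simps sum_distrib_left)
      also have "(1 + 3 * n) * norm (z - z0) < \<epsilon> / 2"
      proof -
        have "1 + 3 * n > 0" by (simp add: n_def add_pos_nonneg)
        thus ?thesis using elim(2) by (simp add: dist_norm z_def field_simps)
      qed
      also have "(\<Sum>i\<in>I. norm (z0 - b i)) * \<eta> \<le> B * \<eta>" using \<eta> by (intro mult_right_mono) (auto simp: B_def)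
      also have "\<dots> \<le> \<epsilon> / 2" using \<eta> by (simp add: mult.commute)
      finally have "dist (squeeze L d z) w < \<epsilon>" by (simp add: dist_norm)
      moreover have "w \<in> shade {L} z0" unfolding w_def by (rule shade_sum) (use r in auto)
      ultimately show "\<exists>w\<in>shade {L} z0. dist (squeeze L (fst p) (snd p)) w < \<epsilon>"
        unfolding d_def z_def by blast
    qed
  qed
qed

text \<open>A closed set that misses all limit points over a compact set is missed by the map itself as soon
as \<open>d\<close> is small.\<close>

lemma squeeze_avoids:
  assumes "closed C" "compact K0" "K0 \<subseteq> K" "compact A" "A \<subseteq> {0..M}"
    and "\<And>z. z \<in> K0 \<Longrightarrow> shade A z \<inter> C = {}"
  shows "\<forall>\<^sub>F d in at_right 0. \<forall>z\<in>K0. \<forall>L\<in>A. squeeze L d z \<notin> C"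
proof (cases "M \<ge> 0")
  case True
  show ?thesis
  proof (rule compact_eventually_ball[OF assms(2)])
    fix z assume z: "z \<in> K0"
    obtain \<epsilon> where \<epsilon>: "\<epsilon> > 0" "\<And>x y. x \<in> shade A z \<Longrightarrow> y \<in> C \<Longrightarrow> \<epsilon> \<le> dist x y"
      using separate_compact_closed[OF compact_shade[OF assms(4)] assms(1,6)] z by metis
    have "z \<in> K" using z assms by auto
    from squeeze_near_shade[OF this \<epsilon>(1) True]
    show "\<forall>\<^sub>F p in at_right 0 \<times>\<^sub>F nhds z. snd p \<in> K0 \<longrightarrow> (\<forall>L\<in>A. squeeze L (fst p) (snd p) \<notin> C)"
    proof eventually_elim
      case (elim p)
      show ?case
      proof (intro impI ballI notI)
        fix L assume "snd p \<in> K0" and L: "L \<in> A" and C: "squeeze L (fst p) (snd p) \<in> C"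
        then obtain w where "w \<in> shade {L} z" "dist (squeeze L (fst p) (snd p)) w < \<epsilon>"
          using elim assms by blast
        moreover have "shade {L} z \<subseteq> shade A z" using L by (intro shade_mono) auto
        ultimately show False using \<epsilon>(2)[of w "squeeze L (fst p) (snd p)"] C by (auto simp: dist_commute)
      qed
    qed
  qed
next
  case False
  hence "A = {}" using assms(5) by auto
  thus ?thesis by simp
qed

lemma shade_subset_P:
  assumes "i \<in> I" "z \<in> P i" "A \<subseteq> {0..}"
  shows "shade A z \<subseteq> P i"
proof
  fix w assume "w \<in> shade A z"
  then obtain j L r where j: "j \<in> I" "z \<in> P j" "L \<in> A" "r \<in> depth j z"
      and w: "w = b j + (z - b j) * exp (- of_real (L * r))"
    unfolding shade_def using assms by (auto split: if_splits)
  have "j = i" using j assms disjoint_P by blast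
  define t where "t = exp (- (L * r))"
  have "L * r \<ge> 0" using j assms depth_bounds by (intro mult_nonneg_nonneg) auto
  hence t: "0 \<le> t" "t \<le> 1" by (auto simp: t_def)
  have "w = (1 - t) *\<^sub>R b i + t *\<^sub>R z"
    unfolding w t_def \<open>j = i\<close> by (simp add: scaleR_conv_of_real algebra_simps exp_of_real[symmetric])
  moreover have "b i \<in> P i" using b_interior[OF assms(1)] interior_subset by blast
  ultimately show "w \<in> P i" using convexD_alt[OF convex_P[OF assms(1)] _ assms(2)] t by blast
qed

lemma shade_outside: "z \<notin> (\<Union>i\<in>I. P i) \<Longrightarrow> shade A z \<subseteq> {z}"
  unfolding shade_def by auto

lemma shade_inside:
  assumes "i \<in> I" "z \<in> P i" "w \<in> shade A z"
  obtains L r where "L \<in> A" "r \<in> depth i z" "w = b i + (z - b i) * of_real (exp (- (L * r)))"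
proof -
  obtain j L r where j: "j \<in> I" "z \<in> P j" "L \<in> A" "r \<in> depth j z"
      and w: "w = b j + (z - b j) * exp (- of_real (L * r))"
    using assms unfolding shade_def by (auto split: if_splits)
  have "j = i" using j assms disjoint_P by blast
  thus ?thesis using that[OF j(3), of r] j w by (simp flip: exp_of_real)
qed

lemma contracted_frontier_interior:
  assumes "i \<in> I" "z \<in> P i" "0 < t" "t < 1"
  shows "b i + (z - b i) * of_real t \<in> interior (P i)"
proof (cases "z = b i")
  case True
  thus ?thesis using b_interior[OF assms(1)] by simp
next
  case False
  have "b i + (z - b i) * of_real t \<in> open_segment (b i) z"
    unfolding in_segment using assms False
    by (auto simp: scaleR_conv_of_real algebra_simps intro!: exI[of _ t])
  thus ?thesis
    using in_interior_closure_convex_segment[OF convex_P[OF assms(1)] b_interior[OF assms(1)], of z]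
      assms closure_subset by blast
qed

text \<open>The limit points of points of \<open>P i\<close> lie on rays from \<open>b i\<close>. If two of
them coincide, then one of the two original points is an interior contraction of the other and at the same
time a gap, which lies on the boundary.\<close>

lemma shade_disjoint_same:
  assumes i: "i \<in> I" "z \<in> K" "w \<in> K" "z \<in> P i" "w \<in> P i" "z \<noteq> w" and L: "L > 0"
    and r: "r \<in> depth i z" "r' \<in> depth i w" "r' \<le> r"
  shows "b i + (z - b i) * of_real (exp (- (L * r))) \<noteq> b i + (w - b i) * of_real (exp (- (L * r')))"
proof
  assume eq: "b i + (z - b i) * of_real (exp (- (L * r))) = b i + (w - b i) * of_real (exp (- (L * r')))"
  define t where "t = exp (- (L * (r - r')))"
  have "(w - b i) * of_real (exp (- (L * r'))) = ((z - b i) * of_real t) * of_real (exp (- (L * r')))"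
    using eq by (simp add: t_def algebra_simps flip: of_real_mult exp_add)
  hence "w - b i = (z - b i) * of_real t" by (subst (asm) mult_right_cancel) auto
  hence w: "w = b i + (z - b i) * of_real t" by (simp add: algebra_simps)
  have "r \<noteq> r'" using w i by (auto simp: t_def)
  hence "r' < r" using r by simp
  hence "w \<in> V i" using r i by (auto simp: depth_def split: if_splits)
  hence "w \<notin> interior (P i)" using V_frontier[OF i(1)] by (auto simp: frontier_def)
  moreover have "0 < t" "t < 1" using L \<open>r' < r\<close> by (auto simp: t_def)
  ultimately show False using contracted_frontier_interior[OF i(1) i(4)] w by blast
qed

text \<open>In the limit the squeezing map is injective as a relation. This is what separates the images of
distant points.\<close>

lemma shade_disjoint:
  assumes "z \<in> K" "w \<in> K" "z \<noteq> w" and L: "L > 0"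
  shows "shade {L} z \<inter> shade {L} w = {}"
proof -
  have A: "{L} \<subseteq> {0..}" using L by simp
  have one: "shade {L} x \<inter> shade {L} y = {}" if "x \<notin> (\<Union>i\<in>I. P i)" "x \<noteq> y" for x y
  proof (cases "y \<in> (\<Union>i\<in>I. P i)")
    case True
    then obtain j where "j \<in> I" "y \<in> P j" by blast
    from shade_subset_P[OF this A] shade_outside[OF that(1)] show ?thesis
      using that \<open>j \<in> I\<close> by blast
  next
    case False
    from shade_outside[OF this] shade_outside[OF that(1)] show ?thesis using that by blast
  qed
  show ?thesis
  proof (cases "z \<in> (\<Union>i\<in>I. P i) \<and> w \<in> (\<Union>i\<in>I. P i)")
    case False
    thus ?thesis using one[of z w] one[of w z] assms(3) by blast
  next
    case True
    then obtain i j where ij: "i \<in> I" "z \<in> P i" "j \<in> I" "w \<in> P j" by blast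
    show ?thesis
    proof (cases "i = j")
      case False
      thus ?thesis using shade_subset_P[OF ij(1,2) A] shade_subset_P[OF ij(3,4) A] disjoint_P[OF ij(1,3)] by blast
    next
      case True
      show ?thesis
      proof (rule ccontr)
        assume "shade {L} z \<inter> shade {L} w \<noteq> {}"
        then obtain x where x: "x \<in> shade {L} z" "x \<in> shade {L} w" by blast
        obtain r where r: "r \<in> depth i z" "x = b i + (z - b i) * of_real (exp (- (L * r)))"
          using shade_inside[OF ij(1,2) x(1)] by auto
        obtain r' where r': "r' \<in> depth i w" "x = b i + (w - b i) * of_real (exp (- (L * r')))"
          using shade_inside[OF ij(3,4) x(2)] True by auto
        show False
        proof (cases "r' \<le> r")
          case le: True
          from shade_disjoint_same[OF ij(1) assms(1,2) ij(2) _ assms(3) L r(1) r'(1) le] show False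
            using r r' ij True by simp
        next
          case False
          hence le: "r \<le> r'" by simp
          from shade_disjoint_same[OF ij(1) assms(2,1) _ ij(2) assms(3)[symmetric] L r'(1) r(1) le] show False
            using r r' ij True by simp
        qed
      qed
    qed
  qed
qed

end

section \<open>Univalence of the squeezing map\<close>

lemma injective_of_Re_deriv_pos:
  fixes f f' :: "complex \<Rightarrow> complex"
  assumes "\<And>\<xi>. \<xi> \<in> closed_segment z w \<Longrightarrow> (f has_field_derivative f' \<xi>) (at \<xi>)"
    and "\<And>\<xi>. \<xi> \<in> closed_segment z w \<Longrightarrow> Re (c * f' \<xi>) > 0" and "z \<noteq> w"
  shows "f z \<noteq> f w"
proof -
  have "Re (c / (w - z) * f z) < Re (c / (w - z) * f w)"
    by (rule Re_strict_increase_along_segment[OF assms(1)]) (use assms in auto)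
  thus ?thesis by auto
qed

text \<open>The pairs of points near which \<open>f\<close> identifies no two distinct points form an open
neighbourhood of \<open>K \<times> K\<close>: off the diagonal by continuity, on the diagonal because the
derivative does not vanish. By compactness it contains the square of a neighbourhood of
\<open>K\<close>.\<close>

lemma injective_near_compact:
  fixes f :: "complex \<Rightarrow> complex"
  assumes "compact K" "f analytic_on K" "inj_on f K" "\<And>z. z \<in> K \<Longrightarrow> deriv f z \<noteq> 0"
  obtains N where "open N" "K \<subseteq> N" "f holomorphic_on N" "inj_on f N"
proof -
  obtain N0 where N0: "open N0" "K \<subseteq> N0" "f holomorphic_on N0"
    using assms(2) unfolding analytic_on_holomorphic by auto
  have cont: "continuous_on N0 f" using N0 by (simp add: holomorphic_on_imp_continuous_on)
  have "\<exists>W. open W \<and> p \<in> W \<and> (\<forall>q\<in>W. fst q \<in> N0 \<and> snd q \<in> N0 \<and> (f (fst q) = f (snd q) \<longrightarrow> fst q = snd q))"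
    if p: "p \<in> K \<times> K" for p
  proof (cases "fst p = snd p")
    case True
    have "fst p \<in> N0" "deriv f (fst p) \<noteq> 0" using p N0 assms by auto
    then obtain r where r: "r > 0" "ball (fst p) r \<subseteq> N0" "inj_on f (ball (fst p) r)"
      using has_complex_derivative_locally_injective[OF N0(3) _ N0(1)] by metis
    have "p \<in> ball (fst p) r \<times> ball (fst p) r" using r True by (auto simp: mem_Times_iff)
    moreover have "\<forall>q\<in>ball (fst p) r \<times> ball (fst p) r. fst q \<in> N0 \<and> snd q \<in> N0 \<and> (f (fst q) = f (snd q) \<longrightarrow> fst q = snd q)"
      using r by (auto simp: inj_on_def)
    ultimately show ?thesis by (intro exI[of _ "ball (fst p) r \<times> ball (fst p) r"]) (auto intro: open_Times)
  next
    case False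
    hence ne: "f (fst p) \<noteq> f (snd p)" using p assms(3) by (auto simp: inj_on_def mem_Times_iff)
    have "continuous_on (N0 \<times> N0) (\<lambda>q. dist (f (fst q)) (f (snd q)))"
      by (intro continuous_intros continuous_on_compose2[OF cont]) auto
    hence "open ((N0 \<times> N0) \<inter> (\<lambda>q. dist (f (fst q)) (f (snd q))) -` {0<..})"
      by (rule continuous_open_preimage) (use N0 open_Times in auto)
    moreover have "p \<in> (N0 \<times> N0) \<inter> (\<lambda>q. dist (f (fst q)) (f (snd q))) -` {0<..}"
      using p N0 ne by (auto simp: mem_Times_iff)
    ultimately show ?thesis
      by (intro exI[of _ "(N0 \<times> N0) \<inter> (\<lambda>q. dist (f (fst q)) (f (snd q))) -` {0<..}"]) auto
  qed
  then obtain W where W: "\<And>p. p \<in> K \<times> K \<Longrightarrow> open (W p) \<and> p \<in> W p \<and>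
      (\<forall>q\<in>W p. fst q \<in> N0 \<and> snd q \<in> N0 \<and> (f (fst q) = f (snd q) \<longrightarrow> fst q = snd q))"
    by metis
  have "compact (K \<times> K)" using assms compact_Times by blast
  then obtain e where e: "e > 0" "(\<Union>p\<in>K \<times> K. ball p e) \<subseteq> (\<Union>p\<in>K \<times> K. W p)"
    using compact_subset_open_imp_ball_epsilon_subset[of "K \<times> K" "\<Union>p\<in>K \<times> K. W p"] W by blast
  define N where "N = (\<Union>x\<in>K. ball x (e/2))"
  have key: "fst q \<in> N0 \<and> snd q \<in> N0 \<and> (f (fst q) = f (snd q) \<longrightarrow> fst q = snd q)" if q: "q \<in> N \<times> N" for q
  proof -
    obtain x y where xy: "x \<in> K" "y \<in> K" "dist x (fst q) < e/2" "dist y (snd q) < e/2"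
      using q by (auto simp: N_def mem_Times_iff)
    have "dist (x, y) q \<le> dist x (fst q) + dist y (snd q)"
      by (cases q) (auto simp: dist_Pair_Pair intro!: sqrt_sum_squares_le_sum)
    hence "q \<in> ball (x, y) e" using xy by simp
    hence "q \<in> (\<Union>p\<in>K \<times> K. W p)" using e xy by blast
    thus ?thesis using W by blast
  qed
  show ?thesis
  proof
    show "open N" by (auto simp: N_def)
    show "K \<subseteq> N" using e by (auto simp: N_def)
    have "N \<subseteq> N0" using key by (metis fst_conv mem_Sigma_iff subsetI)
    thus "f holomorphic_on N" using N0 holomorphic_on_subset by blast
    show "inj_on f N" using key by (force simp: inj_on_def)
  qed
qed

lemma gap_filter_eventuallyD:
  assumes "\<forall>\<^sub>F p in gap_filter z. Q p"
  obtains U D where "open U" "z \<in> U" "eventually D (at_right 0)" "\<And>d w. D d \<Longrightarrow> w \<in> U \<Longrightarrow> Q (d, w)"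
  using gap_filterD[of "\<lambda>d w. Q (d, w)" z] assms by auto

context gapped_walls begin

lemma squeeze_close:
  assumes "compact K0" "K0 \<subseteq> K" "\<And>i. i \<in> I \<Longrightarrow> K0 \<inter> P i = {}" "\<epsilon> > 0" "L \<ge> 0"
  shows "\<forall>\<^sub>F d in at_right 0. \<forall>z\<in>K0. dist (squeeze L d z) z < \<epsilon>"
proof (rule compact_eventually_ball[OF assms(1)])
  fix z0 assume z0: "z0 \<in> K0"
  have out: "shade {L} z0 \<subseteq> {z0}" using z0 assms by (intro shade_outside) auto
  have "z0 \<in> K" using z0 assms by auto
  from squeeze_near_shade[OF this half_gt_zero[OF assms(4)] assms(5)]
  have "\<forall>\<^sub>F p in gap_filter z0. snd p \<in> K \<longrightarrow> dist (squeeze L (fst p) (snd p)) z0 < \<epsilon> / 2"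
    by eventually_elim (use out assms in fastforce)
  moreover have "\<forall>\<^sub>F p in gap_filter z0. dist (snd p) z0 < \<epsilon> / 2"
    using tendstoD[OF gap_filter_snd, of "\<epsilon> / 2" z0] assms(4) by simp
  ultimately show "\<forall>\<^sub>F p in gap_filter z0. snd p \<in> K0 \<longrightarrow> dist (squeeze L (fst p) (snd p)) (snd p) < \<epsilon>"
  proof eventually_elim
    case (elim p)
    show ?case using elim assms(2) dist_triangle2[of "squeeze L (fst p) (snd p)" "snd p" z0] by auto
  qed
qed

text \<open>The local form of univalence that is propagated to all of \<open>K\<close> by compactness.\<close>

definition good_near :: "real \<Rightarrow> real \<Rightarrow> complex set \<Rightarrow> bool" where
  "good_near L d U \<longleftrightarrow> inj_on (squeeze L d) (U \<inter> K) \<and>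
     (\<forall>z\<in>U \<inter> K. squeeze L d analytic_on {z} \<and> deriv (squeeze L d) z \<noteq> 0)"

lemma squeeze_slope_tendsto:
  assumes "\<And>i. i \<in> I \<Longrightarrow> z \<notin> frontier (P i)"
  shows "((\<lambda>p. squeeze_slope L (fst p) (snd p)) \<longlongrightarrow> of_real (1 + (\<Sum>i\<in>I. exp (- L * of_bool (z \<in> P i)) - 1))) (gap_filter z)"
proof -
  have "((\<lambda>p. exp (- of_real L * potential j (fst p) (snd p)) - 1 + (snd p - b j) *
      (- of_real L * potential_slope j (fst p) (snd p) * exp (- of_real L * potential j (fst p) (snd p)))) \<longlongrightarrow>
       exp (- of_real L * of_bool (z \<in> P j)) - 1 + (z - b j) * (- of_real L * (0::complex) * exp (- of_real L * of_bool (z \<in> P j)))) (gap_filter z)"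
    if "j \<in> I" for j
    by (intro tendsto_add tendsto_diff tendsto_mult tendsto_exp tendsto_const potential_tendsto potential_slope_tendsto gap_filter_snd that assms)
  hence "((\<lambda>p. squeeze_slope L (fst p) (snd p)) \<longlongrightarrow> 1 + (\<Sum>j\<in>I. exp (- of_real L * of_bool (z \<in> P j)) - 1 + (z - b j) * (- of_real L * (0::complex) * exp (- of_real L * of_bool (z \<in> P j))))) (gap_filter z)"
    unfolding squeeze_slope_def by (rule tendsto_add[OF tendsto_const tendsto_sum])
  also have "1 + (\<Sum>j\<in>I. exp (- of_real L * of_bool (z \<in> P j)) - 1 + (z - b j) * (- of_real L * (0::complex) * exp (- of_real L * of_bool (z \<in> P j))))
      = of_real (1 + (\<Sum>i\<in>I. exp (- L * of_bool (z \<in> P i)) - 1))"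
  proof -
    have "complex_of_real (of_bool B) = of_bool B" for B by (cases B) auto
    thus ?thesis by (simp flip: exp_of_real)
  qed
  finally show ?thesis .
qed

lemma limit_slope_pos:
  fixes L :: real
  shows "1 + (\<Sum>i\<in>I. exp (- L * of_bool (z \<in> P i)) - 1) > 0"
proof (cases "\<exists>i\<in>I. z \<in> P i")
  case True
  then obtain i where i: "i \<in> I" "z \<in> P i" by blast
  have "(\<Sum>j\<in>I - {i}. exp (- L * of_bool (z \<in> P j)) - 1) = 0"
    using i disjoint_P by (intro sum.neutral) auto
  thus ?thesis unfolding sum.remove[OF finite_I i(1)] using i by simp
next
  case False
  hence "(\<Sum>i\<in>I. exp (- L * of_bool (z \<in> P i)) - 1) = 0" by (intro sum.neutral) auto
  thus ?thesis by simp
qed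

text \<open>Away from the walls the derivative tends to 1 or to \<open>exp (- L)\<close>, so its real part is
positive on a ball.\<close>

lemma good_near_regular:
  assumes "\<And>i. i \<in> I \<Longrightarrow> z0 \<notin> frontier (P i)"
  shows "\<exists>U. open U \<and> z0 \<in> U \<and> (\<forall>\<^sub>F d in at_right 0. good_near L d U)"
proof -
  have "\<forall>\<^sub>F p in gap_filter z0. \<forall>i\<in>I.
           (potential i (fst p) has_field_derivative potential_slope i (fst p) (snd p)) (at (snd p))"
    by (intro eventually_ball_finite finite_I ballI potential_deriv_ev assms)
  moreover have "\<forall>\<^sub>F p in gap_filter z0. Re (squeeze_slope L (fst p) (snd p)) > 0"
    using tendsto_Re[OF squeeze_slope_tendsto[OF assms, of L]] limit_slope_pos[of L z0]
    by (intro order_tendstoD(1)) auto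
  ultimately have "\<forall>\<^sub>F p in gap_filter z0. (squeeze L (fst p) has_field_derivative squeeze_slope L (fst p) (snd p)) (at (snd p))
      \<and> Re (squeeze_slope L (fst p) (snd p)) > 0"
    by eventually_elim (auto intro: squeeze_deriv)
  from gap_filter_eventuallyD[OF this, unfolded fst_conv snd_conv] obtain U0 D where U0: "open U0" "z0 \<in> U0" "eventually D (at_right 0)"
    "\<And>d z. D d \<Longrightarrow> z \<in> U0 \<Longrightarrow> (squeeze L d has_field_derivative squeeze_slope L d z) (at z) \<and> Re (squeeze_slope L d z) > 0"
    by blast
  obtain r where r: "r > 0" "ball z0 r \<subseteq> U0" using U0 open_contains_ball by blast
  have "good_near L d (ball z0 r)" if D: "D d" for d
  proof -
    have der: "(squeeze L d has_field_derivative squeeze_slope L d z) (at z)" "Re (squeeze_slope L d z) > 0"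
      if "z \<in> ball z0 r" for z using U0(4)[OF D] r that by blast+
    have "squeeze L d z \<noteq> squeeze L d w" if "z \<in> ball z0 r" "w \<in> ball z0 r" "z \<noteq> w" for z w
    proof (rule injective_of_Re_deriv_pos[where f = "squeeze L d" and c = 1 and f' = "squeeze_slope L d"])
      have "closed_segment z w \<subseteq> ball z0 r" using that convex_ball by (simp add: closed_segment_subset)
      thus "\<And>\<xi>. \<xi> \<in> closed_segment z w \<Longrightarrow> (squeeze L d has_field_derivative squeeze_slope L d \<xi>) (at \<xi>)"
        "\<And>\<xi>. \<xi> \<in> closed_segment z w \<Longrightarrow> Re (1 * squeeze_slope L d \<xi>) > 0" using der by auto
    qed (use that in auto)
    moreover have "squeeze L d analytic_on ball z0 r"
      unfolding analytic_on_open[OF open_ball] using der(1)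
      by (meson field_differentiable_at_within field_differentiable_def holomorphic_on_def)
    moreover have "deriv (squeeze L d) z \<noteq> 0" if "z \<in> ball z0 r" for z
      using DERIV_imp_deriv[OF der(1)[OF that]] der(2)[OF that] by auto
    ultimately show ?thesis unfolding good_near_def inj_on_def
      by (meson Int_iff analytic_on_subset empty_subsetI insert_subset)
  qed
  hence "\<forall>\<^sub>F d in at_right 0. good_near L d (ball z0 r)" by (rule eventually_mono[OF U0(3)])
  thus ?thesis using r by (intro exI[of _ "ball z0 r"]) auto
qed

text \<open>Two points in the same half of the double cone are joined by a segment inside it, on which the
derivative stays in a half-plane. Two points in opposite halves are compared through the vertex: with
\<open>c'\<close> chosen by the normal at the gap, \<open>Re (c' * squeeze L d z)\<close> lies above its value
at the vertex on one half and below it on the other.\<close>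

lemma good_near_V:
  assumes i: "i \<in> I" "v \<in> V i" and L: "L > 0"
  shows "\<exists>U. open U \<and> v \<in> U \<and> (\<forall>\<^sub>F d in at_right 0. good_near L d U)"
proof -
  define c where "c = cnj (1 + axis i v)"
  obtain k where k: "0 < k" "k \<le> 1/16"
    "\<forall>\<^sub>F p in gap_filter v. \<bar>Im (coord v (snd p))\<bar> \<le> k * \<bar>Re (coord v (snd p))\<bar> \<longrightarrow>
       (\<forall>u. norm (u - 1) \<le> k \<longrightarrow> Re (c * squeeze_slope L (fst p) (snd p) * u) > 0)"
    unfolding c_def by (rule squeeze_slope_near_V[OF i L])
  have "\<forall>\<^sub>F p in gap_filter v. snd p \<in> K \<longrightarrow> \<bar>Im (coord v (snd p))\<bar> \<le> k * \<bar>Re (coord v (snd p))\<bar>"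
    using gap_filter_nhds[OF K_near_V[OF i k(1)]] by (simp add: coord_def)
  with k(3) squeeze_deriv_near_V[OF i] gap_filter_pos
  have "\<forall>\<^sub>F p in gap_filter v. fst p > 0 \<and>
      (snd p \<in> K \<longrightarrow> \<bar>Im (coord v (snd p))\<bar> \<le> k * \<bar>Re (coord v (snd p))\<bar>) \<and>
      (off_cut v (fst p, snd p) \<longrightarrow> (squeeze L (fst p) has_field_derivative squeeze_slope L (fst p) (snd p)) (at (snd p))) \<and>
      (\<bar>Im (coord v (snd p))\<bar> \<le> k * \<bar>Re (coord v (snd p))\<bar> \<longrightarrow>
       (\<forall>u. norm (u - 1) \<le> k \<longrightarrow> Re (c * squeeze_slope L (fst p) (snd p) * u) > 0))"
    by eventually_elim auto
  from gap_filter_eventuallyD[OF this, unfolded fst_conv snd_conv] obtain U0 D where U0: "open U0" "v \<in> U0" "eventually D (at_right 0)"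
    "\<And>d z. D d \<Longrightarrow> z \<in> U0 \<Longrightarrow> d > 0 \<and>
      (z \<in> K \<longrightarrow> \<bar>Im (coord v z)\<bar> \<le> k * \<bar>Re (coord v z)\<bar>) \<and>
      (off_cut v (d, z) \<longrightarrow> (squeeze L d has_field_derivative squeeze_slope L d z) (at z)) \<and>
      (\<bar>Im (coord v z)\<bar> \<le> k * \<bar>Re (coord v z)\<bar> \<longrightarrow>
       (\<forall>u. norm (u - 1) \<le> k \<longrightarrow> Re (c * squeeze_slope L d z * u) > 0))"
    by blast
  obtain r where r: "r > 0" "ball v r \<subseteq> U0" using U0 open_contains_ball by blast
  have "good_near L d (ball v r)" if D: "D d" for d
  proof -
    define cone where "cone = {z \<in> ball v r. \<bar>Im (coord v z)\<bar> \<le> k * \<bar>Re (coord v z)\<bar>}"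
    have d: "d > 0" using U0(4)[OF D U0(2)] by blast
    have Kcone: "z \<in> cone" if "z \<in> ball v r" "z \<in> K" for z
      using U0(4)[OF D, of z] r that by (auto simp: cone_def)
    have der0: "(squeeze L d has_field_derivative squeeze_slope L d z) (at z)" if "z \<in> ball v r" "off_cut v (d, z)" for z
      using U0(4)[OF D, of z] r that by auto
    have cone_off: "off_cut v (d, z)" if "z \<in> cone" for z
      using that d by (auto simp: cone_def off_cut_def)
    have der: "(squeeze L d has_field_derivative squeeze_slope L d z) (at z)" if "z \<in> cone" for z
      using der0[OF _ cone_off[OF that]] that by (auto simp: cone_def)
    have pos: "Re (c * squeeze_slope L d z * u) > 0" if "z \<in> cone" "norm (u - 1) \<le> k" for z u
      using U0(4)[OF D, of z] r that by (auto simp: cone_def)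
    have pos1: "Re (c * squeeze_slope L d z) > 0" if "z \<in> cone" for z
      using pos[OF that, of 1] k by simp
    have vcone: "v \<in> cone" using r by (simp add: cone_def coord_def)
    have coord_seg: "coord v ((1 - t) *\<^sub>R z + t *\<^sub>R w) = (1 - t) * coord v z + t * coord v w" for t z w
      by (simp add: coord_def scaleR_conv_of_real algebra_simps)
    have seg_ball: "closed_segment z w \<subseteq> ball v r" if "z \<in> cone" "w \<in> cone" for z w
      using that convex_ball by (simp add: closed_segment_subset cone_def)
    \<comment> \<open>two points in the same half of the double cone\<close>
    have same: "squeeze L d z \<noteq> squeeze L d w"
      if zw: "z \<in> cone" "w \<in> cone" "z \<noteq> w" and s: "Re (coord v z) * Re (coord v w) \<ge> 0" for z w
    proof (rule injective_of_Re_deriv_pos[where f = "squeeze L d" and c = c and f' = "squeeze_slope L d"])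
      have sub: "closed_segment z w \<subseteq> cone"
      proof
        fix \<xi> assume \<xi>: "\<xi> \<in> closed_segment z w"
        then obtain t where t: "0 \<le> t" "t \<le> 1" "\<xi> = (1 - t) *\<^sub>R z + t *\<^sub>R w" unfolding in_segment by auto
        have "\<bar>Im (coord v \<xi>)\<bar> \<le> (1 - t) * \<bar>Im (coord v z)\<bar> + t * \<bar>Im (coord v w)\<bar>"
          unfolding t(3) coord_seg using t
          by (simp add: order_trans[OF abs_triangle_ineq] abs_mult)
        also have "\<dots> \<le> (1 - t) * (k * \<bar>Re (coord v z)\<bar>) + t * (k * \<bar>Re (coord v w)\<bar>)"
          using zw t by (intro add_mono mult_left_mono) (auto simp: cone_def)
        also have "\<dots> = k * \<bar>(1 - t) * Re (coord v z) + t * Re (coord v w)\<bar>"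
        proof -
          have "(0 \<le> Re (coord v z) \<and> 0 \<le> Re (coord v w)) \<or> (Re (coord v z) \<le> 0 \<and> Re (coord v w) \<le> 0)"
            using s by (auto simp: zero_le_mult_iff)
          thus ?thesis
          proof
            assume sg: "0 \<le> Re (coord v z) \<and> 0 \<le> Re (coord v w)"
            hence "(1 - t) * Re (coord v z) + t * Re (coord v w) \<ge> 0" using t by simp
            hence e: "\<bar>(1 - t) * Re (coord v z) + t * Re (coord v w)\<bar> = (1 - t) * Re (coord v z) + t * Re (coord v w)"
              by simp
            show ?thesis unfolding e using sg by (simp add: algebra_simps)
          next
            assume sg: "Re (coord v z) \<le> 0 \<and> Re (coord v w) \<le> 0"
            hence "(1 - t) * Re (coord v z) + t * Re (coord v w) \<le> 0"
              using t by (intro add_nonpos_nonpos mult_nonneg_nonpos) auto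
            hence e: "\<bar>(1 - t) * Re (coord v z) + t * Re (coord v w)\<bar> = - ((1 - t) * Re (coord v z) + t * Re (coord v w))"
              by simp
            show ?thesis unfolding e using sg by (simp add: algebra_simps)
          qed
        qed
        also have "(1 - t) * Re (coord v z) + t * Re (coord v w) = Re (coord v \<xi>)"
          unfolding t(3) coord_seg by simp
        finally show "\<xi> \<in> cone" using seg_ball[OF zw(1,2)] \<xi> by (auto simp: cone_def)
      qed
      show "\<And>\<xi>. \<xi> \<in> closed_segment z w \<Longrightarrow> (squeeze L d has_field_derivative squeeze_slope L d \<xi>) (at \<xi>)"
        "\<And>\<xi>. \<xi> \<in> closed_segment z w \<Longrightarrow> Re (c * squeeze_slope L d \<xi>) > 0"
        using sub der pos1 by auto
    qed (use zw in auto)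
    \<comment> \<open>two points in opposite halves are compared through the vertex\<close>
    define c' where "c' = c * cnj (e v)"
    have ev: "e v * cnj (e v) = 1"
      using norm_e[OF i] by (simp add: complex_norm_square[symmetric])
    have ray: "Re (c' * squeeze_slope L d \<xi> * (w - v)) * sgn (Re (coord v w)) > 0"
      if w: "w \<in> cone" "Re (coord v w) \<noteq> 0" and \<xi>: "\<xi> \<in> cone" for w \<xi>
    proof -
      define x y where "x = Re (coord v w)" and "y = Im (coord v w)"
      define u where "u = coord v w / x"
      have x: "x \<noteq> 0" using w by (simp add: x_def)
      have "w - v = coord v w * e v" using ev by (simp add: coord_def mult.assoc mult.commute[of "cnj (e v)"])
      hence wv: "w - v = x * u * e v" using x by (simp add: u_def)
      have "u - 1 = \<i> * (y / x)" using x complex_eq[of "coord v w"]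
        by (simp add: u_def x_def[symmetric] y_def[symmetric] field_simps)
      hence "norm (u - 1) = \<bar>y\<bar> / \<bar>x\<bar>" by (simp add: norm_mult norm_divide)
      also have "\<dots> \<le> k" using w x by (simp add: cone_def x_def y_def field_simps)
      finally have nu: "norm (u - 1) \<le> k" .
      define R where "R = Re (c * squeeze_slope L d \<xi> * u)"
      have R: "R > 0" unfolding R_def by (rule pos[OF \<xi> nu])
      have "c' * squeeze_slope L d \<xi> * (w - v) = of_real x * (c * squeeze_slope L d \<xi> * u) * (e v * cnj (e v))"
        unfolding c'_def wv by (simp add: mult_ac)
      hence eq: "Re (c' * squeeze_slope L d \<xi> * (w - v)) = x * R" unfolding R_def
        unfolding ev by (simp only: mult_1_right Re_complex_of_real Im_complex_of_real times_complex.sel mult_zero_left diff_zero)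
      have "x * R * sgn x = \<bar>x\<bar> * R" by (simp add: abs_sgn mult_ac)
      moreover have "\<bar>x\<bar> * R > 0" using x R by simp
      ultimately show ?thesis unfolding eq x_def[symmetric] by linarith
    qed
    have seg_v: "closed_segment v w \<subseteq> cone" if w: "w \<in> cone" for w
    proof
      fix \<xi> assume \<xi>: "\<xi> \<in> closed_segment v w"
      then obtain t where t: "0 \<le> t" "t \<le> 1" "\<xi> = (1 - t) *\<^sub>R v + t *\<^sub>R w" unfolding in_segment by auto
      have "coord v \<xi> = t * coord v w" unfolding t(3) coord_seg by (simp add: coord_def)
      moreover have "t * \<bar>Im (coord v w)\<bar> \<le> t * (k * \<bar>Re (coord v w)\<bar>)"
        using w t by (intro mult_left_mono) (auto simp: cone_def)
      ultimately show "\<xi> \<in> cone" using seg_ball[OF vcone w] \<xi> t by (auto simp: cone_def abs_mult mult_ac)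
    qed
    have up: "Re (c' * squeeze L d v) < Re (c' * squeeze L d w)" if w: "w \<in> cone" "Re (coord v w) > 0" for w
    proof (rule Re_strict_increase_along_segment[where f = "squeeze L d" and f' = "squeeze_slope L d"])
      show "\<And>\<xi>. \<xi> \<in> closed_segment v w \<Longrightarrow> (squeeze L d has_field_derivative squeeze_slope L d \<xi>) (at \<xi>)"
        using seg_v[OF w(1)] der by blast
      show "\<And>\<xi>. \<xi> \<in> closed_segment v w \<Longrightarrow> Re (c' * squeeze_slope L d \<xi> * (w - v)) > 0"
        using seg_v[OF w(1)] ray[OF w(1)] w(2) by auto
    qed
    have down: "Re (c' * squeeze L d w) < Re (c' * squeeze L d v)" if w: "w \<in> cone" "Re (coord v w) < 0" for w
    proof (rule Re_strict_increase_along_segment[where f = "squeeze L d" and f' = "squeeze_slope L d"])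
      show "\<And>\<xi>. \<xi> \<in> closed_segment w v \<Longrightarrow> (squeeze L d has_field_derivative squeeze_slope L d \<xi>) (at \<xi>)"
        using seg_v[OF w(1)] der by (metis closed_segment_commute subsetD)
      show "Re (c' * squeeze_slope L d \<xi> * (v - w)) > 0" if "\<xi> \<in> closed_segment w v" for \<xi>
      proof -
        have "\<xi> \<in> cone" using seg_v[OF w(1)] that by (metis closed_segment_commute subsetD)
        from ray[OF w(1) _ this] w(2) have "Re (c' * squeeze_slope L d \<xi> * (w - v)) < 0" by simp
        moreover have "c' * squeeze_slope L d \<xi> * (v - w) = - (c' * squeeze_slope L d \<xi> * (w - v))"
          by (simp add: algebra_simps)
        ultimately show ?thesis by (metis neg_0_less_iff_less uminus_complex.sel(1))
      qed
    qed
    have inj: "squeeze L d z \<noteq> squeeze L d w" if zw: "z \<in> cone" "w \<in> cone" "z \<noteq> w" for z w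
    proof (cases "Re (coord v z) * Re (coord v w) \<ge> 0")
      case True
      thus ?thesis using same zw by blast
    next
      case False
      hence "(Re (coord v z) < 0 \<and> Re (coord v w) > 0) \<or> (Re (coord v z) > 0 \<and> Re (coord v w) < 0)"
        by (auto simp: not_le mult_less_0_iff)
      thus ?thesis using up[of z] up[of w] down[of z] down[of w] zw(1,2) by auto
    qed
    have "squeeze L d analytic_on {z}" if z: "z \<in> cone" for z
    proof -
      define O' where "O' = ball v r \<inter> {z. Re (coord v z) \<noteq> 0 \<or> \<bar>Im (coord v z)\<bar> < d}"
      have "open {z. Re (coord v z) \<noteq> 0 \<or> \<bar>Im (coord v z)\<bar> < d}"
        unfolding coord_def by (intro open_Collect_disj open_Collect_neq open_Collect_less continuous_intros)
      hence "open O'" by (auto simp: O'_def)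
      moreover have "squeeze L d holomorphic_on O'"
        unfolding holomorphic_on_def
      proof
        fix x assume "x \<in> O'"
        hence "(squeeze L d has_field_derivative squeeze_slope L d x) (at x)"
          using der0[of x] by (auto simp: O'_def off_cut_def)
        thus "squeeze L d field_differentiable at x within O'"
          by (meson field_differentiable_at_within field_differentiable_def)
      qed
      moreover have "z \<in> O'" using z cone_off[OF z] by (auto simp: O'_def cone_def off_cut_def)
      ultimately show ?thesis unfolding analytic_at by blast
    qed
    moreover have "deriv (squeeze L d) z \<noteq> 0" if "z \<in> cone" for z
      using DERIV_imp_deriv[OF der[OF that]] pos1[OF that] by auto
    ultimately show ?thesis unfolding good_near_def inj_on_def using Kcone inj by blast
  qed
  hence "\<forall>\<^sub>F d in at_right 0. good_near L d (ball v r)" by (rule eventually_mono[OF U0(3)])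
  thus ?thesis using r by (intro exI[of _ "ball v r"]) auto
qed

lemma good_near_K:
  assumes "z \<in> K" "L > 0"
  obtains U where "open U" "z \<in> U" "\<forall>\<^sub>F d in at_right 0. good_near L d U"
proof (cases "\<exists>i\<in>I. z \<in> frontier (P i)")
  case True
  then obtain i where "i \<in> I" "z \<in> V i" using K_frontier assms by blast
  thus ?thesis using good_near_V[OF _ _ assms(2)] that by blast
next
  case False
  thus ?thesis using good_near_regular that by blast
qed

text \<open>Two distinct points of \<open>K\<close> have disjoint compact sets of limit points, so
neighbourhoods of them have disjoint images for small \<open>d\<close>; near the diagonal of \<open>K \<times>
K\<close> the local statement applies.\<close>

theorem squeeze_univalent:
  assumes L: "L > 0"
  shows "\<forall>\<^sub>F d in at_right 0. inj_on (squeeze L d) K \<and> squeeze L d analytic_on K \<and>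
           (\<forall>z\<in>K. deriv (squeeze L d) z \<noteq> 0)"
proof -
  have "\<forall>\<^sub>F d in at_right 0. \<forall>z\<in>K. squeeze L d analytic_on {z} \<and> deriv (squeeze L d) z \<noteq> 0"
  proof (rule compact_eventually_ball[OF compact_K])
    fix z assume "z \<in> K"
    then obtain U where U: "open U" "z \<in> U" "\<forall>\<^sub>F d in at_right 0. good_near L d U"
      using good_near_K[OF _ L] by blast
    have "\<forall>\<^sub>F p in gap_filter z. snd p \<in> U" using U by (intro gap_filter_nhds) (auto simp: eventually_nhds)
    moreover have "\<forall>\<^sub>F p in gap_filter z. good_near L (fst p) U"
      using U(3) filterlim_fst[of "at_right (0::real)" "nhds z"] unfolding filterlim_iff by blast
    ultimately show "\<forall>\<^sub>F p in gap_filter z. snd p \<in> K \<longrightarrow>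
        squeeze L (fst p) analytic_on {snd p} \<and> deriv (squeeze L (fst p)) (snd p) \<noteq> 0"
      by eventually_elim (auto simp: good_near_def)
  qed
  moreover have "\<forall>\<^sub>F d in at_right 0. \<forall>q\<in>K \<times> K. squeeze L d (fst q) = squeeze L d (snd q) \<longrightarrow> fst q = snd q"
  proof (rule compact_eventually_ball)
    show "compact (K \<times> K)" using compact_K compact_Times by blast
    fix q assume q: "q \<in> K \<times> K"
    obtain x y where xy: "q = (x, y)" by (cases q)
    show "\<forall>\<^sub>F p in at_right 0 \<times>\<^sub>F nhds q. snd p \<in> K \<times> K \<longrightarrow>
        squeeze L (fst p) (fst (snd p)) = squeeze L (fst p) (snd (snd p)) \<longrightarrow> fst (snd p) = snd (snd p)"
    proof (cases "x = y")
      case True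
      obtain U where U: "open U" "x \<in> U" "\<forall>\<^sub>F d in at_right 0. good_near L d U"
        using good_near_K[OF _ L, of x] q xy by blast
      have 1: "\<forall>\<^sub>F p in gap_filter x. snd p \<in> U" using U by (intro gap_filter_nhds) (auto simp: eventually_nhds)
      moreover have "\<forall>\<^sub>F p in gap_filter x. good_near L (fst p) U"
        using U(3) filterlim_fst[of "at_right (0::real)" "nhds x"] unfolding filterlim_iff by blast
      ultimately have "\<forall>\<^sub>F p in gap_filter x. good_near L (fst p) U \<and> snd p \<in> U"
        by eventually_elim auto
      from gap_filter_pair[OF this 1] show ?thesis
        unfolding xy True[symmetric]
        by eventually_elim (auto simp: good_near_def inj_on_def)
    next
      case False
      have xyK: "x \<in> K" "y \<in> K" using q xy by auto
      obtain \<epsilon> where \<epsilon>: "\<epsilon> > 0" "\<And>a b. a \<in> shade {L} x \<Longrightarrow> b \<in> shade {L} y \<Longrightarrow> \<epsilon> \<le> dist a b"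
        using separate_compact_closed[OF compact_shade compact_imp_closed[OF compact_shade] shade_disjoint[OF xyK False L]]
        by (metis compact_insert compact_empty)
      have L0: "L \<ge> 0" using L by simp
      have ev: "\<forall>\<^sub>F p in gap_filter z. snd p \<in> K \<longrightarrow> (\<exists>w\<in>shade {L} z. dist (squeeze L (fst p) (snd p)) w < \<epsilon> / 2)"
        if "z \<in> K" for z
        using squeeze_near_shade[OF that half_gt_zero[OF \<epsilon>(1)] L0] by eventually_elim (use L in auto)
      from gap_filter_pair[OF ev[OF xyK(1)] ev[OF xyK(2)]] show ?thesis
        unfolding xy
      proof eventually_elim
        case (elim p)
        show ?case
        proof (intro impI)
          assume "snd p \<in> K \<times> K" and eq: "squeeze L (fst p) (fst (snd p)) = squeeze L (fst p) (snd (snd p))"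
          then obtain a b where ab: "a \<in> shade {L} x" "b \<in> shade {L} y"
            "dist (squeeze L (fst p) (fst (snd p))) a < \<epsilon> / 2" "dist (squeeze L (fst p) (snd (snd p))) b < \<epsilon> / 2"
            using elim by (auto simp: mem_Times_iff)
          have "dist a b < \<epsilon>" using ab(3,4) unfolding eq[symmetric]
            by (metis dist_commute dist_triangle_half_r)
          thus "fst (snd p) = snd (snd p)" using \<epsilon>(2)[OF ab(1,2)] by simp
        qed
      qed
    qed
  qed
  ultimately show ?thesis
  proof eventually_elim
    case (elim d)
    thus ?case using analytic_on_analytic_at[of "squeeze L d" K] by (auto simp: inj_on_def)
  qed
qed

end

section \<open>Chains of touching discs around a rectangle\<close>

text \<open>The integer points on the boundary of the rectangle \<open>[- n, 1] \<times> [- 1, 1]\<close>. The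
discs of radius \<open>1/2\<close> about them form a closed chain of touching discs.\<close>

definition grid :: "nat \<Rightarrow> (int \<times> int) set" where
  "grid n = {(k, l). - int n \<le> k \<and> k \<le> 1 \<and> -1 \<le> l \<and> l \<le> 1 \<and> (k = - int n \<or> k = 1 \<or> l = -1 \<or> l = 1)}"

definition grid_point :: "int \<times> int \<Rightarrow> complex" where
  "grid_point q = Complex (of_int (fst q)) (of_int (snd q))"

definition unit_rect :: "nat \<Rightarrow> complex set" where
  "unit_rect n = cbox (Complex (- real n) (-1)) (Complex 1 1)"

text \<open>The points at which consecutive discs of the chain touch.\<close>

definition unit_gaps :: "nat \<Rightarrow> complex set" where
  "unit_gaps n = (\<lambda>(k, s). Complex (of_int k + 1/2) s) ` ({- int n..0} \<times> {-1, 1})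
     \<union> (\<lambda>(x, t). Complex x t) ` ({- real n, 1} \<times> {-1/2, 1/2})"

definition unit_normal :: "complex \<Rightarrow> complex" where
  "unit_normal v = (if Im v = 1 then \<i> else if Im v = -1 then - \<i> else if Re v = 1 then 1 else -1)"

lemma finite_grid: "finite (grid n)"
  by (rule finite_subset[of _ "{- int n..1} \<times> {-1..1}"]) (auto simp: grid_def)

lemma finite_unit_gaps: "finite (unit_gaps n)"
  by (auto simp: unit_gaps_def)

lemma norm_unit_normal [simp]: "norm (unit_normal v) = 1"
  by (simp add: unit_normal_def)

lemma grid_point_dist: "p \<noteq> q \<Longrightarrow> dist (grid_point p) (grid_point q) \<ge> 1"
proof -
  assume "p \<noteq> q"
  hence "fst p \<noteq> fst q \<or> snd p \<noteq> snd q" by (auto simp: prod_eq_iff)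
  hence "1 \<le> \<bar>Re (grid_point p - grid_point q)\<bar> \<or> 1 \<le> \<bar>Im (grid_point p - grid_point q)\<bar>"
    by (auto simp: grid_point_def simp flip: of_int_diff of_int_abs)
  thus ?thesis
    using abs_Re_le_cmod[of "grid_point p - grid_point q"] abs_Im_le_cmod[of "grid_point p - grid_point q"]
    by (auto simp: dist_norm)
qed

lemma nearest_integer:
  fixes x :: real
  obtains k :: int where "of_int k - 1/2 \<le> x" "x < of_int k + 1/2"
  by (rule that[of "\<lfloor>x + 1/2\<rfloor>"]) linarith+

text \<open>The discs cover the boundary of the rectangle except for the points where they touch: a boundary
point that is not closer than \<open>1/2\<close> to its nearest grid point is exactly halfway between two of
them.\<close>

lemma unit_frontier_gap:
  assumes z: "z \<in> cbox (Complex (- real n) (-1)) (Complex 1 1) - box (Complex (- real n) (-1)) (Complex 1 1)"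
    and far: "\<And>q. q \<in> grid n \<Longrightarrow> dist z (grid_point q) \<ge> 1/2"
  shows "z \<in> unit_gaps n"
proof -
  define x y where "x = Re z" and "y = Im z"
  have zxy: "z = Complex x y" by (simp add: x_def y_def)
  have xy: "- real n \<le> x" "x \<le> 1" "-1 \<le> y" "y \<le> 1" "x = - real n \<or> x = 1 \<or> y = -1 \<or> y = 1"
    using z unfolding zxy by (auto simp: in_cbox_complex_iff in_box_complex_iff)
  consider "y = -1 \<or> y = 1" | "x = - real n \<or> x = 1" using xy by blast
  thus ?thesis
  proof cases
    case 1
    obtain k :: int where k: "of_int k - 1/2 \<le> x" "x < of_int k + 1/2" using nearest_integer .
    obtain l :: int where l: "y = of_int l" "l = -1 \<or> l = 1" using 1 by (metis of_int_1 of_int_minus)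
    have kb: "- int n \<le> k" "k \<le> 1" using k xy by linarith+
    hence "(k, l) \<in> grid n" using l by (auto simp: grid_def)
    from far[OF this] have "\<bar>x - of_int k\<bar> \<ge> 1/2"
      by (simp add: zxy grid_point_def dist_complex_def cmod_def l)
    hence x: "x = of_int (k - 1) + 1/2" using k by (auto simp: abs_if split: if_splits)
    hence "- int n \<le> k - 1" "k - 1 \<le> 0" using xy kb by linarith+
    hence "(k - 1, y) \<in> {- int n..0} \<times> {-1, 1}" using 1 by auto
    moreover have "z = (case (k - 1, y) of (k, s) \<Rightarrow> Complex (of_int k + 1/2) s)"
      using x zxy by simp
    ultimately show ?thesis unfolding unit_gaps_def by blast
  next
    case 2
    obtain l :: int where l: "of_int l - 1/2 \<le> y" "y < of_int l + 1/2" using nearest_integer .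
    obtain k :: int where k: "x = of_int k" "k = - int n \<or> k = 1" using 2 by (metis of_int_1 of_int_minus of_int_of_nat_eq)
    have lb: "-1 \<le> l" "l \<le> 1" using l xy by linarith+
    hence "(k, l) \<in> grid n" using k by (auto simp: grid_def)
    from far[OF this] have "\<bar>y - of_int l\<bar> \<ge> 1/2"
      by (simp add: zxy grid_point_def dist_complex_def cmod_def k)
    hence y: "y = of_int l - 1/2" using l by (auto simp: abs_if split: if_splits)
    hence "l = 0 \<or> l = 1" using xy lb by linarith
    hence "y = -1/2 \<or> y = 1/2" using y by auto
    hence "(x, y) \<in> {- real n, 1} \<times> {-1/2, 1/2}" using 2 by auto
    moreover have "z = (case (x, y) of (x, t) \<Rightarrow> Complex x t)" using zxy by simp
    ultimately show ?thesis unfolding unit_gaps_def by blast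
  qed
qed

lemma unit_gaps_cases:
  assumes "v \<in> unit_gaps n"
  obtains k s where "- int n \<le> k" "k \<le> 0" "s = -1 \<or> s = (1::real)" "v = Complex (of_int k + 1/2) s" "unit_normal v = s * \<i>"
  | x t where "x = - real n \<and> unit_normal v = -1 \<or> x = 1 \<and> unit_normal v = 1" "t = -1/2 \<or> t = 1/2" "v = Complex x t"
proof -
  consider (a) k s where "- int n \<le> k" "k \<le> 0" "s = -1 \<or> s = (1::real)" "v = Complex (of_int k + 1/2) s"
    | (b) x t where "x = - real n \<or> x = 1" "t = -1/2 \<or> t = 1/2" "v = Complex x t"
  proof -
    from assms consider "v \<in> (\<lambda>(k, s). Complex (of_int k + 1/2) s) ` ({- int n..0} \<times> {-1, 1})"
      | "v \<in> (\<lambda>(x, t). Complex x t) ` ({- real n, 1} \<times> {-1/2, 1/2})"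
      unfolding unit_gaps_def by blast
    thus ?thesis
    proof cases
      case 1
      then obtain k s where "k \<in> {- int n..0}" "s \<in> {-1, 1}" "v = Complex (of_int k + 1/2) s" by auto
      thus ?thesis using that(1)[of k s] by auto
    next
      case 2
      then obtain p where p: "p \<in> {- real n, 1} \<times> {-1/2, 1/2}" "v = (case p of (x, t) \<Rightarrow> Complex x t)"
        by (elim imageE)
      have "fst p = - real n \<or> fst p = 1" "snd p = -1/2 \<or> snd p = 1/2" "v = Complex (fst p) (snd p)"
        using p by auto
      thus ?thesis by (rule that(2))
    qed
  qed
  thus ?thesis
  proof cases
    case a
    have "unit_normal v = s * \<i>" using a by (auto simp: unit_normal_def)
    with a that(1) show ?thesis by blast
  next
    case b
    have "x = - real n \<and> unit_normal v = -1 \<or> x = 1 \<and> unit_normal v = 1"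
      using b by (auto simp: unit_normal_def)
    with b that(2) show ?thesis by blast
  qed
qed

lemma unit_gaps_frontier:
  assumes "v \<in> unit_gaps n"
  shows "v \<in> cbox (Complex (- real n) (-1)) (Complex 1 1) - box (Complex (- real n) (-1)) (Complex 1 1)"
  using assms
proof (cases rule: unit_gaps_cases)
  case (1 k s)
  have "real_of_int k \<ge> - real n" "real_of_int k \<le> 0" using 1 by linarith+
  thus ?thesis using 1 by (auto simp: in_cbox_complex_iff in_box_complex_iff)
next
  case (2 x t)
  thus ?thesis by (auto simp: in_cbox_complex_iff in_box_complex_iff)
qed

lemma unit_rect_near_gap:
  assumes "v \<in> unit_gaps n" "norm (z - v) < 1/4"
  shows "z \<in> unit_rect n \<longleftrightarrow> Re ((z - v) * cnj (unit_normal v)) \<le> 0"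
proof -
  have b: "\<bar>Re z - Re v\<bar> < 1/4" "\<bar>Im z - Im v\<bar> < 1/4"
    using abs_Re_le_cmod[of "z - v"] abs_Im_le_cmod[of "z - v"] assms(2) by simp_all
  show ?thesis using assms(1)
  proof (cases rule: unit_gaps_cases)
    case (1 k s)
    have "real_of_int k \<ge> - real n" "real_of_int k \<le> 0" using 1 by linarith+
    hence "- real n \<le> Re z" "Re z \<le> 1" using b 1(4) by (auto simp: abs_if split: if_splits)
    moreover have "Re ((z - v) * cnj (unit_normal v)) = s * (Im z - s)"
      using 1 by simp
    ultimately show ?thesis using 1(3,4) b(2)
      by (auto simp: unit_rect_def in_cbox_complex_iff)
  next
    case (2 x t)
    have "-1 \<le> Im z" "Im z \<le> 1" using b(2) 2(2,3) by (auto simp: abs_if split: if_splits)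
    moreover from 2 have "(x = - real n \<and> Re ((z - v) * cnj (unit_normal v)) = - (Re z - x)) \<or>
        (x = 1 \<and> Re ((z - v) * cnj (unit_normal v)) = Re z - x)"
      by auto
    ultimately show ?thesis using b(1) 2(3)
      by (auto simp: unit_rect_def in_cbox_complex_iff abs_if split: if_splits)
  qed
qed

text \<open>The common tangent of the two discs touching at a gap is normal to the wall.\<close>

lemma unit_gap_neighbours:
  assumes "v \<in> unit_gaps n"
  obtains p q where "p \<in> grid n" "q \<in> grid n"
    "grid_point p = v + \<i> * unit_normal v / 2" "grid_point q = v - \<i> * unit_normal v / 2"
  using assms
proof (cases rule: unit_gaps_cases)
  case (1 k s)
  have g: "(k, 1) \<in> grid n" "(k, -1) \<in> grid n" "(k + 1, 1) \<in> grid n" "(k + 1, -1) \<in> grid n"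
    using 1 by (auto simp: grid_def)
  show ?thesis
  proof (cases "s = 1")
    case True
    show ?thesis
      by (rule that[of "(k, 1)" "(k + 1, 1)"]) (use 1 g True in \<open>auto simp: grid_point_def complex_eq_iff\<close>)
  next
    case False
    hence "s = -1" using 1 by simp
    show ?thesis
      by (rule that[of "(k + 1, -1)" "(k, -1)"]) (use 1 g \<open>s = -1\<close> in \<open>auto simp: grid_point_def complex_eq_iff\<close>)
  qed
next
  case (2 x t)
  define l :: int where "l = (if t = 1/2 then 1 else 0)"
  define k :: int where "k = (if x = 1 then 1 else - int n)"
  have t: "t = of_int l - 1/2" "l = 0 \<or> l = 1" using 2 by (auto simp: l_def)
  have x: "x = of_int k" "k = 1 \<or> k = - int n" using 2 by (auto simp: k_def)
  have g: "(k, l) \<in> grid n" "(k, l - 1) \<in> grid n" using t x by (auto simp: grid_def)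
  have g': "grid_point (k, l) = v + \<i> / 2" "grid_point (k, l - 1) = v - \<i> / 2"
    using t(1) x(1) by (simp_all add: grid_point_def complex_eq_iff 2(3))
  have "unit_normal v = 1 \<or> unit_normal v = -1" using 2 by auto
  thus ?thesis
  proof
    assume "unit_normal v = 1"
    thus ?thesis
      by (intro that[of "(k, l)" "(k, l - 1)"]) (use g g' in simp_all)
  next
    assume "unit_normal v = -1"
    thus ?thesis
      by (intro that[of "(k, l - 1)" "(k, l)"]) (use g g' in simp_all)
  qed
qed

text \<open>Outside two discs of diameter 1 that touch at 0 one has \<open>\<bar>Im s\<bar> \<le>
\<bar>s\<bar>\<^sup>2\<close>, so near 0 what is left consists of two cusps tangent to the real axis.\<close>

lemma cusp_between_discs:
  fixes s :: complex
  assumes "norm (s - \<i> / 2) \<ge> 1/2" "norm (s + \<i> / 2) \<ge> 1/2" "norm s \<le> 1/2" "norm s \<le> k / 2"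
  shows "\<bar>Im s\<bar> \<le> k * \<bar>Re s\<bar>"
proof -
  have "(1/2)\<^sup>2 \<le> (norm (s - \<i> / 2))\<^sup>2" "(1/2)\<^sup>2 \<le> (norm (s + \<i> / 2))\<^sup>2"
    using assms by (intro power_mono; simp)+
  hence "Im s \<le> (norm s)\<^sup>2" "- Im s \<le> (norm s)\<^sup>2"
    unfolding cmod_power2 by (simp_all add: power2_eq_square algebra_simps)
  hence "\<bar>Im s\<bar> \<le> norm s * norm s" by (simp add: power2_eq_square)
  also have "\<dots> \<le> norm s * (\<bar>Re s\<bar> + \<bar>Im s\<bar>)"
    by (intro mult_left_mono cmod_le) auto
  finally have *: "\<bar>Im s\<bar> \<le> norm s * \<bar>Re s\<bar> + norm s * \<bar>Im s\<bar>" by (simp add: distrib_left)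
  have "norm s * \<bar>Im s\<bar> \<le> 1/2 * \<bar>Im s\<bar>" "norm s * \<bar>Re s\<bar> \<le> k / 2 * \<bar>Re s\<bar>"
    using assms by (intro mult_right_mono; simp)+
  with * show ?thesis by simp
qed

section \<open>Walls of discs around parallel segments\<close>

text \<open>For each height \<open>y\<close> the segment \<open>[0, 1] \<times> {y}\<close> is enclosed in the
rectangle \<open>[- h, 1 + 2 h] \<times> [y - h, y + h]\<close>, whose boundary is lined with touching discs
of radius \<open>h/2\<close>. The relation between \<open>n\<close> and \<open>h\<close> makes this a copy of
the unit configuration, scaled by \<open>h\<close>, with the origin placed at \<open>1 + h + \<i> y\<close>.
This point lies to the right of the segment, and the contraction towards it clears the segment.\<close>

locale disc_walls =
  fixes Y :: "real set" and h :: real and n :: nat and R :: real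
  assumes finite_Y: "finite Y" and h_pos: "h > 0" and n3: "n \<ge> 3" and n_h: "real n * h = 1 + 2 * h"
    and gap_Y: "\<And>y y'. y \<in> Y \<Longrightarrow> y' \<in> Y \<Longrightarrow> y \<noteq> y' \<Longrightarrow> \<bar>y - y'\<bar> > 6 * h"
    and inside_R: "\<And>y z. y \<in> Y \<Longrightarrow> - 2 * h \<le> Re z \<Longrightarrow> Re z \<le> 1 + 3 * h \<Longrightarrow> \<bar>Im z - y\<bar> \<le> 2 * h \<Longrightarrow> norm z < R"
begin

definition base :: "real \<Rightarrow> complex" where "base y = Complex (1 + h) y"
definition unscale :: "real \<Rightarrow> complex \<Rightarrow> complex" where "unscale y z = (z - base y) / of_real h"
definition scale :: "real \<Rightarrow> complex \<Rightarrow> complex" where "scale y z = base y + of_real h * z"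
definition rect :: "real \<Rightarrow> complex set" where "rect y = cbox (Complex (- h) (y - h)) (Complex (1 + 2 * h) (y + h))"
definition gaps :: "real \<Rightarrow> complex set" where "gaps y = scale y ` unit_gaps n"
text \<open>Rectangles of different heights are disjoint, so a gap determines its height.\<close>

definition normal :: "complex \<Rightarrow> complex" where "normal v = unit_normal (unscale (SOME y. y \<in> Y \<and> v \<in> gaps y) v)"
definition centers :: "complex set" where "centers = (\<Union>y\<in>Y. (\<lambda>q. scale y (grid_point q)) ` grid n)"
definition K :: "complex set" where "K = cball 0 R - (\<Union>c\<in>centers. ball c (h / 2))"

lemma unscale_scale [simp]: "unscale y (scale y z) = z" and scale_unscale [simp]: "scale y (unscale y z) = z"
  using h_pos by (simp_all add: unscale_def scale_def)

lemma dist_scale: "dist (scale y z) (scale y w) = h * dist z w"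
  using h_pos by (simp add: scale_def dist_norm norm_mult flip: right_diff_distrib)

lemma dist_unscale: "dist (unscale y z) w = dist z (scale y w) / h"
  using dist_scale[of y "unscale y z" w] h_pos by simp

lemma unscale_sel: "Re (unscale y z) = (Re z - 1 - h) / h" "Im (unscale y z) = (Im z - y) / h"
  by (simp_all add: unscale_def base_def Re_divide_of_real Im_divide_of_real)

lemma rect_unscale: "z \<in> rect y \<longleftrightarrow> unscale y z \<in> unit_rect n"
  unfolding rect_def unit_rect_def in_cbox_complex_iff unscale_sel
  using h_pos n_h by (simp add: field_simps)

lemma frontier_rect_unscale: "z \<in> frontier (rect y) \<longleftrightarrow>
    unscale y z \<in> cbox (Complex (- real n) (-1)) (Complex 1 1) - box (Complex (- real n) (-1)) (Complex 1 1)"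
  unfolding rect_def frontier_cbox Diff_iff in_cbox_complex_iff in_box_complex_iff unscale_sel
  using h_pos n_h by (simp add: field_simps)

lemma finite_centers: "finite centers"
  unfolding centers_def using finite_Y finite_grid by auto

lemma centers_bounds:
  assumes "q \<in> grid n"
  shows "- h \<le> Re (scale y (grid_point q))" "Re (scale y (grid_point q)) \<le> 1 + 2 * h"
    "\<bar>Im (scale y (grid_point q)) - y\<bar> \<le> h"
proof -
  have q: "- real n \<le> of_int (fst q)" "of_int (fst q) \<le> (1::real)" "-1 \<le> (of_int (snd q) :: real)" "of_int (snd q) \<le> (1::real)"
    using assms by (auto simp: grid_def)
  have "h * - real n \<le> h * of_int (fst q)" "h * of_int (fst q) \<le> h * 1" "\<bar>h * of_int (snd q)\<bar> \<le> h * 1"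
    using q h_pos mult_left_mono[OF q(1), of h] by (auto simp: abs_mult)
  thus "- h \<le> Re (scale y (grid_point q))" "Re (scale y (grid_point q)) \<le> 1 + 2 * h"
    "\<bar>Im (scale y (grid_point q)) - y\<bar> \<le> h"
    using n_h by (simp_all add: scale_def base_def grid_point_def algebra_simps)
qed

lemma centers_dist:
  assumes "c \<in> centers" "c' \<in> centers" "c \<noteq> c'"
  shows "dist c c' \<ge> h"
proof -
  obtain y q where c: "y \<in> Y" "q \<in> grid n" "c = scale y (grid_point q)" using assms by (auto simp: centers_def)
  obtain y' q' where c': "y' \<in> Y" "q' \<in> grid n" "c' = scale y' (grid_point q')" using assms by (auto simp: centers_def)
  show ?thesis
  proof (cases "y = y'")
    case True
    hence "q \<noteq> q'" using assms c c' by auto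
    thus ?thesis using grid_point_dist[of q q'] h_pos True by (simp add: c c' dist_scale)
  next
    case False
    have "h \<le> \<bar>Im c - Im c'\<bar>"
      using gap_Y[OF c(1) c'(1) False] centers_bounds(3)[OF c(2), of y] centers_bounds(3)[OF c'(2), of y'] h_pos
      unfolding c(3) c'(3) by linarith
    thus ?thesis using abs_Im_le_cmod[of "c - c'"] by (simp add: dist_norm)
  qed
qed

lemma rect_bounds: "z \<in> rect y \<Longrightarrow> - h \<le> Re z \<and> Re z \<le> 1 + 2 * h \<and> \<bar>Im z - y\<bar> \<le> h"
  by (auto simp: rect_def in_cbox_complex_iff)

lemma rect_disjoint:
  assumes "y \<in> Y" "y' \<in> Y" "y \<noteq> y'"
  shows "rect y \<inter> rect y' = {}"
proof (rule ccontr)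
  assume "rect y \<inter> rect y' \<noteq> {}"
  then obtain z where "z \<in> rect y" "z \<in> rect y'" by blast
  from this[THEN rect_bounds] gap_Y[OF assms] h_pos show False by linarith
qed

lemma gaps_frontier: "gaps y \<subseteq> frontier (rect y)"
  unfolding gaps_def using unit_gaps_frontier by (auto simp: frontier_rect_unscale)

lemma normal_eq:
  assumes "y \<in> Y" "v \<in> gaps y"
  shows "normal v = unit_normal (unscale y v)"
proof -
  have "closed (rect y')" for y' unfolding rect_def by (rule closed_cbox)
  hence sub: "gaps y' \<subseteq> rect y'" for y' using gaps_frontier frontier_subset_closed by blast
  have "(SOME y. y \<in> Y \<and> v \<in> gaps y) = y"
  proof (rule some_equality)
    show "y \<in> Y \<and> v \<in> gaps y" using assms by simp
    show "y' = y" if "y' \<in> Y \<and> v \<in> gaps y'" for y'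
      using that assms sub rect_disjoint[of y' y] by blast
  qed
  thus ?thesis by (simp add: normal_def)
qed

lemma K_far: "z \<in> K \<Longrightarrow> y \<in> Y \<Longrightarrow> q \<in> grid n \<Longrightarrow> dist (unscale y z) (grid_point q) \<ge> 1/2"
proof -
  assume z: "z \<in> K" "y \<in> Y" "q \<in> grid n"
  hence "scale y (grid_point q) \<in> centers" by (auto simp: centers_def)
  hence "h / 2 \<le> dist z (scale y (grid_point q))" using z by (auto simp: K_def dist_commute not_less)
  thus ?thesis using h_pos by (simp add: dist_unscale field_simps)
qed

lemma unscale_diff: "unscale y z - unscale y w = (z - w) / of_real h"
  by (simp add: unscale_def diff_divide_distrib)

text \<open>The discs removed from \<open>K\<close> close the walls up to the touching points, where two discs
leave a cusp on either side of the wall.\<close>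

lemma gapped_walls: "gapped_walls Y base rect gaps normal K"
proof
  show "finite Y" by (rule finite_Y)
  have "K = cball 0 R \<inter> - (\<Union>c\<in>centers. ball c (h / 2))" by (auto simp: K_def)
  thus "compact K" by (auto intro!: compact_Int_closed open_UN)
  show "convex (rect y)" "compact (rect y)" for y by (auto simp: rect_def)
  show "base y \<in> interior (rect y)" for y
    using h_pos by (simp add: rect_def base_def in_box_complex_iff)
  show "rect y \<inter> rect y' = {}" if "y \<in> Y" "y' \<in> Y" "y \<noteq> y'" for y y' using rect_disjoint[OF that] .
  show "finite (gaps y)" for y by (simp add: gaps_def finite_unit_gaps)
  show "gaps y \<subseteq> frontier (rect y)" for y by (rule gaps_frontier)
  show "norm (normal v) = 1" for v by (simp add: normal_def)
next
  fix y v assume yv: "y \<in> Y" "v \<in> gaps y"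
  have u: "unscale y v \<in> unit_gaps n" using yv by (auto simp: gaps_def)
  have "\<forall>\<^sub>F z in nhds v. dist z v < h / 4" unfolding eventually_nhds_metric using h_pos by (intro exI[of _ "h/4"]) auto
  thus "\<forall>\<^sub>F z in nhds v. (z \<in> rect y) = (Re ((z - v) * cnj (normal v)) \<le> 0)"
  proof eventually_elim
    case (elim z)
    have "norm (unscale y z - unscale y v) < 1/4"
      using elim h_pos by (simp add: unscale_diff norm_divide dist_norm field_simps)
    from unit_rect_near_gap[OF u this]
    have "z \<in> rect y \<longleftrightarrow> Re ((z - v) / of_real h * cnj (normal v)) \<le> 0"
      by (simp add: rect_unscale normal_eq[OF yv] unscale_diff)
    also have "(z - v) / of_real h * cnj (normal v) = ((z - v) * cnj (normal v)) / of_real h" by simp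
    also have "Re \<dots> \<le> 0 \<longleftrightarrow> Re ((z - v) * cnj (normal v)) \<le> 0"
      using h_pos by (simp only: Re_divide_of_real) (simp add: divide_le_0_iff)
    finally show ?case .
  qed
next
  fix y assume y: "y \<in> Y"
  show "K \<inter> frontier (rect y) \<subseteq> gaps y"
  proof
    fix z assume z: "z \<in> K \<inter> frontier (rect y)"
    have "unscale y z \<in> unit_gaps n"
      by (rule unit_frontier_gap) (use z frontier_rect_unscale K_far y in auto)
    thus "z \<in> gaps y" unfolding gaps_def by (metis imageI scale_unscale)
  qed
next
  fix y v and k :: real assume yv: "y \<in> Y" "v \<in> gaps y" and k: "k > 0"
  have u: "unscale y v \<in> unit_gaps n" using yv by (auto simp: gaps_def)
  define w where "w = unit_normal (unscale y v)"
  obtain p q where pq: "p \<in> grid n" "q \<in> grid n"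
    "grid_point p = unscale y v + \<i> * w / 2" "grid_point q = unscale y v - \<i> * w / 2"
    using unit_gap_neighbours[OF u] unfolding w_def by metis
  define m where "m = h * min (1/2) (k/2)"
  have m: "m > 0" using h_pos k by (simp add: m_def)
  have "\<forall>\<^sub>F z in nhds v. dist z v < m" unfolding eventually_nhds_metric using m by (intro exI[of _ m]) auto
  thus "\<forall>\<^sub>F z in nhds v. z \<in> K \<longrightarrow> \<bar>Im ((z - v) * cnj (normal v))\<bar> \<le> k * \<bar>Re ((z - v) * cnj (normal v))\<bar>"
  proof eventually_elim
    case (elim z)
    show ?case
    proof
      assume z: "z \<in> K"
      have w: "w * cnj w = 1" "norm w = 1" by (simp_all add: w_def complex_norm_square[symmetric])
      define s where "s = (unscale y z - unscale y v) * cnj w"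
      have zs: "unscale y z - unscale y v = s * w"
        using w(1) by (simp add: s_def mult.assoc mult.commute[of "cnj w"])
      have "norm s = dist z v / h"
        using w(2) h_pos by (simp add: s_def norm_mult unscale_diff norm_divide dist_norm)
      hence "h * norm s < h * min (1/2) (k/2)" using elim h_pos by (simp add: m_def)
      hence "norm s < min (1/2) (k/2)" using h_pos by simp
      moreover have "norm (s - \<i> / 2) \<ge> 1/2"
      proof -
        have "unscale y z - grid_point p = (s - \<i> / 2) * w" using zs pq(3) by (simp add: algebra_simps)
        thus ?thesis using K_far[OF z yv(1) pq(1)] w(2) by (simp add: dist_norm norm_mult)
      qed
      moreover have "norm (s + \<i> / 2) \<ge> 1/2"
      proof -
        have "unscale y z - grid_point q = (s + \<i> / 2) * w" using zs pq(4) by (simp add: algebra_simps)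
        thus ?thesis using K_far[OF z yv(1) pq(2)] w(2) by (simp add: dist_norm norm_mult)
      qed
      ultimately have "\<bar>Im s\<bar> \<le> k * \<bar>Re s\<bar>" by (intro cusp_between_discs) auto
      hence "\<bar>Im (of_real h * s)\<bar> \<le> k * \<bar>Re (of_real h * s)\<bar>"
        using h_pos by (simp add: abs_mult mult_ac)
      moreover have "of_real h * s = (z - v) * cnj (normal v)"
        using h_pos by (simp add: s_def unscale_diff normal_eq[OF yv] w_def)
      ultimately show "\<bar>Im ((z - v) * cnj (normal v))\<bar> \<le> k * \<bar>Re ((z - v) * cnj (normal v))\<bar>" by simp
    qed
  qed
qed

end

sublocale disc_walls \<subseteq> gapped_walls Y base rect gaps normal K
  by (rule gapped_walls)

section \<open>Univalent maps that omit the segments\<close>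

lemma homotopic_loops_image_family:
  assumes "continuous_on ({0..1} \<times> {0..1}) (\<lambda>p. k (fst p) (snd p))"
    and "\<And>t x. t \<in> {0..1} \<Longrightarrow> x \<in> {0..1} \<Longrightarrow> k t x \<in> S"
    and "\<And>t. t \<in> {0..1} \<Longrightarrow> k t 1 = k t 0"
  shows "homotopic_loops S (k (0::real)) (k (1::real))"
  unfolding homotopic_loops
  by (rule exI[of _ "\<lambda>p. k (fst p) (snd p)"]) (use assms in \<open>auto simp: pathfinish_def pathstart_def\<close>)

text \<open>Discs may be shrunk slightly without leaving a given neighbourhood of the complement of the larger
ones.\<close>

lemma shrink_balls:
  fixes Ce :: "complex set"
  assumes "finite Ce" "\<rho> > 0" "open N" "compact B" "B - (\<Union>c\<in>Ce. ball c \<rho>) \<subseteq> N"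
  obtains r where "0 < r" "r < \<rho>" "B - (\<Union>c\<in>Ce. ball c r) \<subseteq> N"
proof -
  define W where "W = (\<lambda>r. \<Union>c\<in>Ce. ball c r)"
  have "compact (B - N)" using assms by (simp add: compact_diff)
  moreover have "B - N \<subseteq> (\<Union>r\<in>{0<..<\<rho>}. W r)"
  proof
    fix z assume "z \<in> B - N"
    hence "z \<in> (\<Union>c\<in>Ce. ball c \<rho>)" using assms(5) by blast
    then obtain c where c: "c \<in> Ce" "dist c z < \<rho>" by auto
    obtain r where r: "max 0 (dist c z) < r" "r < \<rho>" using dense[of "max 0 (dist c z)" \<rho>] c assms by auto
    hence "z \<in> W r" using c(1) by (auto simp: W_def)
    moreover have "r \<in> {0<..<\<rho>}" using r le_less_trans[OF zero_le_dist, of c z r] by auto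
    ultimately show "z \<in> (\<Union>r\<in>{0<..<\<rho>}. W r)" by blast
  qed
  moreover have "open (W r)" for r by (auto simp: W_def)
  ultimately obtain D where D: "D \<subseteq> {0<..<\<rho>}" "finite D" "B - N \<subseteq> (\<Union>r\<in>D. W r)"
    using compactE_image[of "B - N" "{0<..<\<rho>}" W] by metis
  define r where "r = Max (insert (\<rho>/2) D)"
  have "r \<in> insert (\<rho>/2) D" unfolding r_def using D by (intro Max_in) auto
  hence "0 < r" "r < \<rho>" using D assms by auto
  moreover have "W r' \<subseteq> W r" if "r' \<in> D" for r'
  proof -
    have "r' \<le> r" unfolding r_def using D that by (intro Max_ge) auto
    thus ?thesis by (force simp: W_def)
  qed
  hence "B - N \<subseteq> W r" using D by blast
  ultimately show ?thesis using that[of r] by (auto simp: W_def)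
qed

context disc_walls begin

text \<open>The centre of the leftmost disc of the wall. The image of the circle around it is going to enclose
the segment at height \<open>y\<close>.\<close>

definition tip :: "real \<Rightarrow> complex" where "tip y = Complex (- h) y"
definition axis_segment :: "real \<Rightarrow> complex set" where "axis_segment y = closed_segment (tip y) (Complex 1 y)"
text \<open>The contraction by the factor \<open>exp (- rate) = 1 / (n + 1)\<close> takes the part of the
rectangle at height \<open>y\<close>, of length at most \<open>1 + 2 h = n h\<close> to the left of the centre
\<open>1 + h\<close>, to points strictly to the right of 1.\<close>

definition rate :: real where "rate = ln (real n + 1)"

lemma rate: "rate > 0" "exp (- rate) = 1 / (real n + 1)"
proof -
  show "rate > 0" using n3 by (simp add: rate_def)
  have "exp (- rate) = inverse (exp (ln (real n + 1)))" by (simp add: rate_def exp_minus)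
  also have "\<dots> = 1 / (real n + 1)" by (subst exp_ln) (simp_all add: inverse_eq_divide)
  finally show "exp (- rate) = 1 / (real n + 1)" .
qed

lemma tip_center: "tip y = scale y (grid_point (- int n, 0))"
  using n_h by (simp add: tip_def scale_def base_def grid_point_def complex_eq_iff mult.commute)

lemma tip_in_centers: "y \<in> Y \<Longrightarrow> tip y \<in> centers"
  unfolding tip_center centers_def using n3 by (auto simp: grid_def intro!: image_eqI[of _ _ "(- int n, 0)"] bexI[of _ y])

lemma mem_axis_segment: "z \<in> axis_segment y \<longleftrightarrow> Im z = y \<and> - h \<le> Re z \<and> Re z \<le> 1"
proof
  assume "z \<in> axis_segment y"
  then obtain t where t: "0 \<le> t" "t \<le> 1" "z = (1 - t) *\<^sub>R tip y + t *\<^sub>R Complex 1 y"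
    unfolding axis_segment_def in_segment by auto
  have "Im z = y" unfolding t(3) by (simp add: tip_def algebra_simps)
  moreover have "Re z = - h + t * (1 + h)" unfolding t(3) by (simp add: tip_def algebra_simps)
  moreover have "0 \<le> t * (1 + h)" "t * (1 + h) \<le> 1 + h" using t h_pos by (auto intro: mult_left_le_one_le)
  ultimately show "Im z = y \<and> - h \<le> Re z \<and> Re z \<le> 1" by auto
next
  assume z: "Im z = y \<and> - h \<le> Re z \<and> Re z \<le> 1"
  define t where "t = (Re z + h) / (1 + h)"
  have t: "0 \<le> t" "t \<le> 1" using z h_pos by (auto simp: t_def field_simps)
  have "t * (1 + h) = Re z + h" using h_pos by (simp add: t_def)
  hence "z = (1 - t) *\<^sub>R tip y + t *\<^sub>R Complex 1 y"
    using z by (simp add: tip_def complex_eq_iff algebra_simps)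
  thus "z \<in> axis_segment y" unfolding axis_segment_def in_segment using t by blast
qed

lemma axis_segment_rect: "axis_segment y \<subseteq> rect y"
  using h_pos by (auto simp: mem_axis_segment rect_def in_cbox_complex_iff)

lemma gap_off_axis: "y \<in> Y \<Longrightarrow> v \<in> gaps y \<Longrightarrow> Im v \<noteq> y"
proof -
  assume "v \<in> gaps y"
  then obtain u where u: "u \<in> unit_gaps n" "v = scale y u" by (auto simp: gaps_def)
  have "Im u \<noteq> 0" using u(1) by (cases rule: unit_gaps_cases) auto
  thus ?thesis using h_pos by (simp add: u scale_def base_def)
qed

lemma shade_meets_rect:
  assumes "y \<in> Y" "A \<subseteq> {0..}" "w \<in> shade A z" "w \<in> rect y"
  shows "z = w \<or> z \<in> rect y"
proof (cases "z \<in> (\<Union>y\<in>Y. rect y)")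
  case True
  then obtain y' where y': "y' \<in> Y" "z \<in> rect y'" by blast
  hence "w \<in> rect y'" using shade_subset_P assms by blast
  hence "y' = y" using rect_disjoint[of y' y] y' assms by blast
  thus ?thesis using y' by simp
next
  case False
  thus ?thesis using shade_outside[OF False] assms by blast
qed

text \<open>No gap lies at height \<open>y\<close>, so on this line there is no tentacle, and the contraction
moves everything in the rectangle to the right of the segment.\<close>

lemma shade_avoids_axis:
  assumes "y \<in> Y" "z \<in> K"
  shows "shade {rate} z \<inter> axis_segment y = {}"
proof (rule ccontr)
  assume "shade {rate} z \<inter> axis_segment y \<noteq> {}"
  then obtain w where w: "w \<in> shade {rate} z" "w \<in> axis_segment y" by blast
  have A: "{rate} \<subseteq> {0..}" using rate by simp
  have wr: "w \<in> rect y" using w axis_segment_rect by blast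
  have z: "z \<in> rect y" using shade_meets_rect[OF assms(1) A w(1) wr] wr by auto
  obtain r where r: "r \<in> depth y z" "w = base y + (z - base y) * of_real (exp (- (rate * r)))"
    using shade_inside[OF assms(1) z w(1)] by auto
  define t where "t = exp (- (rate * r))"
  have t: "t > 0" by (simp add: t_def)
  have "Im z = y"
  proof -
    have "Im w = y + (Im z - y) * t" using r by (simp add: t_def base_def)
    thus ?thesis using w t by (simp add: mem_axis_segment)
  qed
  hence "z \<notin> gaps y" using gap_off_axis assms by blast
  hence "r = 1" using r z by (simp add: depth_def)
  hence tn: "t = 1 / (real n + 1)" using rate by (simp add: t_def)
  have "Re w = 1 + h + (Re z - (1 + h)) * t" using r by (simp add: t_def base_def)
  hence "(real n + 1) * (1 + h - Re w) = 1 + h - Re z"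
    unfolding tn by (simp add: field_simps)
  moreover have "(real n + 1) * (1 + h - Re w) \<ge> (real n + 1) * h"
    using w h_pos by (intro mult_left_mono) (auto simp: mem_axis_segment)
  ultimately have "Re z \<le> - 2 * h" using n_h by (simp add: algebra_simps)
  thus False using rect_bounds[OF z] h_pos by simp
qed

text \<open>The tip is the leftmost point of the rectangle on its line, and contraction moves points of the
rectangle to the right. Hence the tip is not met during the whole deformation.\<close>

lemma shade_avoids_tip:
  assumes "y \<in> Y" "z \<in> sphere (tip y) (h / 2)" "A \<subseteq> {0..}"
  shows "tip y \<notin> shade A z"
proof
  assume w: "tip y \<in> shade A z"
  have ne: "z \<noteq> tip y" using assms h_pos by auto
  have wr: "tip y \<in> rect y" using axis_segment_rect by (auto simp: axis_segment_def)
  have z: "z \<in> rect y" using shade_meets_rect[OF assms(1,3) w wr] wr by auto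
  obtain L r where r: "L \<in> A" "r \<in> depth y z" "tip y = base y + (z - base y) * of_real (exp (- (L * r)))"
    using shade_inside[OF assms(1) z w] by auto
  define t where "t = exp (- (L * r))"
  have "L * r \<ge> 0" using r assms depth_bounds by (intro mult_nonneg_nonneg) auto
  hence t: "t > 0" "t \<le> 1" by (simp_all add: t_def)
  have "Im (tip y) = y + (Im z - y) * t" using r by (simp add: t_def base_def)
  hence imz: "Im z = y" using t by (simp add: tip_def)
  have "Re (tip y) = 1 + h + (Re z - (1 + h)) * t" using r by (simp add: t_def base_def)
  hence "(1 + h - Re z) * t = 1 + 2 * h" by (simp add: tip_def algebra_simps)
  moreover have "(1 + h - Re z) * t \<le> 1 + h - Re z"
  proof (rule mult_left_le)
    have "(1 + h - Re z) * t > 0" using \<open>(1 + h - Re z) * t = 1 + 2 * h\<close> h_pos by simp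
    thus "0 \<le> 1 + h - Re z" using t by (simp add: zero_less_mult_iff)
  qed (use t in simp)
  ultimately have "Re z \<le> - h" by simp
  hence "Re z = - h" using rect_bounds[OF z] by simp
  thus False using ne imz by (simp add: tip_def complex_eq_iff)
qed

text \<open>The circle about a tip stays in a strip that does not reach the segments at other heights.\<close>

lemma shade_in_strip:
  assumes "y \<in> Y" "z \<in> sphere (tip y) (h / 2)" "A \<subseteq> {0..}" "w \<in> shade A z"
  shows "\<bar>Im w - y\<bar> < 2 * h"
proof -
  have "\<bar>Im (z - tip y)\<bar> \<le> h / 2" using assms(2) abs_Im_le_cmod[of "z - tip y"] by (simp add: dist_norm norm_minus_commute)
  hence z: "\<bar>Im z - y\<bar> \<le> h / 2" by (simp add: tip_def)
  show ?thesis
  proof (cases "z \<in> (\<Union>y\<in>Y. rect y)")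
    case False
    hence "w = z" using shade_outside[OF False] assms(4) by blast
    thus ?thesis using z h_pos by simp
  next
    case True
    then obtain y' where y': "y' \<in> Y" "z \<in> rect y'" by blast
    have "y' = y"
    proof (rule ccontr)
      assume "y' \<noteq> y"
      thus False using gap_Y[OF y'(1) assms(1)] rect_bounds[OF y'(2)] z h_pos by linarith
    qed
    hence "w \<in> rect y" using shade_subset_P[OF y' assms(3)] assms(4) by auto
    thus ?thesis using rect_bounds[of w y] h_pos by linarith
  qed
qed

lemma center_ball_bounds:
  assumes "y \<in> Y" "q \<in> grid n" "dist (scale y (grid_point q)) z \<le> h / 2"
  shows "- 2 * h \<le> Re z" "Re z \<le> 1 + 3 * h" "\<bar>Im z - y\<bar> \<le> 2 * h"
proof -
  have "\<bar>Re z - Re (scale y (grid_point q))\<bar> \<le> h / 2" "\<bar>Im z - Im (scale y (grid_point q))\<bar> \<le> h / 2"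
    using assms(3) abs_Re_le_cmod[of "z - scale y (grid_point q)"] abs_Im_le_cmod[of "z - scale y (grid_point q)"]
    by (simp_all add: dist_norm norm_minus_commute)
  thus "- 2 * h \<le> Re z" "Re z \<le> 1 + 3 * h" "\<bar>Im z - y\<bar> \<le> 2 * h"
    using centers_bounds[OF assms(2), of y] h_pos by linarith+
qed

lemma rect_in_ball: "y \<in> Y \<Longrightarrow> rect y \<subseteq> cball 0 R"
proof
  fix z assume "y \<in> Y" "z \<in> rect y"
  thus "z \<in> cball 0 R" using inside_R[of y z] rect_bounds[of z y] h_pos by auto
qed

lemma tip_sphere_in_K: "y \<in> Y \<Longrightarrow> sphere (tip y) (h / 2) \<subseteq> K"
proof
  fix z assume y: "y \<in> Y" and z: "z \<in> sphere (tip y) (h / 2)"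
  have g: "(- int n, 0) \<in> grid n" by (auto simp: grid_def)
  have "norm z < R"
    using inside_R[OF y] center_ball_bounds[OF y g, of z] z unfolding tip_center by simp
  moreover have "dist c z \<ge> h / 2" if "c \<in> centers" for c
  proof (cases "c = tip y")
    case True
    thus ?thesis using z by simp
  next
    case False
    from centers_dist[OF that tip_in_centers[OF y] False] dist_triangle2[of c "tip y" z] z show ?thesis
      by simp
  qed
  ultimately show "z \<in> K" by (auto simp: K_def not_less)
qed

text \<open>The winding number is constant along the segment, which starts at the tip.\<close>

lemma winding_step:
  assumes "path \<gamma>" "pathfinish \<gamma> = pathstart \<gamma>" "winding_number \<gamma> (tip y) = 1"
    "axis_segment y \<inter> path_image \<gamma> = {}" "z \<in> axis_segment y"
  shows "winding_number \<gamma> z = 1"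
proof -
  have "winding_number \<gamma> z = winding_number \<gamma> (tip y)"
    by (rule winding_number_eq[where S = "axis_segment y"])
       (use assms in \<open>auto simp: axis_segment_def\<close>)
  thus ?thesis using assms by simp
qed

text \<open>For a narrow gap the squeezing map is univalent near the complement of the touching discs, nearly
the identity away from the rectangles, and omits the segments. Deforming \<open>L\<close> from 0 to
\<open>rate\<close> shows that the circle about the tip still winds once around the tip, hence around the
whole segment, which the map omits. Finally the discs are shrunk a little to make them disjoint.\<close>

theorem generation_step:
  assumes U: "open U" and e: "\<epsilon> > 0"
    and inU: "\<And>y z. y \<in> Y \<Longrightarrow> - 2 * h \<le> Re z \<Longrightarrow> Re z \<le> 1 + 3 * h \<Longrightarrow> \<bar>Im z - y\<bar> \<le> 2 * h \<Longrightarrow> z \<in> U"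
  obtains r f N where "0 < r" "r < h / 2" "open N" "cball 0 R - (\<Union>c\<in>centers. ball c r) \<subseteq> N"
    "f holomorphic_on N" "inj_on f N"
    "\<And>z. z \<in> cball 0 R - U \<Longrightarrow> dist (f z) z < \<epsilon>"
    "\<And>z. z \<in> N \<Longrightarrow> norm (f z) < R + 1"
    "\<And>y z. y \<in> Y \<Longrightarrow> z \<in> N \<Longrightarrow> f z \<notin> axis_segment y"
    "\<And>y z. y \<in> Y \<Longrightarrow> z \<in> axis_segment y \<Longrightarrow> winding_number (f \<circ> circlepath (tip y) r) z = 1"
    "\<And>y y' z. y \<in> Y \<Longrightarrow> y' \<in> Y \<Longrightarrow> y' \<noteq> y \<Longrightarrow> z \<in> axis_segment y' \<Longrightarrow> winding_number (f \<circ> circlepath (tip y) r) z = 0"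
proof -
  have rpos: "{rate} \<subseteq> {0..}" "{rate} \<subseteq> {0..rate}" "{0..rate} \<subseteq> {0..}" using rate by auto
  have ballU: "ball c (h/2) \<subseteq> U" if cc: "c \<in> centers" for c
  proof
    fix z assume z: "z \<in> ball c (h/2)"
    obtain y q where "y \<in> Y" "q \<in> grid n" "c = scale y (grid_point q)" using cc unfolding centers_def by blast
    thus "z \<in> U" using inU center_ball_bounds[of y q z] z by auto
  qed
  have rectU: "rect y \<subseteq> U" if "y \<in> Y" for y
    using inU[OF that] rect_bounds h_pos by (force)
  have KU: "cball 0 R - U = K - U" using ballU by (auto simp: K_def)
  have S: "compact (sphere (tip y) (h/2))" for y by simp
  have "compact (K - U)" using compact_K U by (simp add: compact_diff)
  hence 1: "\<forall>\<^sub>F d in at_right 0. \<forall>z\<in>K - U. dist (squeeze rate d z) z < \<epsilon>"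
    by (rule squeeze_close) (use rectU e rate in auto)
  have 2: "\<forall>\<^sub>F d in at_right 0. \<forall>z\<in>K. \<forall>L\<in>{rate}. squeeze L d z \<notin> {w. norm w \<ge> R + 1}"
  proof (rule squeeze_avoids[OF _ compact_K order_refl _ rpos(2)])
    show "closed {w::complex. norm w \<ge> R + 1}" by (intro closed_Collect_le continuous_intros)
    fix z assume z: "z \<in> K"
    hence zR: "z \<in> cball 0 R" by (auto simp: K_def)
    have "shade {rate} z \<subseteq> cball 0 R"
    proof (cases "z \<in> (\<Union>y\<in>Y. rect y)")
      case True
      thus ?thesis using shade_subset_P[OF _ _ rpos(1)] rect_in_ball by blast
    next
      case False
      thus ?thesis using shade_outside[OF False] zR by blast
    qed
    thus "shade {rate} z \<inter> {w. norm w \<ge> R + 1} = {}" by force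
  qed simp
  have 3: "\<forall>\<^sub>F d in at_right 0. \<forall>y\<in>Y. \<forall>z\<in>K. \<forall>L\<in>{rate}. squeeze L d z \<notin> axis_segment y"
  proof (rule eventually_ball_finite[OF finite_Y], rule ballI)
    fix y assume y: "y \<in> Y"
    show "\<forall>\<^sub>F d in at_right 0. \<forall>z\<in>K. \<forall>L\<in>{rate}. squeeze L d z \<notin> axis_segment y"
      by (rule squeeze_avoids[OF _ compact_K order_refl _ rpos(2)])
         (use shade_avoids_axis y in \<open>auto simp: axis_segment_def\<close>)
  qed
  have 4: "\<forall>\<^sub>F d in at_right 0. \<forall>y\<in>Y. \<forall>z\<in>sphere (tip y) (h/2). \<forall>L\<in>{0..rate}. squeeze L d z \<notin> {tip y}"
  proof (rule eventually_ball_finite[OF finite_Y], rule ballI)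
    fix y assume y: "y \<in> Y"
    show "\<forall>\<^sub>F d in at_right 0. \<forall>z\<in>sphere (tip y) (h/2). \<forall>L\<in>{0..rate}. squeeze L d z \<notin> {tip y}"
      by (rule squeeze_avoids[OF _ S tip_sphere_in_K[OF y] _ order_refl])
         (use shade_avoids_tip[OF y _ rpos(3)] in auto)
  qed
  have 5: "\<forall>\<^sub>F d in at_right 0. \<forall>y\<in>Y. \<forall>z\<in>sphere (tip y) (h/2). \<forall>L\<in>{rate}. squeeze L d z \<notin> {w. \<bar>Im w - y\<bar> \<ge> 2 * h}"
  proof (rule eventually_ball_finite[OF finite_Y], rule ballI)
    fix y assume y: "y \<in> Y"
    show "\<forall>\<^sub>F d in at_right 0. \<forall>z\<in>sphere (tip y) (h/2). \<forall>L\<in>{rate}. squeeze L d z \<notin> {w. \<bar>Im w - y\<bar> \<ge> 2 * h}"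
    proof (rule squeeze_avoids[OF _ S tip_sphere_in_K[OF y] _ rpos(2)])
      show "closed {w. \<bar>Im w - y\<bar> \<ge> 2 * h}" by (intro closed_Collect_le continuous_intros)
      show "shade {rate} z \<inter> {w. \<bar>Im w - y\<bar> \<ge> 2 * h} = {}" if "z \<in> sphere (tip y) (h/2)" for z
        using shade_in_strip[OF y that rpos(1)] by force
    qed simp
  qed
  have 6: "\<forall>\<^sub>F d in at_right 0. \<forall>z\<in>K. \<forall>y\<in>Y.
      (potential y d has_field_derivative potential_slope y d z) (at z)"
  proof (rule compact_eventually_ball[OF compact_K])
    fix z assume z: "z \<in> K"
    have "\<forall>\<^sub>F p in gap_filter z. \<forall>y\<in>Y. snd p \<in> K \<longrightarrow>
           (potential y (fst p) has_field_derivative potential_slope y (fst p) (snd p)) (at (snd p))"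
      by (intro eventually_ball_finite finite_Y ballI potential_deriv_K z)
    thus "\<forall>\<^sub>F p in gap_filter z. snd p \<in> K \<longrightarrow> (\<forall>y\<in>Y.
           (potential y (fst p) has_field_derivative potential_slope y (fst p) (snd p)) (at (snd p)))"
      by eventually_elim auto
  qed
  have "\<exists>d. (\<forall>z\<in>K - U. dist (squeeze rate d z) z < \<epsilon>) \<and>
     (\<forall>z\<in>K. norm (squeeze rate d z) < R + 1) \<and>
     (\<forall>y\<in>Y. \<forall>z\<in>K. squeeze rate d z \<notin> axis_segment y) \<and>
     (\<forall>y\<in>Y. \<forall>z\<in>sphere (tip y) (h/2). \<forall>L\<in>{0..rate}. squeeze L d z \<noteq> tip y) \<and>
     (\<forall>y\<in>Y. \<forall>z\<in>sphere (tip y) (h/2). \<bar>Im (squeeze rate d z) - y\<bar> < 2 * h) \<and>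
     (\<forall>z\<in>K. \<forall>y\<in>Y. (potential y d has_field_derivative potential_slope y d z) (at z)) \<and>
     inj_on (squeeze rate d) K \<and> squeeze rate d analytic_on K \<and> (\<forall>z\<in>K. deriv (squeeze rate d) z \<noteq> 0)"
    by (rule eventually_happens'[OF trivial_limit_at_right_real])
       (use 1 2 3 4 5 6 squeeze_univalent[OF rate(1)] in \<open>eventually_elim; auto simp: not_le\<close>)
  then obtain d where D: "\<forall>z\<in>K - U. dist (squeeze rate d z) z < \<epsilon>" "\<forall>z\<in>K. norm (squeeze rate d z) < R + 1"
      "\<forall>y\<in>Y. \<forall>z\<in>K. squeeze rate d z \<notin> axis_segment y"
      "\<forall>y\<in>Y. \<forall>z\<in>sphere (tip y) (h/2). \<forall>L\<in>{0..rate}. squeeze L d z \<noteq> tip y"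
      "\<forall>y\<in>Y. \<forall>z\<in>sphere (tip y) (h/2). \<bar>Im (squeeze rate d z) - y\<bar> < 2 * h"
      "\<forall>z\<in>K. \<forall>y\<in>Y. (potential y d has_field_derivative potential_slope y d z) (at z)"
      "inj_on (squeeze rate d) K" "squeeze rate d analytic_on K" "\<forall>z\<in>K. deriv (squeeze rate d) z \<noteq> 0"
    by (elim exE conjE)
  note d = D(1)[rule_format] D(2)[rule_format] D(3)[rule_format] D(4)[rule_format] D(5)[rule_format]
    D(6)[rule_format] D(7,8) D(9)[rule_format]
  define f where "f = squeeze rate d"
  obtain N0 where N0: "open N0" "K \<subseteq> N0" "f holomorphic_on N0" "inj_on f N0"
    using injective_near_compact[OF compact_K d(8,7,9)] unfolding f_def by blast
  have contf: "continuous_on N0 f" using N0 holomorphic_on_imp_continuous_on by blast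
  \<comment> \<open>the neighbourhood is cut down so that the open conditions on the values persist on it\<close>
  define T where "T = {w. norm w < R + 1} \<inter> - (\<Union>y\<in>Y. axis_segment y)"
  have "closed (\<Union>y\<in>Y. axis_segment y)" unfolding axis_segment_def using finite_Y by (intro closed_UN) auto
  moreover have "open {w::complex. norm w < R + 1}" by (intro open_Collect_less continuous_intros)
  ultimately have T: "open T" unfolding T_def by (metis open_Int open_Compl)
  define N where "N = N0 \<inter> f -` T"
  have N: "open N" unfolding N_def by (rule continuous_open_preimage[OF contf N0(1) T])
  have KN: "K \<subseteq> N" using N0 d(2,3) by (auto simp: N_def T_def f_def)
  obtain r where r: "0 < r" "r < h / 2" "cball 0 R - (\<Union>c\<in>centers. ball c r) \<subseteq> N"
    using shrink_balls[OF finite_centers _ N, of "h/2" "cball 0 R"] KN h_pos unfolding K_def by auto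
  have avoid: "f z \<notin> axis_segment y" if "z \<in> N" "y \<in> Y" for z y using that by (auto simp: N_def T_def)
  have contN: "continuous_on N f" using contf by (rule continuous_on_subset) (auto simp: N_def)
  \<comment> \<open>the circle of radius \<open>h/2\<close> lies in \<open>K\<close>, where the estimates hold\<close>
  have circ: "path_image (circlepath (tip y) (h/2)) = sphere (tip y) (h/2)" for y using h_pos by simp
  have circK: "circlepath (tip y) (h/2) x \<in> K" if "y \<in> Y" "x \<in> {0..1}" for y x
    using tip_sphere_in_K[OF that(1)] that(2) circ[of y] unfolding path_image_def by blast
  have pathf: "path (f \<circ> circlepath (tip y) (h/2))" if "y \<in> Y" for y
    by (intro path_continuous_image continuous_on_subset[OF contN] path_circlepath)
       (use tip_sphere_in_K[OF that] KN circ in auto)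
  have loopf: "pathfinish (f \<circ> circlepath (tip y) \<rho>) = pathstart (f \<circ> circlepath (tip y) \<rho>)" for y \<rho>
    by (simp add: pathfinish_compose pathstart_compose)
  have wind_tip: "winding_number (f \<circ> circlepath (tip y) (h/2)) (tip y) = 1" if y: "y \<in> Y" for y
  proof -
    \<comment> \<open>the deformation from the identity\<close>
    define k where "k = (\<lambda>t x. squeeze (t * rate) d (circlepath (tip y) (h/2) x))"
    have cp: "continuous_on {0..1} (circlepath (tip y) (h/2))"
      using path_circlepath unfolding path_def .
    have cpot: "continuous_on ({0..1::real} \<times> {0..1}) (\<lambda>p. potential y' d (circlepath (tip y) (h/2) (snd p)))" if "y' \<in> Y" for y'
    proof -
      have A: "continuous_on K (potential y' d)"
        by (rule DERIV_continuous_on[OF has_field_derivative_at_within[OF d(6)[OF _ that]]])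
      have B: "continuous_on ({0..1::real} \<times> {0..1}) (\<lambda>p. circlepath (tip y) (h/2) (snd p))"
        by (rule continuous_on_compose2[OF cp continuous_on_snd[OF continuous_on_id]]) auto
      show ?thesis by (rule continuous_on_compose2[OF A B]) (use circK y in auto)
    qed
    have "homotopic_loops (- {tip y}) (k 0) (k 1)"
    proof (rule homotopic_loops_image_family)
      show "continuous_on ({0..1} \<times> {0..1}) (\<lambda>p. k (fst p) (snd p))"
        unfolding k_def squeeze_def
        by (intro continuous_intros cpot continuous_on_compose2[OF cp continuous_on_snd[OF continuous_on_id]]) auto
      show "k t x \<in> - {tip y}" if "t \<in> {0..1}" "x \<in> {0..1}" for t x
      proof -
        have "t * rate \<in> {0..rate}" using that rate by (auto simp: mult_left_le_one_le)
        moreover have "circlepath (tip y) (h/2) x \<in> sphere (tip y) (h/2)"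
          using that circ unfolding path_image_def by blast
        ultimately show ?thesis using d(4)[OF y] by (simp add: k_def)
      qed
      show "k t 1 = k t 0" for t by (simp add: k_def circlepath)
    qed
    hence "winding_number (k 1) (tip y) = winding_number (k 0) (tip y)"
      by (simp add: winding_number_homotopic_loops)
    moreover have "k 1 = f \<circ> circlepath (tip y) (h/2)" by (auto simp: k_def f_def)
    moreover have "k 0 = circlepath (tip y) (h/2)" by (auto simp: k_def squeeze_def)
    moreover have "winding_number (circlepath (tip y) (h/2)) (tip y) = 1"
      using h_pos by (intro winding_number_circlepath_centre) simp
    ultimately show ?thesis by simp
  qed
  have im: "path_image (f \<circ> circlepath (tip y) (h/2)) = f ` sphere (tip y) (h/2)" for y
    by (simp only: path_image_compose circ)
  have wind1: "winding_number (f \<circ> circlepath (tip y) (h/2)) z = 1" if "y \<in> Y" "z \<in> axis_segment y" for y z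
  proof (rule winding_step[OF pathf[OF that(1)] loopf wind_tip[OF that(1)] _ that(2)])
    show "axis_segment y \<inter> path_image (f \<circ> circlepath (tip y) (h/2)) = {}"
      unfolding im using tip_sphere_in_K[OF that(1)] KN avoid that by blast
  qed
  have wind0: "winding_number (f \<circ> circlepath (tip y) (h/2)) z = 0"
    if "y \<in> Y" "y' \<in> Y" "y' \<noteq> y" "z \<in> axis_segment y'" for y y' z
  proof (rule winding_number_zero_outside[OF pathf[OF that(1)] _ loopf])
    \<comment> \<open>the loop stays in a strip which does not reach the other segments\<close>
    define Q where "Q = {w. Im w > y - 2 * h} \<inter> {w. Im w < y + 2 * h}"
    show "convex Q" unfolding Q_def
      by (intro convex_Int) (simp_all add: convex_halfspace_Im_gt convex_halfspace_Im_lt)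
    show "z \<notin> Q" using that gap_Y[OF that(2,1,3)] h_pos by (auto simp: Q_def mem_axis_segment)
    show "path_image (f \<circ> circlepath (tip y) (h/2)) \<subseteq> Q"
    proof -
      have "f w \<in> Q" if "w \<in> sphere (tip y) (h/2)" for w
        using d(5)[OF \<open>y \<in> Y\<close> that] by (simp add: Q_def f_def abs_less_iff)
      thus ?thesis unfolding im by blast
    qed
  qed
  have shrunk: "winding_number (f \<circ> circlepath (tip y) r) z = winding_number (f \<circ> circlepath (tip y) (h/2)) z"
    if y: "y \<in> Y" "y' \<in> Y" "z \<in> axis_segment y'" for y y' z
  proof -
    \<comment> \<open>the circles of intermediate radius stay in \<open>N\<close>, so their images miss the segments\<close>
    define \<rho> where "\<rho> = (\<lambda>t. r + t * (h/2 - r))"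
    define k where "k = (\<lambda>t x. f (circlepath (tip y) (\<rho> t) x))"
    have \<rho>: "r \<le> \<rho> t" "\<rho> t \<le> h/2" if "t \<in> {0..1}" for t
    proof -
      have "0 \<le> t * (h/2 - r)" using that r by simp
      moreover have "t * (h/2 - r) \<le> 1 * (h/2 - r)" using that r by (intro mult_right_mono) auto
      ultimately show "r \<le> \<rho> t" "\<rho> t \<le> h/2" by (simp_all add: \<rho>_def)
    qed
    have mem: "circlepath (tip y) (\<rho> t) x \<in> N" if tx: "t \<in> {0..1}" "x \<in> {0..1}" for t x
    proof -
      define w where "w = circlepath (tip y) (\<rho> t) x"
      have "w \<in> sphere (tip y) (\<rho> t)"
        using tx \<rho>[OF tx(1)] r path_image_circlepath[of "tip y" "\<rho> t"] unfolding path_image_def w_def by force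
      hence dw: "dist (tip y) w = \<rho> t" by simp
      have g: "(- int n, 0) \<in> grid n" by (auto simp: grid_def)
      have "norm w < R"
        using inside_R[OF y(1)] center_ball_bounds[OF y(1) g, of w] dw \<rho>[OF tx(1)] unfolding tip_center by simp
      moreover have "dist c w \<ge> r" if "c \<in> centers" for c
      proof (cases "c = tip y")
        case True
        thus ?thesis using dw \<rho>[OF tx(1)] by simp
      next
        case False
        from centers_dist[OF that tip_in_centers[OF y(1)] False] dist_triangle2[of c "tip y" w] dw \<rho>[OF tx(1)] r show ?thesis
          by (simp add: dist_commute)
      qed
      ultimately have "w \<in> cball 0 R - (\<Union>c\<in>centers. ball c r)" by (auto simp: not_less)
      thus ?thesis using r(3) unfolding w_def by blast
    qed
    have "homotopic_loops (- {z}) (k 0) (k 1)"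
    proof (rule homotopic_loops_image_family)
      show "continuous_on ({0..1} \<times> {0..1}) (\<lambda>p. k (fst p) (snd p))"
        unfolding k_def
      proof (rule continuous_on_compose2[OF contN])
        show "continuous_on ({0..1} \<times> {0..1}) (\<lambda>p. circlepath (tip y) (\<rho> (fst p)) (snd p))"
          unfolding circlepath \<rho>_def by (intro continuous_intros)
      qed (use mem in auto)
      show "k t x \<in> - {z}" if "t \<in> {0..1}" "x \<in> {0..1}" for t x
        using avoid[OF mem[OF that] y(2)] y(3) by (auto simp: k_def)
      show "k t 1 = k t 0" for t by (simp add: k_def circlepath)
    qed
    hence "winding_number (k 0) z = winding_number (k 1) z"
      by (rule winding_number_homotopic_loops)
    moreover have "k 0 = f \<circ> circlepath (tip y) r" "k 1 = f \<circ> circlepath (tip y) (h/2)"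
      by (auto simp: k_def \<rho>_def)
    ultimately show ?thesis by simp
  qed
  show ?thesis
  proof (rule that[OF r(1,2) N r(3)])
    show "f holomorphic_on N" using N0(3) by (rule holomorphic_on_subset) (auto simp: N_def)
    show "inj_on f N" using N0(4) by (rule inj_on_subset) (auto simp: N_def)
    show "dist (f z) z < \<epsilon>" if "z \<in> cball 0 R - U" for z using d(1) that unfolding KU f_def by blast
    show "norm (f z) < R + 1" if "z \<in> N" for z using that by (auto simp: N_def T_def)
    show "f z \<notin> axis_segment y" if "y \<in> Y" "z \<in> N" for y z using avoid that by blast
    show "winding_number (f \<circ> circlepath (tip y) r) z = 1" if "y \<in> Y" "z \<in> axis_segment y" for y z
      using shrunk[OF that(1,1,2)] wind1[OF that] by simp
    show "winding_number (f \<circ> circlepath (tip y) r) z = 0"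
      if "y \<in> Y" "y' \<in> Y" "y' \<noteq> y" "z \<in> axis_segment y'" for y y' z
      using shrunk[OF that(1,2,4)] wind0[OF that] by simp
  qed
qed

end

section \<open>Stages of the construction\<close>

text \<open>Each segment of a finite family of parallel segments can be traded for finitely many small round
discs close to it: the complement of the discs is mapped univalently, almost without moving points far from
the segments, so that the image omits the segments and that each of them is enclosed by the image of one of
the circles.\<close>

theorem generation:
  fixes Y :: "real set"
  assumes Y: "finite Y" and U: "open U" "U \<subseteq> ball 0 R" and seg: "\<And>y x. y \<in> Y \<Longrightarrow> x \<in> {0..1} \<Longrightarrow> Complex x y \<in> U"
    and e: "\<epsilon> > 0"
  obtains C r t f N where "finite C" "0 < r" "\<And>c. c \<in> C \<Longrightarrow> cball c r \<subseteq> U"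
    "\<And>c c'. c \<in> C \<Longrightarrow> c' \<in> C \<Longrightarrow> c \<noteq> c' \<Longrightarrow> cball c r \<inter> cball c' r = {}"
    "open N" "cball 0 R - (\<Union>c\<in>C. ball c r) \<subseteq> N" "f holomorphic_on N" "inj_on f N"
    "\<And>z. z \<in> cball 0 R - U \<Longrightarrow> dist (f z) z < \<epsilon>"
    "\<And>z. z \<in> N \<Longrightarrow> norm (f z) < R + 1"
    "\<And>y. y \<in> Y \<Longrightarrow> t y \<in> C"
    "\<And>y x z. y \<in> Y \<Longrightarrow> x \<in> {0..1} \<Longrightarrow> z \<in> N \<Longrightarrow> f z \<noteq> Complex x y"
    "\<And>y y' x. y \<in> Y \<Longrightarrow> y' \<in> Y \<Longrightarrow> x \<in> {0..1} \<Longrightarrow>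
       winding_number (f \<circ> circlepath (t y) r) (Complex x y') = (if y' = y then 1 else 0)"
proof -
  \<comment> \<open>the scale is determined by the distance of the segments from the complement of \<open>U\<close> and from each other\<close>
  define S where "S = (\<lambda>(x, y). Complex x y) ` ({0..1} \<times> Y)"
  have "compact S" unfolding S_def
    by (intro compact_continuous_image compact_Times finite_imp_compact Y compact_Icc)
       (auto simp: case_prod_unfold Complex_eq intro!: continuous_intros)
  moreover have "S \<subseteq> U" using seg by (auto simp: S_def)
  ultimately obtain \<rho> where \<rho>: "\<rho> > 0" "(\<Union>z\<in>S. ball z \<rho>) \<subseteq> U"
    using compact_subset_open_imp_ball_epsilon_subset[of S U] U by blast
  define D where "D = Min (insert 1 ((\<lambda>(y, y'). \<bar>y - y'\<bar>) ` {(y, y'). y \<in> Y \<and> y' \<in> Y \<and> y \<noteq> y'}))"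
  have finD: "finite ((\<lambda>(y, y'). \<bar>y - y'\<bar>) ` {(y, y'). y \<in> Y \<and> y' \<in> Y \<and> y \<noteq> y'})"
    by (rule finite_imageI, rule finite_subset[of _ "Y \<times> Y"]) (use Y in auto)
  have "D > 0" unfolding D_def using finD by (subst Min_gr_iff) auto
  have D: "D \<le> \<bar>y - y'\<bar>" if "y \<in> Y" "y' \<in> Y" "y \<noteq> y'" for y y'
    unfolding D_def using finD that by (intro Min_le) auto
  \<comment> \<open>\<open>h = 1 / m\<close>: rectangles and discs stay within \<open>5 * h\<close> of the segments, and heights have to differ by more than \<open>6 * h\<close>\<close>
  obtain m :: nat where m: "real m > max (1 + 9 / \<rho>) (7 / D)" using reals_Archimedean2 by blast
  have mm: "real m > 1 + 9 / \<rho>" "real m > 7 / D" using m unfolding max_less_iff_conj by auto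
  have "9 / \<rho> > 0" using \<rho> by simp
  hence m1: "real m > 1" "real m > 9 / \<rho>" "real m > 7 / D" using mm by linarith+
  define h where "h = 1 / real m"
  have h: "h > 0" "9 * h < \<rho>" "7 * h < D" using m1 \<rho> \<open>D > 0\<close> by (auto simp: h_def field_simps)
  have inU: "z \<in> U" if y: "y \<in> Y" and z: "- 2 * h \<le> Re z" "Re z \<le> 1 + 3 * h" "\<bar>Im z - y\<bar> \<le> 2 * h" for y z
  proof -
    define x where "x = min 1 (max 0 (Re z))"
    have x: "x \<in> {0..1}" by (auto simp: x_def)
    have "\<bar>Re z - x\<bar> \<le> 3 * h" using z h by (auto simp: x_def min_def max_def)
    hence "norm (z - Complex x y) \<le> 3 * h + 2 * h"
      using cmod_le[of "z - Complex x y"] z by simp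
    hence "z \<in> ball (Complex x y) \<rho>" using h by (simp add: dist_norm norm_minus_commute)
    moreover have "Complex x y \<in> S" using x y by (auto simp: S_def)
    ultimately show ?thesis using \<rho> by blast
  qed
  \<comment> \<open>\<open>(m + 2) * h = 1 + 2 * h\<close>\<close>
  interpret disc_walls Y h "m + 2" R
  proof
    show "\<bar>y - y'\<bar> > 6 * h" if "y \<in> Y" "y' \<in> Y" "y \<noteq> y'" for y y' using D[OF that] h by linarith
    show "norm z < R" if "y \<in> Y" "- 2 * h \<le> Re z" "Re z \<le> 1 + 3 * h" "\<bar>Im z - y\<bar> \<le> 2 * h" for y z
      using inU[OF that] U(2) by auto
    show "real (m + 2) * h = 1 + 2 * h" using m1 by (simp add: h_def field_simps)
  qed (use Y h m1 in auto)
  obtain r f N where F: "0 < r" "r < h / 2" "open N" "cball 0 R - (\<Union>c\<in>centers. ball c r) \<subseteq> N"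
    "f holomorphic_on N" "inj_on f N"
    "\<And>z. z \<in> cball 0 R - U \<Longrightarrow> dist (f z) z < \<epsilon>"
    "\<And>z. z \<in> N \<Longrightarrow> norm (f z) < R + 1"
    "\<And>y z. y \<in> Y \<Longrightarrow> z \<in> N \<Longrightarrow> f z \<notin> axis_segment y"
    "\<And>y z. y \<in> Y \<Longrightarrow> z \<in> axis_segment y \<Longrightarrow> winding_number (f \<circ> circlepath (tip y) r) z = 1"
    "\<And>y y' z. y \<in> Y \<Longrightarrow> y' \<in> Y \<Longrightarrow> y' \<noteq> y \<Longrightarrow> z \<in> axis_segment y' \<Longrightarrow> winding_number (f \<circ> circlepath (tip y) r) z = 0"
    by (rule generation_step[OF U(1) e]) ((use inU in blast), (rule that; assumption))
  have seg': "Complex x y \<in> axis_segment y" if "x \<in> {0..1}" for x y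
    using that h by (auto simp: mem_axis_segment)
  show ?thesis
  proof (rule that[of centers r N f tip])
    show "cball c r \<subseteq> U" if "c \<in> centers" for c
    proof
      fix z assume z: "z \<in> cball c r"
      obtain y q where "y \<in> Y" "q \<in> grid (m + 2)" "c = scale y (grid_point q)"
        using \<open>c \<in> centers\<close> unfolding centers_def by blast
      thus "z \<in> U" using inU center_ball_bounds[of y q z] z F(2) by auto
    qed
    show "cball c r \<inter> cball c' r = {}" if "c \<in> centers" "c' \<in> centers" "c \<noteq> c'" for c c'
    proof (rule ccontr)
      assume "cball c r \<inter> cball c' r \<noteq> {}"
      then obtain z where "dist c z \<le> r" "dist c' z \<le> r" by auto
      thus False using centers_dist[OF that] dist_triangle2[of c c' z] F(2) by linarith
    qed
    show "f z \<noteq> Complex x y" if "y \<in> Y" "x \<in> {0..1}" "z \<in> N" for x y z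
      using F(9)[OF that(1,3)] seg'[OF that(2), of y] by auto
    show "winding_number (f \<circ> circlepath (tip y) r) (Complex x y') = (if y' = y then 1 else 0)"
      if "y \<in> Y" "y' \<in> Y" "x \<in> {0..1}" for y y' x
      using F(10)[OF that(1) seg'[OF that(3)]] F(11)[OF that(1,2) _ seg'[OF that(3)]] by auto
  qed (use F finite_centers tip_in_centers in auto)
qed

text \<open>One step of the construction. The circle domain is the open disc of radius \<open>outer\<close>
without the closed discs of radius \<open>radius\<close> about \<open>centres\<close>; \<open>chart\<close>
maps it into the circle domain of the next step and omits the segments \<open>[0, 1] \<times> {y}\<close> for
\<open>y \<in> heights\<close>; \<open>tips y\<close> is the centre of the disc whose circle is mapped to a
loop around the segment at height \<open>y\<close>. The distance from the segments to the image of the chart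
is at least \<open>margin\<close>, which limits how far later charts may move points.\<close>

record stage =
  heights :: "real set"
  outer :: real
  centres :: "complex set"
  radius :: real
  tips :: "real \<Rightarrow> complex"
  chart :: "complex \<Rightarrow> complex"
  margin :: real

definition closed_region :: "stage \<Rightarrow> complex set" where
  "closed_region s = cball 0 (outer s) - (\<Union>c\<in>centres s. ball c (radius s))"

definition open_region :: "stage \<Rightarrow> complex set" where
  "open_region s = ball 0 (outer s) - (\<Union>c\<in>centres s. cball c (radius s))"

definition valid_stage :: "stage \<Rightarrow> bool" where
  "valid_stage s \<longleftrightarrow> finite (heights s) \<and> finite (centres s) \<and> 0 < radius s \<and> 1 \<le> outer s \<and>
     (\<forall>c\<in>centres s. cball c (radius s) \<subseteq> ball 0 (outer s)) \<and>
     (\<forall>c\<in>centres s. \<forall>c'\<in>centres s. c \<noteq> c' \<longrightarrow> cball c (radius s) \<inter> cball c' (radius s) = {}) \<and>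
     (\<exists>N. open N \<and> closed_region s \<subseteq> N \<and> chart s holomorphic_on N \<and> inj_on (chart s) N) \<and>
     (\<forall>z\<in>closed_region s. norm (chart s z) < outer s + 1) \<and>
     0 < margin s \<and> margin s \<le> 1 \<and>
     (\<forall>y\<in>heights s. \<forall>x\<in>{0..1}. norm (Complex x y) < outer s \<and>
        (\<forall>z\<in>closed_region s. margin s \<le> dist (chart s z) (Complex x y))) \<and>
     (\<forall>y\<in>heights s. tips s y \<in> centres s) \<and>
     (\<forall>y\<in>heights s. \<forall>y'\<in>heights s. \<forall>x\<in>{0..1}.
        winding_number (chart s \<circ> circlepath (tips s y) (radius s)) (Complex x y') = (if y' = y then 1 else 0))"

lemma compact_closed_region: "compact (closed_region s)"
proof -
  have "closed_region s = cball 0 (outer s) \<inter> - (\<Union>c\<in>centres s. ball c (radius s))" by (auto simp: closed_region_def)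
  thus ?thesis by (auto intro!: compact_Int_closed open_UN)
qed

lemma stage_exists:
  assumes Y: "finite Y" and U: "open U" "U \<subseteq> ball 0 R" and seg: "\<And>y x. y \<in> Y \<Longrightarrow> x \<in> {0..1} \<Longrightarrow> Complex x y \<in> U"
    and e: "\<epsilon> > 0" and m: "\<mu> > 0" "\<mu> \<le> 1" and R: "R \<ge> 1"
  obtains s where "valid_stage s" "heights s = Y" "outer s = R" "margin s \<le> \<mu>"
    "\<And>c. c \<in> centres s \<Longrightarrow> cball c (radius s) \<subseteq> U"
    "\<And>z. z \<in> cball 0 R - U \<Longrightarrow> dist (chart s z) z < \<epsilon>"
proof -
  obtain C r t f N where F: "finite C" "0 < r" "\<And>c. c \<in> C \<Longrightarrow> cball c r \<subseteq> U"
    "\<And>c c'. c \<in> C \<Longrightarrow> c' \<in> C \<Longrightarrow> c \<noteq> c' \<Longrightarrow> cball c r \<inter> cball c' r = {}"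
    "open N" "cball 0 R - (\<Union>c\<in>C. ball c r) \<subseteq> N" "f holomorphic_on N" "inj_on f N"
    "\<And>z. z \<in> cball 0 R - U \<Longrightarrow> dist (f z) z < \<epsilon>"
    "\<And>z. z \<in> N \<Longrightarrow> norm (f z) < R + 1"
    "\<And>y. y \<in> Y \<Longrightarrow> t y \<in> C"
    "\<And>y x z. y \<in> Y \<Longrightarrow> x \<in> {0..1} \<Longrightarrow> z \<in> N \<Longrightarrow> f z \<noteq> Complex x y"
    "\<And>y y' x. y \<in> Y \<Longrightarrow> y' \<in> Y \<Longrightarrow> x \<in> {0..1} \<Longrightarrow>
       winding_number (f \<circ> circlepath (t y) r) (Complex x y') = (if y' = y then 1 else 0)"
    by (rule generation[OF Y U seg e]) (assumption, assumption, (rule that; assumption))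
  define S where "S = (\<lambda>(x, y). Complex x y) ` ({0..1} \<times> Y)"
  have S: "compact S" unfolding S_def
    by (intro compact_continuous_image compact_Times finite_imp_compact Y compact_Icc)
       (auto simp: case_prod_unfold Complex_eq intro!: continuous_intros)
  define s0 where "s0 = \<lparr>heights = Y, outer = R, centres = C, radius = r, tips = t, chart = f, margin = 1\<rparr>"
  have cr: "closed_region s0 = cball 0 R - (\<Union>c\<in>C. ball c r)" by (simp add: closed_region_def s0_def)
  have "compact (f ` closed_region s0)"
    by (intro compact_continuous_image compact_closed_region continuous_on_subset[OF holomorphic_on_imp_continuous_on[OF F(7)]])
       (use F cr in auto)
  moreover have "f ` closed_region s0 \<inter> S = {}"
  proof -
    have "f z \<noteq> w" if zw: "z \<in> closed_region s0" "w \<in> S" for z w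
    proof -
      obtain p where p: "p \<in> {0..1} \<times> Y" "w = Complex (fst p) (snd p)"
        using zw(2) unfolding S_def by (auto simp: case_prod_unfold)
      have "z \<in> N" using zw(1) F(6) unfolding cr by (rule subsetD[rotated])
      thus ?thesis using F(12)[of "snd p" "fst p" z] p by (auto simp: mem_Times_iff)
    qed
    thus ?thesis by blast
  qed
  ultimately obtain \<delta> where \<delta>: "\<delta> > 0" "\<And>x y. x \<in> f ` closed_region s0 \<Longrightarrow> y \<in> S \<Longrightarrow> \<delta> \<le> dist x y"
    using separate_compact_closed[OF _ compact_imp_closed[OF S]] by metis
  define s where "s = s0\<lparr>margin := min \<delta> \<mu>\<rparr>"
  have cr': "closed_region s = cball 0 R - (\<Union>c\<in>C. ball c r)" by (simp add: closed_region_def s_def s0_def)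
  have marg: "min \<delta> \<mu> \<le> dist (f z) (Complex x y)" if "y \<in> Y" "x \<in> {0..1}" "z \<in> closed_region s" for x y z
  proof -
    have "Complex x y \<in> S" using that by (auto simp: S_def)
    moreover have "f z \<in> f ` closed_region s0" using that cr cr' by auto
    ultimately have "\<delta> \<le> dist (f z) (Complex x y)" using \<delta> by blast
    thus ?thesis by simp
  qed
  have CU: "cball c r \<subseteq> ball 0 R" if "c \<in> C" for c using F(3)[OF that] U(2) by blast
  have segR: "norm (Complex x y) < R" if "y \<in> Y" "x \<in> {0..1}" for x y using seg[OF that] U(2) by auto
  have "valid_stage s"
    unfolding valid_stage_def
  proof (intro conjI)
    show "\<exists>N. open N \<and> closed_region s \<subseteq> N \<and> chart s holomorphic_on N \<and> inj_on (chart s) N"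
      using F(5-8) cr' by (intro exI[of _ N]) (auto simp: s_def s0_def)
    show "\<forall>z\<in>closed_region s. norm (chart s z) < outer s + 1"
      using F(6,10) cr' by (auto simp: s_def s0_def)
    show "\<forall>y\<in>heights s. \<forall>x\<in>{0..1}. norm (Complex x y) < outer s \<and>
        (\<forall>z\<in>closed_region s. margin s \<le> dist (chart s z) (Complex x y))"
    proof (intro ballI conjI)
      fix y x z assume "y \<in> heights s" "x \<in> {0..1::real}"
      hence yx: "y \<in> Y" "x \<in> {0..1}" by (auto simp: s_def s0_def)
      show "norm (Complex x y) < outer s" using segR[OF yx] by (simp add: s_def s0_def)
      show "margin s \<le> dist (chart s z) (Complex x y)" if "z \<in> closed_region s"
        using marg[OF yx that] by (simp add: s_def s0_def)
    qed
  qed (use F CU \<delta> m R Y in \<open>simp_all add: s_def s0_def\<close>)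
  thus ?thesis
    by (rule that) (use F in \<open>auto simp: s_def s0_def\<close>)
qed

text \<open>Every height splits into two nearby ones. The new discs avoid the image of the old chart, and the
new chart moves the points of this image by a small part of the old margin.\<close>

definition next_stage :: "stage \<Rightarrow> stage \<Rightarrow> bool" where
  "next_stage s s' \<longleftrightarrow> (\<exists>\<tau>. 0 < \<tau> \<and> \<tau> \<le> margin s / 8 \<and> heights s' = heights s \<union> (\<lambda>y. y + \<tau>) ` heights s) \<and>
     margin s' \<le> margin s / 4 \<and> outer s' = outer s + 1 \<and>
     chart s ` closed_region s \<subseteq> open_region s' \<and>
     (\<forall>z\<in>chart s ` closed_region s. dist (chart s' z) z < margin s / 8)"

text \<open>Both copies of every old segment stay at positive distance from the compact image \<open>J\<close>
of the old chart, so the next generation can be carried out in the complement of \<open>J\<close>.\<close>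

lemma next_stage_exists:
  assumes s: "valid_stage s"
  obtains s' where "valid_stage s'" "next_stage s s'"
proof -
  note v = s[unfolded valid_stage_def]
  obtain N where N: "open N" "closed_region s \<subseteq> N" "chart s holomorphic_on N" "inj_on (chart s) N" using v by blast
  \<comment> \<open>small enough for the shifted segments to stay away from the image of the chart\<close>
  define \<tau> where "\<tau> = margin s / 8"
  have \<tau>: "\<tau> > 0" "\<tau> \<le> 1" using v by (auto simp: \<tau>_def)
  define Y where "Y = heights s \<union> (\<lambda>y. y + \<tau>) ` heights s"
  define J where "J = chart s ` closed_region s"
  have J: "compact J" unfolding J_def
    by (intro compact_continuous_image compact_closed_region continuous_on_subset[OF holomorphic_on_imp_continuous_on[OF N(3)] N(2)])
  define U where "U = ball 0 (outer s + 1) - J"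
  have U: "open U" unfolding U_def using J by (simp add: open_Diff compact_imp_closed)
  have UR: "U \<subseteq> ball 0 (outer s + 1)" by (auto simp: U_def)
  have seg: "Complex x y \<in> U" if y: "y \<in> Y" and x: "x \<in> {0..1}" for x y
  proof -
    obtain y0 where y0: "y0 \<in> heights s" "y = y0 \<or> y = y0 + \<tau>" using y by (auto simp: Y_def)
    have d: "dist (Complex x y) (Complex x y0) \<le> \<tau>"
      using y0 \<tau> by (auto simp: dist_norm cmod_def)
    have b: "norm (Complex x y0) < outer s" "\<And>z. z \<in> closed_region s \<Longrightarrow> margin s \<le> dist (chart s z) (Complex x y0)"
      using v y0(1) x by blast+
    have "norm (Complex x y) < outer s + 1"
      using b(1) d \<tau> norm_triangle_sub[of "Complex x y" "Complex x y0"] by (simp add: dist_norm)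
    moreover have "Complex x y \<notin> J"
    proof
      assume "Complex x y \<in> J"
      then obtain z where "z \<in> closed_region s" "chart s z = Complex x y" by (auto simp: J_def)
      hence "margin s \<le> \<tau>" using b(2)[of z] d by simp
      thus False using v by (simp add: \<tau>_def)
    qed
    ultimately show ?thesis by (simp add: U_def)
  qed
  obtain s' where s': "valid_stage s'" "heights s' = Y" "outer s' = outer s + 1" "margin s' \<le> margin s / 4"
    "\<And>c. c \<in> centres s' \<Longrightarrow> cball c (radius s') \<subseteq> U"
    "\<And>z. z \<in> cball 0 (outer s + 1) - U \<Longrightarrow> dist (chart s' z) z < margin s / 8"
  proof (rule stage_exists[OF _ U UR seg, where \<epsilon> = "margin s / 8" and \<mu> = "margin s / 4"])
    show "finite Y" using v by (simp add: Y_def)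
  qed (use v in auto)
  have JR: "J \<subseteq> ball 0 (outer s + 1)" using v by (auto simp: J_def)
  have "J \<subseteq> open_region s'"
    unfolding open_region_def using JR s'(3,5) by (auto simp: U_def)
  moreover have "dist (chart s' z) z < margin s / 8" if "z \<in> J" for z
    using s'(6)[of z] that JR by (auto simp: U_def)
  moreover have "\<exists>\<tau>. 0 < \<tau> \<and> \<tau> \<le> margin s / 8 \<and> heights s' = heights s \<union> (\<lambda>y. y + \<tau>) ` heights s"
    using \<tau> s'(2) by (intro exI[of _ \<tau>]) (simp add: Y_def \<tau>_def)
  ultimately have "next_stage s s'"
    unfolding next_stage_def using s'(3,4) by (simp add: J_def)
  thus ?thesis using that s'(1) by blast
qed

theorem stages_exist:
  obtains s where "\<And>n. valid_stage (s n)" "\<And>n. next_stage (s n) (s (Suc n))"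
    "heights (s 0) = {0}" "outer (s 0) = 10"
    "\<And>c. c \<in> centres (s 0) \<Longrightarrow> cball c (radius (s 0)) \<subseteq> ball 0 5"
    "\<And>z. 5 \<le> norm z \<Longrightarrow> norm z \<le> 10 \<Longrightarrow> dist (chart (s 0) z) z < 1"
proof -
  have seg: "Complex x y \<in> ball 0 5" if "y \<in> {0}" "x \<in> {0..1}" for x y
    using that by (auto simp: cmod_def)
  have sub: "ball 0 5 \<subseteq> (ball 0 10 :: complex set)" by auto
  obtain s0 where s0: "valid_stage s0" "heights s0 = {0}" "outer s0 = 10"
    "\<And>c. c \<in> centres s0 \<Longrightarrow> cball c (radius s0) \<subseteq> ball 0 5"
    "\<And>z. z \<in> cball 0 10 - ball 0 5 \<Longrightarrow> dist (chart s0 z) z < 1"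
    by (rule stage_exists[OF _ open_ball sub seg, where Y = "{0}" and \<epsilon> = 1 and \<mu> = 1]) (simp, assumption, assumption, simp, simp, simp, simp, (rule that; assumption))
  have "\<exists>f. \<forall>n. (valid_stage (f n) \<and> (n = 0 \<longrightarrow> f n = s0)) \<and> next_stage (f n) (f (Suc n))"
  proof (rule dependent_nat_choice)
    show "\<exists>x. valid_stage x \<and> (0 = (0::nat) \<longrightarrow> x = s0)" using s0(1) by blast
    show "\<exists>y. (valid_stage y \<and> (Suc n = 0 \<longrightarrow> y = s0)) \<and> next_stage x y"
      if "valid_stage x \<and> (n = 0 \<longrightarrow> x = s0)" for x n
      using next_stage_exists[of x] that by (metis nat.distinct(1))
  qed
  then obtain s where "\<forall>n. (valid_stage (s n) \<and> (n = 0 \<longrightarrow> s n = s0)) \<and> next_stage (s n) (s (Suc n))" ..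
  hence s: "\<And>n. valid_stage (s n)" "s 0 = s0" "\<And>n. next_stage (s n) (s (Suc n))" by blast+
  show ?thesis by (rule that[of s, OF s(1,3)]) (use s0 s(2) in auto)
qed

section \<open>Circular regions and limits of composed charts\<close>

text \<open>Induction on the number of discs by Janiszewski's theorem.\<close>

lemma connected_complement_discs:
  assumes "finite C" "r > 0" "\<And>c c'. c \<in> C \<Longrightarrow> c' \<in> C \<Longrightarrow> c \<noteq> c' \<Longrightarrow> cball c r \<inter> cball c' r = {}"
  shows "connected (- (\<Union>c\<in>C. cball c r) :: complex set)"
  using assms(1,3)
proof (induction C rule: finite_induct)
  case (insert c C)
  have "connected_component (- (\<Union>c\<in>C. cball c r) \<inter> - cball c r) a b"
    if "a \<in> - (\<Union>c\<in>C. cball c r) \<inter> - cball c r" "b \<in> - (\<Union>c\<in>C. cball c r) \<inter> - cball c r" for a b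
  proof -
    have "connected_component (- ((\<Union>c\<in>C. cball c r) \<union> cball c r)) a b"
    proof (rule Janiszewski)
      show "compact (\<Union>c\<in>C. cball c r)" using insert.hyps by (intro compact_UN) auto
      have "(\<Union>c\<in>C. cball c r) \<inter> cball c r = {}"
        using insert.prems[of _ c] insert.hyps by fastforce
      thus "connected ((\<Union>c\<in>C. cball c r) \<inter> cball c r)" by (simp only: connected_empty)
      have "connected (- (\<Union>c\<in>C. cball c r))" using insert.IH insert.prems by simp
      thus "connected_component (- (\<Union>c\<in>C. cball c r)) a b"
        using that connected_component_of_subset unfolding connected_component_def by blast
      have "connected (- cball c r)" by (intro connected_complement_bounded_convex) auto
      thus "connected_component (- cball c r) a b"
        using that unfolding connected_component_def by blast
    qed auto
    thus ?thesis by (simp only: Compl_Un)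
  qed
  hence "connected (- (\<Union>c\<in>C. cball c r) \<inter> - cball c r)" unfolding connected_iff_connected_component by blast
  thus ?case by (simp add: Int_commute)
qed auto

lemma open_open_region: "valid_stage s \<Longrightarrow> open (open_region s)"
proof -
  assume "valid_stage s"
  hence "finite (centres s)" by (simp add: valid_stage_def)
  thus ?thesis unfolding open_region_def by (intro open_Diff closed_UN) auto
qed

lemma open_subset_closed_region: "open_region s \<subseteq> closed_region s"
  by (force simp: open_region_def closed_region_def)

lemma connected_open_region:
  assumes "valid_stage s"
  shows "connected (open_region s)"
proof -
  note v = assms[unfolded valid_stage_def]
  define B where "B = (\<Union>c\<in>centres s. cball c (radius s))"
  have "connected (- B)" unfolding B_def
    by (rule connected_complement_discs) (use v in blast)+
  moreover have "finite (centres s)" using v by blast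
  hence "compact B" unfolding B_def by (intro compact_UN) auto
  moreover have "B \<subseteq> ball 0 (outer s)" unfolding B_def using v by blast
  ultimately have B: "connected (- B)" "compact B" "B \<subseteq> ball 0 (outer s)" .
  have eq: "open_region s = - (B \<union> - ball 0 (outer s))" by (auto simp: open_region_def B_def)
  have "connected_component (- (B \<union> - ball 0 (outer s))) a b"
    if "a \<in> open_region s" "b \<in> open_region s" for a b
  proof (rule Janiszewski)
    show "compact B" by (rule B)
    have "B \<inter> - ball 0 (outer s) = {}" using B(3) by blast
    thus "connected (B \<inter> - ball 0 (outer s))" by (simp only: connected_empty)
    show "connected_component (- B) a b" using that B(1) unfolding eq connected_component_def by blast
    have "a \<in> ball 0 (outer s)" "b \<in> ball 0 (outer s)" using that unfolding eq by blast+
    thus "connected_component (- (- ball 0 (outer s))) a b" unfolding connected_component_def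
      by (metis connected_ball double_compl order_refl)
  qed auto
  thus ?thesis unfolding connected_iff_connected_component eq by blast
qed

lemma frontier_region:
  assumes "valid_stage s"
  shows "closed_region s - open_region s = sphere 0 (outer s) \<union> (\<Union>c\<in>centres s. sphere c (radius s))"
proof -
  note v = assms[unfolded valid_stage_def]
  have 1: "cball c (radius s) \<subseteq> ball 0 (outer s)" if "c \<in> centres s" for c using v that by blast
  have 2: "cball c (radius s) \<inter> cball c' (radius s) = {}" if "c \<in> centres s" "c' \<in> centres s" "c \<noteq> c'" for c c'
    using v that by blast
  have "z \<in> closed_region s - open_region s" if c: "c \<in> centres s" "z \<in> sphere c (radius s)" for c z
  proof -
    have z: "z \<in> cball c (radius s)" "z \<notin> ball c (radius s)" using c by auto
    have "z \<notin> ball c' (radius s)" if "c' \<in> centres s" for c'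
    proof (cases "c' = c")
      case False
      hence "z \<notin> cball c' (radius s)" using 2[OF that c(1)] z by blast
      thus ?thesis by auto
    qed (use z in simp)
    moreover have "z \<in> cball 0 (outer s)" using subsetD[OF 1[OF c(1)] z(1)] by simp
    ultimately show ?thesis using z c(1) unfolding closed_region_def open_region_def by blast
  qed
  moreover have "z \<in> closed_region s - open_region s" if z: "z \<in> sphere 0 (outer s)" for z
  proof -
    have "z \<notin> cball c (radius s)" if "c \<in> centres s" for c using 1[OF that] z by force
    thus ?thesis using z unfolding closed_region_def open_region_def by force
  qed
  moreover have "closed_region s - open_region s \<subseteq> sphere 0 (outer s) \<union> (\<Union>c\<in>centres s. sphere c (radius s))"
    by (force simp: closed_region_def open_region_def)
  ultimately show ?thesis by blast
qed

text \<open>A point on a boundary circle is approached from inside the region along the line through the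
centre of that circle.\<close>

lemma closure_open_region:
  assumes "valid_stage s"
  shows "closed_region s \<subseteq> closure (open_region s)"
proof
  note v = assms[unfolded valid_stage_def]
  define B where "B = (\<lambda>C :: complex set. \<Union>c\<in>C. cball c (radius s))"
  fix z assume z: "z \<in> closed_region s"
  \<comment> \<open>approach the boundary point radially\<close>
  have rad: "z \<in> closure (open_region s)"
    if O: "open O'" "z \<in> O'" and a: "\<And>t. 0 < t \<Longrightarrow> t < 1 \<Longrightarrow> z + of_real t * w \<in> O' \<Longrightarrow> z + of_real t * w \<in> open_region s" for O' w
  proof -
    have lim: "((\<lambda>t. z + of_real t * w) \<longlongrightarrow> z + of_real 0 * w) (at_right (0::real))" by (intro tendsto_intros)
    have "\<forall>\<^sub>F t in at_right (0::real). z + of_real t * w \<in> O'"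
      using lim O by (intro topological_tendstoD) auto
    moreover have "\<forall>\<^sub>F t in at_right (0::real). t < 1" "\<forall>\<^sub>F t in at_right (0::real). 0 < t"
      by (auto simp: eventually_at_right_less eventually_at_right_field intro: exI[of _ "1::real"])
    ultimately have "\<forall>\<^sub>F t in at_right (0::real). z + of_real t * w \<in> closure (open_region s)"
      by eventually_elim (use a closure_subset in blast)
    thus ?thesis using Lim_in_closed_set[OF closed_closure _ _ lim] by simp
  qed
  show "z \<in> closure (open_region s)"
  proof (cases "z \<in> open_region s")
    case True
    thus ?thesis using closure_subset by blast
  next
    case False
    hence "z \<in> sphere 0 (outer s) \<union> (\<Union>c\<in>centres s. sphere c (radius s))"
      using frontier_region[OF assms] z by blast
    thus ?thesis
    proof
      assume zs: "z \<in> sphere 0 (outer s)"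
      have "z \<notin> B (centres s)" using v zs by (force simp: B_def)
      moreover have "open (- B (centres s))" unfolding B_def using v by (intro open_Compl closed_UN) auto
      ultimately show ?thesis
      proof (intro rad[of "- B (centres s)" "- z"])
        fix t :: real assume t: "0 < t" "t < 1" "z + of_real t * - z \<in> - B (centres s)"
        have "z + of_real t * - z = of_real (1 - t) * z" by (simp add: algebra_simps)
        hence "norm (z + of_real t * - z) = (1 - t) * norm z" using t
          by (simp only: norm_mult norm_of_real)
        also have "\<dots> < 1 * norm z" using t zs v by (intro mult_strict_right_mono) auto
        finally show "z + of_real t * - z \<in> open_region s" using t zs by (auto simp: open_region_def B_def)
      qed auto
    next
      assume "z \<in> (\<Union>c\<in>centres s. sphere c (radius s))"
      then obtain c where c: "c \<in> centres s" "dist c z = radius s" by auto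
      define O' where "O' = ball 0 (outer s) \<inter> - B (centres s - {c})"
      have "cball c (radius s) \<subseteq> ball 0 (outer s)" using v c by blast
      hence "z \<in> ball 0 (outer s)" by (rule subsetD) (use c in simp)
      moreover have "z \<notin> cball c' (radius s)" if "c' \<in> centres s" "c' \<noteq> c" for c'
      proof -
        have "cball c' (radius s) \<inter> cball c (radius s) = {}" using v that c(1) by blast
        thus ?thesis using c(2) by auto
      qed
      ultimately have zO: "z \<in> O'" by (auto simp: O'_def B_def)
      have "open O'" unfolding O'_def B_def using v by (intro open_Int open_Compl closed_UN) auto
      thus ?thesis using zO
      proof (rule rad[of _ "z - c"])
        fix t :: real assume t: "0 < t" "t < 1" "z + of_real t * (z - c) \<in> O'"
        have "z + of_real t * (z - c) - c = of_real (1 + t) * (z - c)" by (simp add: algebra_simps)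
        hence "norm (z + of_real t * (z - c) - c) = (1 + t) * norm (z - c)" using t
          by (simp only: norm_mult norm_of_real)
        also have "norm (z - c) = radius s" using c by (simp add: dist_norm norm_minus_commute)
        also have "(1 + t) * radius s > 1 * radius s" using t v by (intro mult_strict_right_mono) auto
        finally have "z + of_real t * (z - c) \<notin> cball c (radius s)" by (simp add: dist_norm norm_minus_commute)
        thus "z + of_real t * (z - c) \<in> open_region s" using t(3) by (auto simp: open_region_def O'_def B_def)
      qed
    qed
  qed
qed

text \<open>The conditions \<open>centres_0\<close> and \<open>chart_0\<close> keep the limit maps from being
constant: the first circle domain contains, and the first chart moves by less than 1, the points of the ring
\<open>5 \<le> \<bar>z\<bar> < 10\<close>.\<close>

locale tower =
  fixes s :: "nat \<Rightarrow> stage"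
  assumes valid: "\<And>n. valid_stage (s n)" and nxt: "\<And>n. next_stage (s n) (s (Suc n))"
    and heights_0: "heights (s 0) = {0}" and outer_0: "outer (s 0) = 10"
    and centres_0: "\<And>c. c \<in> centres (s 0) \<Longrightarrow> cball c (radius (s 0)) \<subseteq> ball 0 5"
    and chart_0: "\<And>z. 5 \<le> norm z \<Longrightarrow> norm z \<le> 10 \<Longrightarrow> dist (chart (s 0) z) z < 1"
begin

primrec iter :: "nat \<Rightarrow> nat \<Rightarrow> complex \<Rightarrow> complex" where
  "iter n 0 z = z"
| "iter n (Suc k) z = chart (s (n + k)) (iter n k z)"

definition limit_map :: "nat \<Rightarrow> complex \<Rightarrow> complex" where
  "limit_map n z = lim (\<lambda>k. iter n k z)"

abbreviation "inn n \<equiv> open_region (s n)"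
abbreviation "clo n \<equiv> closed_region (s n)"

lemma margin_pos: "margin (s n) > 0" and margin_le_1: "margin (s n) \<le> 1"
  using valid[of n] by (auto simp: valid_stage_def)

lemma margin_Suc: "margin (s (Suc n)) \<le> margin (s n) / 4"
  using nxt[of n] by (simp add: next_stage_def)

lemma chart_image: "chart (s n) ` clo n \<subseteq> inn (Suc n)"
  using nxt[of n] by (simp add: next_stage_def)

lemma iter_mem: "z \<in> clo n \<Longrightarrow> iter n k z \<in> clo (n + k)"
proof (induction k)
  case (Suc k)
  thus ?case using chart_image[of "n + k"] open_subset_closed_region by fastforce
qed simp

lemma iter_shift: "iter n (Suc k) z = iter (Suc n) k (chart (s n) z)"
  by (induction k) simp_all

lemma chart_nbhd:
  obtains N where "open N" "clo n \<subseteq> N" "chart (s n) holomorphic_on N" "inj_on (chart (s n)) N"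
  using valid[of n] by (auto simp: valid_stage_def)

lemma iter_holomorphic: "iter n k holomorphic_on inn n"
proof (induction k)
  case 0
  have "(\<lambda>z. z) holomorphic_on inn n" by (rule holomorphic_on_ident)
  thus ?case by (simp add: fun_eq_iff cong: holomorphic_cong)
next
  case (Suc k)
  obtain N where N: "clo (n + k) \<subseteq> N" "chart (s (n + k)) holomorphic_on N" using chart_nbhd by blast
  have "iter n k ` inn n \<subseteq> N" using iter_mem open_subset_closed_region N by blast
  from holomorphic_on_compose_gen[OF Suc N(2) this]
  show ?case by (simp add: o_def fun_eq_iff cong: holomorphic_cong)
qed

lemma iter_inj: "inj_on (iter n k) (clo n)"
proof (induction k)
  case (Suc k)
  obtain N where N: "clo (n + k) \<subseteq> N" "inj_on (chart (s (n + k))) N" using chart_nbhd by blast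
  have "inj_on (chart (s (n + k))) (iter n k ` clo n)"
    using N iter_mem by (meson image_subset_iff inj_on_subset subset_trans)
  from comp_inj_on[OF Suc this] show ?case by (simp add: o_def inj_on_def)
qed simp

lemma iter_close_step:
  assumes "z \<in> clo n"
  shows "dist (iter n (Suc (Suc k)) z) (iter n (Suc k) z) \<le> margin (s (n + k)) / 8"
proof -
  have "iter n (Suc k) z \<in> chart (s (n + k)) ` clo (n + k)" using iter_mem[OF assms, of k] by simp
  thus ?thesis using nxt[of "n + k"] by (auto simp: next_stage_def less_imp_le)
qed

text \<open>Successive displacements are dominated by a geometric series with ratio \<open>1/4\<close>, and
\<open>1/8 + (1/4) * (1/6) = 1/6\<close>.\<close>

lemma iter_close:
  assumes "z \<in> clo n"
  shows "dist (iter n (Suc (k + m)) z) (iter n (Suc k) z) \<le> margin (s (n + k)) / 6"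
proof (induction m arbitrary: k)
  case 0
  thus ?case using margin_pos[of "n + k"] by simp
next
  case (Suc m)
  have "dist (iter n (Suc (Suc k + m)) z) (iter n (Suc (Suc k)) z) \<le> margin (s (n + Suc k)) / 6"
    by (rule Suc.IH)
  also have "\<dots> \<le> margin (s (n + k)) / 24" using margin_Suc[of "n + k"] by simp
  finally have "dist (iter n (Suc (k + Suc m)) z) (iter n (Suc (Suc k)) z) \<le> margin (s (n + k)) / 24"
    by (simp only: add_Suc add_Suc_right)
  thus ?case
    using iter_close_step[OF assms, of k] dist_triangle[of "iter n (Suc (k + Suc m)) z" "iter n (Suc k) z" "iter n (Suc (Suc k)) z"]
    by linarith
qed

lemma margin_tendsto: "(\<lambda>k. margin (s (n + k))) \<longlonglongrightarrow> 0"
proof (rule tendsto_sandwich[of "\<lambda>_. 0" _ _ "\<lambda>k. (1/4) ^ k"])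
  have "margin (s (n + k)) \<le> (1/4) ^ k" for k
  proof (induction k)
    case 0
    show ?case using margin_le_1[of n] by simp
  next
    case (Suc k)
    thus ?case using margin_Suc[of "n + k"] by simp
  qed
  thus "\<forall>\<^sub>F k in sequentially. margin (s (n + k)) \<le> (1/4) ^ k" by simp
  show "(\<lambda>k. (1/4) ^ k) \<longlonglongrightarrow> (0::real)" by (rule LIMSEQ_power_zero) simp
qed (auto intro!: always_eventually less_imp_le margin_pos)

lemma iter_converges:
  assumes "z \<in> clo n"
  shows "(\<lambda>k. iter n k z) \<longlonglongrightarrow> limit_map n z"
proof -
  have "Cauchy (\<lambda>k. iter n (Suc k) z)"
  proof (rule metric_CauchyI)
    fix e :: real assume "e > 0"
    hence "\<forall>\<^sub>F k in sequentially. margin (s (n + k)) < e" using order_tendstoD(2)[OF margin_tendsto] by blast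
    then obtain M where M: "margin (s (n + M)) < e" by (auto simp: eventually_sequentially)
    show "\<exists>M. \<forall>i\<ge>M. \<forall>j\<ge>M. dist (iter n (Suc i) z) (iter n (Suc j) z) < e"
    proof (intro exI[of _ M] allI impI)
      fix i j assume "M \<le> i" "M \<le> j"
      hence "dist (iter n (Suc i) z) (iter n (Suc M) z) \<le> margin (s (n + M)) / 6"
        "dist (iter n (Suc j) z) (iter n (Suc M) z) \<le> margin (s (n + M)) / 6"
        using iter_close[OF assms, of M "i - M"] iter_close[OF assms, of M "j - M"] by simp_all
      thus "dist (iter n (Suc i) z) (iter n (Suc j) z) < e"
        using dist_triangle2[of "iter n (Suc i) z" "iter n (Suc j) z" "iter n (Suc M) z"] M margin_pos[of "n + M"]
        by linarith
    qed
  qed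
  hence "convergent (\<lambda>k. iter n (Suc k) z)" by (rule Cauchy_convergent)
  hence "convergent (\<lambda>k. iter n k z)" using convergent_Suc_iff[of "\<lambda>k. iter n k z"] by blast
  thus ?thesis unfolding limit_map_def by (simp add: convergent_LIMSEQ_iff)
qed

lemma limit_close:
  assumes "z \<in> clo n"
  shows "dist (limit_map n z) (iter n (Suc k) z) \<le> margin (s (n + k)) / 6"
proof -
  have "(\<lambda>m. iter n (m + Suc k) z) \<longlonglongrightarrow> limit_map n z"
    using LIMSEQ_ignore_initial_segment[OF iter_converges[OF assms]] .
  hence "(\<lambda>m. dist (iter n (m + Suc k) z) (iter n (Suc k) z)) \<longlonglongrightarrow> dist (limit_map n z) (iter n (Suc k) z)"
    by (intro tendsto_intros)
  moreover have "dist (iter n (m + Suc k) z) (iter n (Suc k) z) \<le> margin (s (n + k)) / 6" for m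
    using iter_close[OF assms, of k m] by (simp add: add.commute)
  ultimately show ?thesis by (intro LIMSEQ_le_const2) auto
qed

lemma limit_uniform: "uniform_limit (clo n) (iter n) (limit_map n) sequentially"
proof (rule uniform_limitI)
  fix e :: real assume "e > 0"
  hence "\<forall>\<^sub>F k in sequentially. margin (s (n + k)) < e" using order_tendstoD(2)[OF margin_tendsto] by blast
  hence "\<forall>\<^sub>F k in sequentially. \<forall>z\<in>clo n. dist (iter n (Suc k) z) (limit_map n z) < e"
  proof eventually_elim
    case (elim k)
    thus ?case using limit_close[of _ n k] margin_pos[of "n + k"] by (force simp: dist_commute)
  qed
  thus "\<forall>\<^sub>F k in sequentially. \<forall>z\<in>clo n. dist (iter n k z) (limit_map n z) < e"
    using eventually_sequentially_Suc[of "\<lambda>k. \<forall>z\<in>clo n. dist (iter n k z) (limit_map n z) < e"] by blast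
qed

lemma limit_map_chart:
  assumes "z \<in> clo n"
  shows "limit_map n z = limit_map (Suc n) (chart (s n) z)"
proof -
  have "chart (s n) z \<in> clo (Suc n)" using chart_image assms open_subset_closed_region by blast
  hence "(\<lambda>k. iter n (Suc k) z) \<longlonglongrightarrow> limit_map (Suc n) (chart (s n) z)"
    using iter_converges unfolding iter_shift by blast
  moreover have "(\<lambda>k. iter n (Suc k) z) \<longlonglongrightarrow> limit_map n z"
    using LIMSEQ_Suc[OF iter_converges[OF assms]] .
  ultimately show ?thesis by (rule LIMSEQ_unique[symmetric])
qed

lemma limit_holomorphic: "limit_map n holomorphic_on inn n"
proof (rule holomorphic_uniform_sequence[OF open_open_region[OF valid] iter_holomorphic])
  fix z assume "z \<in> inn n"
  then obtain d where "d > 0" "cball z d \<subseteq> inn n"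
    using open_open_region[OF valid] open_contains_cball by blast
  thus "\<exists>d>0. cball z d \<subseteq> inn n \<and> uniform_limit (cball z d) (iter n) (limit_map n) sequentially"
    using uniform_limit_on_subset[OF limit_uniform, of "cball z d"] open_subset_closed_region by blast
qed

text \<open>The first limit map moves the points \<open>\<plusminus> 7\<close> by at most 2. A later limit map
that is constant would make all earlier ones constant.\<close>

lemma limit_nonconstant: "\<not> limit_map n constant_on inn n"
proof (induction n)
  case 0
  have mem: "of_real x \<in> inn 0" if "\<bar>x\<bar> = 7" for x :: real
    using centres_0 that outer_0 by (force simp: open_region_def)
  have "dist (limit_map 0 (of_real x)) (of_real x) \<le> 2" if "\<bar>x\<bar> = 7" for x :: real
  proof -
    have "dist (limit_map 0 (of_real x)) (iter 0 (Suc 0) (of_real x)) \<le> margin (s (0 + 0)) / 6"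
      using mem[OF that] open_subset_closed_region by (intro limit_close) blast
    moreover have "dist (chart (s 0) (of_real x)) (of_real x) < 1" using chart_0[of "of_real x"] that by simp
    ultimately show ?thesis
      using margin_le_1[of 0] dist_triangle[of "limit_map 0 (of_real x)" "of_real x" "chart (s 0) (of_real x)"] by simp
  qed
  from this[of 7] this[of "-7"] have
    "dist (limit_map 0 7) 7 \<le> 2" "dist (limit_map 0 (-7)) (-7) \<le> 2" by simp_all
  moreover have "dist (7::complex) (-7) = 14" by (simp add: dist_norm)
  ultimately have "limit_map 0 7 \<noteq> limit_map 0 (-7)"
    using dist_triangle[of 7 "-7" "limit_map 0 7"] by (auto simp: dist_commute)
  moreover have "7 \<in> inn 0" "-7 \<in> inn 0" using mem[of 7] mem[of "-7"] by simp_all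
  ultimately show ?case unfolding constant_on_def by metis
next
  case (Suc n)
  show ?case
  proof
    assume "limit_map (Suc n) constant_on inn (Suc n)"
    then obtain a where "\<And>w. w \<in> inn (Suc n) \<Longrightarrow> limit_map (Suc n) w = a" unfolding constant_on_def by blast
    hence "limit_map n z = a" if "z \<in> inn n" for z
      using limit_map_chart[of z n] chart_image[of n] that open_subset_closed_region by blast
    with Suc show False unfolding constant_on_def by blast
  qed
qed

text \<open>Hurwitz' theorem for the univalent maps \<open>iter n k\<close>.\<close>

lemma limit_inj_open: "inj_on (limit_map n) (inn n)"
proof (rule Hurwitz_injective[OF open_open_region[OF valid] connected_open_region[OF valid] iter_holomorphic limit_holomorphic _ limit_nonconstant])
  show "uniform_limit A (iter n) (limit_map n) sequentially" if "compact A" "A \<subseteq> inn n" for A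
    using uniform_limit_on_subset[OF limit_uniform, of A] that open_subset_closed_region by blast
  show "inj_on (iter n k) (inn n)" for k
    by (rule inj_on_subset[OF iter_inj open_subset_closed_region])
qed

text \<open>The chart maps the closed region into the next open region, so injectivity on open regions
suffices.\<close>

lemma limit_inj: "inj_on (limit_map n) (clo n)"
proof -
  obtain N where N: "clo n \<subseteq> N" "inj_on (chart (s n)) N" using chart_nbhd by blast
  have "inj_on (chart (s n)) (clo n)" by (rule inj_on_subset[OF N(2,1)])
  moreover have "inj_on (limit_map (Suc n)) (chart (s n) ` clo n)"
    by (rule inj_on_subset[OF limit_inj_open chart_image])
  ultimately have "inj_on (limit_map (Suc n) \<circ> chart (s n)) (clo n)" by (rule comp_inj_on)
  thus ?thesis using limit_map_chart by (auto simp: inj_on_def)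
qed

lemma limit_continuous: "continuous_on (clo n) (limit_map n)"
proof -
  obtain N where N: "clo n \<subseteq> N" "chart (s n) holomorphic_on N" using chart_nbhd by blast
  have "continuous_on (clo n) (chart (s n))"
    by (rule continuous_on_subset[OF holomorphic_on_imp_continuous_on[OF N(2)] N(1)])
  moreover have "continuous_on (inn (Suc n)) (limit_map (Suc n))"
    by (rule holomorphic_on_imp_continuous_on[OF limit_holomorphic])
  ultimately have "continuous_on (clo n) (\<lambda>z. limit_map (Suc n) (chart (s n) z))"
    using continuous_on_compose2[OF _ _ chart_image] by blast
  thus ?thesis by (rule continuous_on_eq) (use limit_map_chart in auto)
qed

definition dom :: "nat \<Rightarrow> complex set" where "dom n = limit_map n ` inn n"
definition limit_dom :: "complex set" where "limit_dom = (\<Union>n. dom n)"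

lemma open_dom: "open (dom n)"
  unfolding dom_def by (rule open_mapping_thm3[OF limit_holomorphic open_open_region[OF valid] limit_inj_open])

lemma connected_dom: "connected (dom n)"
  unfolding dom_def
  by (intro connected_continuous_image connected_open_region valid holomorphic_on_imp_continuous_on limit_holomorphic)

text \<open>The boundary curves of one domain lie in the next one.\<close>

lemma closed_image_subset: "limit_map n ` clo n \<subseteq> dom (Suc n)"
  using limit_map_chart chart_image unfolding dom_def by force

lemma dom_mono: "dom n \<subseteq> dom (Suc n)"
  using closed_image_subset[of n] open_subset_closed_region[of "s n"] unfolding dom_def by blast

lemma frontier_dom: "frontier (dom n) = limit_map n ` (sphere 0 (outer (s n)) \<union> (\<Union>c\<in>centres (s n). sphere c (radius (s n))))"
proof -
  have "compact (limit_map n ` clo n)" by (intro compact_continuous_image limit_continuous compact_closed_region)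
  hence cl: "closed (limit_map n ` clo n)" by (rule compact_imp_closed)
  have "closure (dom n) \<subseteq> limit_map n ` clo n"
    using cl open_subset_closed_region unfolding dom_def by (intro closure_minimal) auto
  moreover have "closure (inn n) = clo n"
    using closure_open_region[OF valid] compact_imp_closed[OF compact_closed_region] closure_minimal[OF open_subset_closed_region]
    by blast
  hence eq: "closure (inn n) = clo n" .
  have "limit_map n ` closure (inn n) \<subseteq> closure (dom n)"
    by (rule image_closure_subset) (use eq limit_continuous[of n] closure_subset[of "dom n"] in \<open>simp_all add: dom_def\<close>)
  hence "limit_map n ` clo n \<subseteq> closure (dom n)" unfolding eq .
  ultimately have "frontier (dom n) = limit_map n ` clo n - limit_map n ` inn n"
    using open_dom[of n] by (simp add: frontier_def interior_open dom_def[symmetric])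
  also have "\<dots> = limit_map n ` (clo n - inn n)"
    by (rule inj_on_image_set_diff[OF limit_inj[of n], symmetric]) (use open_subset_closed_region in auto)
  finally show ?thesis unfolding frontier_region[OF valid] .
qed

end

section \<open>Branches and loops that separate them\<close>

text \<open>The winding number is locally constant off the curve and vanishes far away, so the bounded set
where it is 1 has its boundary on the curve.\<close>

lemma winding_level_region:
  assumes "path \<gamma>" "pathfinish \<gamma> = pathstart \<gamma>"
  defines "E \<equiv> {z. z \<notin> path_image \<gamma> \<and> winding_number \<gamma> z = 1}"
  shows "open E" "compact (E \<union> path_image \<gamma>)"
proof -
  show "open E" unfolding E_def by (rule open_winding_number_levelsets[OF assms(1,2)])
  have "E \<union> path_image \<gamma> = - (\<Union>k\<in>-{1}. {z. z \<notin> path_image \<gamma> \<and> winding_number \<gamma> z = k})"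
    by (auto simp: E_def)
  moreover have "open (\<Union>k\<in>-{1}. {z. z \<notin> path_image \<gamma> \<and> winding_number \<gamma> z = k})"
    by (intro open_UN ballI open_winding_number_levelsets assms)
  ultimately have "closed (E \<union> path_image \<gamma>)" by (metis closed_Compl)
  moreover obtain B where B: "\<And>z. B \<le> cmod z \<Longrightarrow> winding_number \<gamma> z = 0"
    using winding_number_zero_at_infinity[OF assms(1,2)] by blast
  have "E \<subseteq> cball 0 B"
  proof
    fix z assume "z \<in> E"
    hence "\<not> B \<le> cmod z" using B by (auto simp: E_def)
    thus "z \<in> cball 0 B" by simp
  qed
  hence "bounded (E \<union> path_image \<gamma>)"
    using bounded_subset[OF bounded_cball] bounded_path_image[OF assms(1)] by (simp add: bounded_Un)
  ultimately show "compact (E \<union> path_image \<gamma>)" by (simp add: compact_eq_bounded_closed)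
qed

context tower begin

text \<open>The amount by which the heights split is only asserted to exist, hence the choice.\<close>

definition shift :: "nat \<Rightarrow> real" where
  "shift n = (SOME \<tau>. 0 < \<tau> \<and> \<tau> \<le> margin (s n) / 8 \<and> heights (s (Suc n)) = heights (s n) \<union> (\<lambda>y. y + \<tau>) ` heights (s n))"

lemma shift: "0 < shift n" "shift n \<le> margin (s n) / 8"
  "heights (s (Suc n)) = heights (s n) \<union> (\<lambda>y. y + shift n) ` heights (s n)"
proof -
  have "\<exists>\<tau>. 0 < \<tau> \<and> \<tau> \<le> margin (s n) / 8 \<and> heights (s (Suc n)) = heights (s n) \<union> (\<lambda>y. y + \<tau>) ` heights (s n)"
    using nxt[of n] by (simp add: next_stage_def)
  from someI_ex[OF this] show "0 < shift n" "shift n \<le> margin (s n) / 8"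
    "heights (s (Suc n)) = heights (s n) \<union> (\<lambda>y. y + shift n) ` heights (s n)"
    unfolding shift_def by auto
qed

text \<open>The path of \<open>\<sigma>\<close> through the binary tree of heights.\<close>

primrec height :: "(nat \<Rightarrow> bool) \<Rightarrow> nat \<Rightarrow> real" where
  "height \<sigma> 0 = 0"
| "height \<sigma> (Suc n) = height \<sigma> n + (if \<sigma> n then shift n else 0)"

definition limit_height :: "(nat \<Rightarrow> bool) \<Rightarrow> real" where "limit_height \<sigma> = lim (height \<sigma>)"

definition branch :: "(nat \<Rightarrow> bool) \<Rightarrow> complex set" where
  "branch \<sigma> = closed_segment (Complex 0 (limit_height \<sigma>)) (Complex 1 (limit_height \<sigma>))"

lemma height_mem: "height \<sigma> n \<in> heights (s n)"
  by (induction n) (auto simp: heights_0 shift(3))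

lemma height_step: "height \<sigma> (n + m) \<ge> height \<sigma> n \<and> height \<sigma> (n + m) - height \<sigma> n \<le> margin (s n) / 6"
proof (induction m arbitrary: n)
  case 0
  show ?case using margin_pos[of n] by simp
next
  case (Suc m)
  have "height \<sigma> (Suc n + m) \<ge> height \<sigma> (Suc n) \<and> height \<sigma> (Suc n + m) - height \<sigma> (Suc n) \<le> margin (s (Suc n)) / 6"
    by (rule Suc.IH)
  moreover have "height \<sigma> (Suc n) - height \<sigma> n \<le> margin (s n) / 8" "height \<sigma> (Suc n) - height \<sigma> n \<ge> 0"
    using shift[of n] margin_pos[of n] by auto
  ultimately show ?case using margin_Suc[of n] by simp
qed

lemma height_limit: "height \<sigma> \<longlonglongrightarrow> limit_height \<sigma>"
proof -
  have "incseq (height \<sigma>)" unfolding incseq_Suc_iff using shift(1) less_imp_le by auto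
  moreover have "\<forall>n. height \<sigma> n \<le> margin (s 0) / 6" using height_step[of \<sigma> 0] by simp
  ultimately obtain L where "height \<sigma> \<longlonglongrightarrow> L" using incseq_convergent by blast
  thus ?thesis unfolding limit_height_def by (simp add: limI)
qed

lemma height_close: "\<bar>limit_height \<sigma> - height \<sigma> n\<bar> \<le> margin (s n) / 6"
proof -
  have lim: "(\<lambda>m. height \<sigma> (m + n)) \<longlonglongrightarrow> limit_height \<sigma>"
    using LIMSEQ_ignore_initial_segment[OF height_limit] .
  have b: "height \<sigma> (m + n) \<le> height \<sigma> n + margin (s n) / 6" "height \<sigma> n \<le> height \<sigma> (m + n)" for m
    using height_step[of \<sigma> n m] by (simp_all add: add.commute[of n])
  have "limit_height \<sigma> \<le> height \<sigma> n + margin (s n) / 6"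
    by (rule LIMSEQ_le_const2[OF lim]) (use b(1) in blast)
  moreover have "height \<sigma> n \<le> limit_height \<sigma>"
    by (rule LIMSEQ_le_const[OF lim]) (use b(2) in blast)
  ultimately show ?thesis by linarith
qed

lemma branch_iff: "p \<in> branch \<sigma> \<longleftrightarrow> Im p = limit_height \<sigma> \<and> 0 \<le> Re p \<and> Re p \<le> 1"
proof
  assume "p \<in> branch \<sigma>"
  then obtain t where t: "0 \<le> t" "t \<le> 1" "p = (1 - t) *\<^sub>R Complex 0 (limit_height \<sigma>) + t *\<^sub>R Complex 1 (limit_height \<sigma>)"
    unfolding branch_def in_segment by auto
  show "Im p = limit_height \<sigma> \<and> 0 \<le> Re p \<and> Re p \<le> 1" unfolding t(3) using t(1,2) by (simp add: algebra_simps)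
next
  assume "Im p = limit_height \<sigma> \<and> 0 \<le> Re p \<and> Re p \<le> 1"
  thus "p \<in> branch \<sigma>" unfolding branch_def in_segment
    by (intro conjI exI[of _ "Re p"]) (auto simp: complex_eq_iff algebra_simps)
qed

lemma branch_near:
  assumes "p \<in> branch \<sigma>"
  shows "dist p (Complex (Re p) (height \<sigma> n)) \<le> margin (s n) / 6" "Re p \<in> {0..1}"
proof -
  have "p - Complex (Re p) (height \<sigma> n) = Complex 0 (limit_height \<sigma> - height \<sigma> n)"
    using assms by (simp add: branch_iff complex_eq_iff)
  thus "dist p (Complex (Re p) (height \<sigma> n)) \<le> margin (s n) / 6"
    using height_close[of \<sigma> n] by (simp add: dist_norm cmod_def)
qed (use assms in \<open>simp add: branch_iff\<close>)

lemma chart_far: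
  assumes "y \<in> heights (s n)" "x \<in> {0..1}" "z \<in> clo n"
  shows "margin (s n) \<le> dist (chart (s n) z) (Complex x y)"
  using valid[of n] assms unfolding valid_stage_def by blast

lemma chart_far_branch:
  assumes "p \<in> branch \<sigma>" "z \<in> clo n"
  shows "5 / 6 * margin (s n) \<le> dist (chart (s n) z) p"
  using chart_far[OF height_mem[of \<sigma> n] branch_near(2)[OF assms(1)] assms(2)] branch_near(1)[OF assms(1), of n]
    dist_triangle[of "chart (s n) z" "Complex (Re p) (height \<sigma> n)" p] by (simp add: dist_commute)

lemma limit_close_chart: "z \<in> clo n \<Longrightarrow> dist (limit_map n z) (chart (s n) z) \<le> margin (s n) / 6"
  using limit_close[of z n 0] by simp

text \<open>The map \<open>limit_map n\<close> is within a sixth of the margin of the chart, whereas the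
branch is within a sixth of the margin of a segment at distance at least the margin from the image of the
chart.\<close>

lemma branch_avoids: "branch \<sigma> \<inter> limit_dom = {}"
proof (rule ccontr)
  assume "branch \<sigma> \<inter> limit_dom \<noteq> {}"
  then obtain p n z where p: "p \<in> branch \<sigma>" "z \<in> inn n" "p = limit_map n z"
    unfolding limit_dom_def dom_def by auto
  have z: "z \<in> clo n" using p(2) open_subset_closed_region by blast
  show False
    using chart_far_branch[OF p(1) z] limit_close_chart[OF z] margin_pos[of n] unfolding p(3)[symmetric]
    by (simp add: dist_commute)
qed

lemma circle_in_clo: "c \<in> centres (s n) \<Longrightarrow> sphere c (radius (s n)) \<subseteq> clo n"
  using frontier_region[OF valid[of n]] by blast

text \<open>On the circle about a tip \<open>limit_map n\<close> differs from the chart by less than the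
distance to the branch, so the two image loops have the same winding number about \<open>p\<close>. That of
the chart does not change on the way from \<open>p\<close> to the segment at height \<open>height \<sigma>
n\<close>, where it is known.\<close>

lemma boundary_winding:
  assumes y: "y \<in> heights (s n)" and p: "p \<in> branch \<sigma>"
  shows "winding_number (limit_map n \<circ> circlepath (tips (s n) y) (radius (s n))) p = (if height \<sigma> n = y then 1 else 0)"
    "p \<notin> path_image (limit_map n \<circ> circlepath (tips (s n) y) (radius (s n)))"
proof -
  define C where "C = circlepath (tips (s n) y) (radius (s n))"
  define g where "g = chart (s n) \<circ> C"
  define h where "h = limit_map n \<circ> C"
  have tip: "tips (s n) y \<in> centres (s n)" and r: "radius (s n) > 0"
    using valid[of n] y unfolding valid_stage_def by blast+
  have imC: "path_image C \<subseteq> clo n" using circle_in_clo[OF tip] r by (simp add: C_def)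
  have Cm: "C t \<in> clo n" if "t \<in> {0..1}" for t using imC that unfolding path_image_def by blast
  obtain N where N: "clo n \<subseteq> N" "chart (s n) holomorphic_on N" using chart_nbhd by blast
  have contc: "continuous_on (path_image C) (chart (s n))"
    by (rule continuous_on_subset[OF holomorphic_on_imp_continuous_on[OF N(2)]]) (use imC N in blast)
  have paths: "path g" "path h" unfolding g_def h_def
    by (intro path_continuous_image contc continuous_on_subset[OF limit_continuous imC]; simp add: C_def)+
  have loops: "pathfinish g = pathstart g" "pathfinish h = pathstart h"
    unfolding g_def h_def by (simp_all add: C_def pathfinish_compose pathstart_compose)
  have near: "norm (h t - g t) < norm (g t - p)" if "t \<in> {0..1}" for t
    using limit_close_chart[OF Cm[OF that]] chart_far_branch[OF p Cm[OF that]] margin_pos[of n]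
    unfolding g_def h_def o_def dist_norm by simp
  have hg: "winding_number h p = winding_number g p"
    by (rule winding_number_nearby_loops_eq[OF paths loops near])
  define q where "q = Complex (Re p) (height \<sigma> n)"
  have pq: "p \<in> cball q (margin (s n) / 6)" "q \<in> cball q (margin (s n) / 6)"
    using branch_near(1)[OF p, of n] margin_pos[of n] by (simp_all add: q_def dist_commute)
  have "cball q (margin (s n) / 6) \<inter> path_image g = {}"
  proof (rule ccontr)
    assume "cball q (margin (s n) / 6) \<inter> path_image g \<noteq> {}"
    then obtain w where w: "w \<in> path_image g" "dist q w \<le> margin (s n) / 6" by auto
    then obtain t where t: "t \<in> {0..1}" "dist q (g t) \<le> margin (s n) / 6" unfolding path_image_def by blast
    thus False using chart_far[OF height_mem[of \<sigma> n] branch_near(2)[OF p] Cm[OF t(1)]] margin_pos[of n]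
      by (simp add: q_def g_def dist_commute)
  qed
  hence "winding_number g p = winding_number g q"
    by (intro winding_number_eq[OF paths(1) loops(1) pq]) auto
  also have "\<dots> = (if height \<sigma> n = y then 1 else 0)"
    using valid[of n] y height_mem[of \<sigma> n] branch_near(2)[OF p] unfolding valid_stage_def g_def C_def q_def by blast
  finally show "winding_number (limit_map n \<circ> circlepath (tips (s n) y) (radius (s n))) p = (if height \<sigma> n = y then 1 else 0)"
    using hg by (simp add: h_def C_def)
  show "p \<notin> path_image (limit_map n \<circ> circlepath (tips (s n) y) (radius (s n)))"
  proof
    assume "p \<in> path_image (limit_map n \<circ> circlepath (tips (s n) y) (radius (s n)))"
    then obtain t where "t \<in> {0..1}" "p = h t" unfolding path_image_def h_def C_def by auto
    thus False using near[of t] by (simp add: norm_minus_commute)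
  qed
qed

text \<open>Right after the first index at which the two sequences differ, the corresponding heights differ,
and the image of the circle about one tip encloses exactly one of the two branches. This loop lies in the
limit domain.\<close>

theorem branch_separation:
  assumes "\<sigma> \<noteq> \<sigma>'"
  obtains E G where "open E" "compact (E \<union> G)" "G \<subseteq> limit_dom" "branch \<sigma> \<subseteq> E" "branch \<sigma>' \<inter> E = {}"
proof -
  obtain k where k: "\<sigma> k \<noteq> \<sigma>' k" using assms by auto
  define i where "i = (LEAST k. \<sigma> k \<noteq> \<sigma>' k)"
  have i: "\<sigma> i \<noteq> \<sigma>' i" unfolding i_def by (rule LeastI[of _ k]) (rule k)
  have below: "\<sigma> j = \<sigma>' j" if "j < i" for j using not_less_Least that unfolding i_def by blast
  have "height \<sigma> m = height \<sigma>' m" if "m \<le> i" for m using that by (induction m) (auto simp: below)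
  hence "height \<sigma> i = height \<sigma>' i" by simp
  hence "height \<sigma> (Suc i) \<noteq> height \<sigma>' (Suc i)" using i shift(1)[of i] by (cases "\<sigma> i") auto
  define n where "n = Suc i"
  have ne: "height \<sigma> n \<noteq> height \<sigma>' n" using \<open>height \<sigma> (Suc i) \<noteq> height \<sigma>' (Suc i)\<close> unfolding n_def .
  define y where "y = height \<sigma> n"
  have y: "y \<in> heights (s n)" by (simp add: y_def height_mem)
  define \<gamma> where "\<gamma> = limit_map n \<circ> circlepath (tips (s n) y) (radius (s n))"
  have tip: "tips (s n) y \<in> centres (s n)" and r: "radius (s n) > 0"
    using valid[of n] y unfolding valid_stage_def by blast+
  have imC: "path_image (circlepath (tips (s n) y) (radius (s n))) \<subseteq> clo n" using circle_in_clo[OF tip] r by simp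
  have \<gamma>: "path \<gamma>" "pathfinish \<gamma> = pathstart \<gamma>"
    unfolding \<gamma>_def
    by (intro path_continuous_image continuous_on_subset[OF limit_continuous imC], simp)
       (simp add: pathfinish_compose pathstart_compose)
  define E where "E = {z. z \<notin> path_image \<gamma> \<and> winding_number \<gamma> z = 1}"
  show ?thesis
  proof (rule that[of E "path_image \<gamma>"])
    show "open E" "compact (E \<union> path_image \<gamma>)" unfolding E_def using winding_level_region[OF \<gamma>] by auto
    have "path_image \<gamma> \<subseteq> limit_map n ` clo n" unfolding \<gamma>_def path_image_compose using imC by blast
    thus "path_image \<gamma> \<subseteq> limit_dom" using closed_image_subset[of n] unfolding limit_dom_def by blast
    show "branch \<sigma> \<subseteq> E" using boundary_winding[OF y, of _ \<sigma>] unfolding E_def \<gamma>_def y_def by auto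
    show "branch \<sigma>' \<inter> E = {}" using boundary_winding[OF y, of _ \<sigma>'] ne unfolding E_def \<gamma>_def y_def by auto
  qed
qed

end

section \<open>Moebius transformations of the sphere\<close>

text \<open>Inverse stereographic projection in homogeneous coordinates \<open>u : v\<close>; here
\<open>Infty\<close> is the point \<open>1 : 0\<close>.\<close>

definition hom_point :: "complex \<Rightarrow> complex \<Rightarrow> complex \<times> real" where
  "hom_point u v = (2 * u * cnj v / of_real ((norm u)\<^sup>2 + (norm v)\<^sup>2),
     ((norm u)\<^sup>2 - (norm v)\<^sup>2) / ((norm u)\<^sup>2 + (norm v)\<^sup>2))"

lemma hom_point_Fin: "to_unit_sphere (Fin z) = hom_point z 1"
  and hom_point_Infty: "to_unit_sphere Infty = hom_point 1 0"
  by (simp_all add: hom_point_def add.commute)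

lemma hom_point_scale:
  assumes "k \<noteq> 0"
  shows "hom_point (k * u) (k * v) = hom_point u v"
proof -
  define K where "K = (norm k)\<^sup>2"
  have K: "K \<noteq> 0" "of_real K = k * cnj k" using assms by (simp add: K_def) (simp only: K_def complex_norm_square)
  have "2 * (k * u) * cnj (k * v) = of_real K * (2 * u * cnj v)" unfolding K by simp
  moreover have "(norm (k * u))\<^sup>2 + (norm (k * v))\<^sup>2 = K * ((norm u)\<^sup>2 + (norm v)\<^sup>2)"
    "(norm (k * u))\<^sup>2 - (norm (k * v))\<^sup>2 = K * ((norm u)\<^sup>2 - (norm v)\<^sup>2)"
    by (simp_all add: K_def norm_mult power_mult_distrib algebra_simps)
  ultimately show ?thesis unfolding hom_point_def using K assms by simp
qed

lemma hom_point_ratio: "v \<noteq> 0 \<Longrightarrow> to_unit_sphere (Fin (u / v)) = hom_point u v"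
  using hom_point_scale[of v "u / v" 1] unfolding hom_point_Fin by simp

fun mob :: "complex \<Rightarrow> complex \<Rightarrow> complex \<Rightarrow> complex \<Rightarrow> riemann_sphere \<Rightarrow> riemann_sphere" where
  "mob a b c d (Fin z) = (if c * z + d = 0 then Infty else Fin ((a * z + b) / (c * z + d)))"
| "mob a b c d Infty = (if c = 0 then Infty else Fin (a / c))"

lemma mob_nonzero:
  assumes "a * d - b * c \<noteq> 0" "c * z + d = 0"
  shows "a * z + b \<noteq> (0::complex)"
proof
  assume az: "a * z + b = 0"
  have "a * d - b * c = a * (c * z + d) - c * (a * z + b)" by (simp add: algebra_simps)
  thus False using assms az by simp
qed

lemma mob_inverse:
  assumes "a * d - b * c \<noteq> 0"
  shows "mob d (- b) (- c) a (mob a b c d p) = p"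
proof (cases p)
  case (Fin z)
  show ?thesis
  proof (cases "c * z + d = 0")
    case True
    have "c \<noteq> 0" using True assms by auto
    moreover have "d = - (c * z)" using True by (simp add: eq_neg_iff_add_eq_0 add.commute)
    ultimately show ?thesis using True Fin by simp
  next
    case False
    define w where "w = (a * z + b) / (c * z + d)"
    have 1: "- c * w + a = (a * d - b * c) / (c * z + d)" "d * w + - b = z * (a * d - b * c) / (c * z + d)"
      using False by (simp_all add: w_def field_simps)
    hence "- c * w + a \<noteq> 0" "(d * w + - b) / (- c * w + a) = z" using False assms by simp_all
    thus ?thesis using False Fin by (simp add: w_def[symmetric])
  qed
next
  case Infty
  show ?thesis
  proof (cases "c = 0")
    case True
    thus ?thesis using Infty assms by simp
  next
    case False
    thus ?thesis using Infty assms by (simp add: field_simps)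
  qed
qed

lemma mob_hom:
  assumes "a * d - b * c \<noteq> 0"
  shows "to_unit_sphere (mob a b c d (Fin z)) = hom_point (a * z + b) (c * z + d)"
    "to_unit_sphere (mob a b c d Infty) = hom_point a c"
proof -
  show "to_unit_sphere (mob a b c d (Fin z)) = hom_point (a * z + b) (c * z + d)"
  proof (cases "c * z + d = 0")
    case True
    thus ?thesis using hom_point_scale[OF mob_nonzero[OF assms True], of 1 0] by (simp add: hom_point_Infty del: to_unit_sphere.simps)
  next
    case False
    thus ?thesis by (simp only: mob.simps if_False hom_point_ratio not_False_eq_True)
  qed
  show "to_unit_sphere (mob a b c d Infty) = hom_point a c"
  proof (cases "c = 0")
    case True
    hence "a \<noteq> 0" using assms by auto
    thus ?thesis using hom_point_scale[of a 1 0] True by (simp add: hom_point_Infty del: to_unit_sphere.simps)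
  next
    case False
    thus ?thesis using hom_point_ratio[OF False] by simp
  qed
qed

text \<open>Up to the factor \<open>\<bar>u\<bar>\<^sup>2 + \<bar>v\<bar>\<^sup>2\<close> this is \<open>(a u
+ b v) * cnj (c u + d v)\<close> and the next function is \<open>\<bar>a u + b v\<bar>\<^sup>2\<close>,
written in terms of the point \<open>X\<close> of the unit sphere with homogeneous coordinates \<open>u :
v\<close>. Both are affine in \<open>X\<close>.\<close>

definition quad_mixed :: "complex \<Rightarrow> complex \<Rightarrow> complex \<Rightarrow> complex \<Rightarrow> complex \<times> real \<Rightarrow> complex" where
  "quad_mixed a b c d X = (a * cnj c * (1 + snd X) + a * cnj d * fst X + b * cnj c * cnj (fst X) + b * cnj d * (1 - snd X)) / 2"

definition quad_norm :: "complex \<Rightarrow> complex \<Rightarrow> complex \<times> real \<Rightarrow> real" where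
  "quad_norm a b X = ((norm a)\<^sup>2 * (1 + snd X) + (norm b)\<^sup>2 * (1 - snd X)) / 2 + Re (a * cnj b * fst X)"

lemma quad_hom:
  assumes "(u, v) \<noteq> (0, 0)"
  defines "S \<equiv> (norm u)\<^sup>2 + (norm v)\<^sup>2"
  shows "quad_mixed a b c d (hom_point u v) = (a * u + b * v) * cnj (c * u + d * v) / of_real S"
    "quad_norm a b (hom_point u v) = (norm (a * u + b * v))\<^sup>2 / S" "S > 0"
proof -
  show S: "S > 0" using assms by (auto simp: S_def add_pos_nonneg add_nonneg_pos)
  have sn: "1 + snd (hom_point u v) = 2 * (norm u)\<^sup>2 / S" "1 - snd (hom_point u v) = 2 * (norm v)\<^sup>2 / S"
    using S by (simp_all add: hom_point_def S_def[symmetric] field_simps)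
  have fs: "fst (hom_point u v) = 2 * u * cnj v / of_real S" by (simp add: hom_point_def S_def)
  have nu: "complex_of_real ((norm u)\<^sup>2) = u * cnj u" "complex_of_real ((norm v)\<^sup>2) = v * cnj v"
    by (simp_all only: complex_norm_square)
  have sn': "complex_of_real (1 + snd (hom_point u v)) = 2 * (u * cnj u) / of_real S"
    "complex_of_real (1 - snd (hom_point u v)) = 2 * (v * cnj v) / of_real S"
    using arg_cong[OF sn(1), of complex_of_real] arg_cong[OF sn(2), of complex_of_real] nu by simp_all
  show "quad_mixed a b c d (hom_point u v) = (a * u + b * v) * cnj (c * u + d * v) / of_real S"
    unfolding quad_mixed_def sn' fs using S by (simp add: field_simps)
  have "complex_of_real ((norm (a * u + b * v))\<^sup>2) = (a * u + b * v) * cnj (a * u + b * v)"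
    by (simp only: complex_norm_square)
  hence "(norm (a * u + b * v))\<^sup>2 = Re ((a * u + b * v) * cnj (a * u + b * v))"
    by (metis Re_complex_of_real)
  also have "\<dots> = (norm a)\<^sup>2 * (norm u)\<^sup>2 + (norm b)\<^sup>2 * (norm v)\<^sup>2 + 2 * Re (a * cnj b * (u * cnj v))"
    unfolding cmod_power2 by (simp add: power2_eq_square algebra_simps)
  finally have nn: "(norm (a * u + b * v))\<^sup>2 = (norm a)\<^sup>2 * (norm u)\<^sup>2 + (norm b)\<^sup>2 * (norm v)\<^sup>2 + 2 * Re (a * cnj b * (u * cnj v))" .
  have re: "Re (a * cnj b * fst (hom_point u v)) = 2 * Re (a * cnj b * (u * cnj v)) / S"
  proof -
    have "a * cnj b * fst (hom_point u v) = (2 / S) *\<^sub>R (a * cnj b * (u * cnj v))"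
      unfolding fs scaleR_conv_of_real by simp
    thus ?thesis by (simp only: scaleR_complex.sel) simp
  qed
  define Q where "Q = Re (a * cnj b * (u * cnj v))"
  show "quad_norm a b (hom_point u v) = (norm (a * u + b * v))\<^sup>2 / S"
    unfolding quad_norm_def sn nn re Q_def[symmetric] using S by (simp add: field_simps)
qed

text \<open>On the unit sphere a Moebius transformation is a quotient of affine maps with a positive common
denominator. Its continuity and the invariance of spherical caps can be read off from this form.\<close>

lemma to_unit_sphere_mob:
  fixes a b c d p
  assumes det: "a * d - b * c \<noteq> 0"
  defines "X \<equiv> to_unit_sphere p"
  shows "to_unit_sphere (mob a b c d p) = (2 * quad_mixed a b c d X / of_real (quad_norm a b X + quad_norm c d X),
           (quad_norm a b X - quad_norm c d X) / (quad_norm a b X + quad_norm c d X))"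
    "quad_norm a b X + quad_norm c d X > 0"
proof -
  obtain u v where uv: "(u, v) \<noteq> (0, 0)" "X = hom_point u v" "to_unit_sphere (mob a b c d p) = hom_point (a * u + b * v) (c * u + d * v)"
  proof (cases p)
    case (Fin z)
    thus ?thesis using that[of z 1] mob_hom(1)[OF det, of z] hom_point_Fin[of z] by (simp add: X_def del: to_unit_sphere.simps mob.simps)
  next
    case Infty
    thus ?thesis using that[of 1 0] mob_hom(2)[OF det] hom_point_Infty by (simp add: X_def del: to_unit_sphere.simps mob.simps)
  qed
  define S where "S = (norm u)\<^sup>2 + (norm v)\<^sup>2"
  note q = quad_hom[OF uv(1), folded S_def uv(2)]
  have S: "S > 0" using q(3)[of] .
  define A B where "A = a * u + b * v" and "B = c * u + d * v"
  have "A \<noteq> 0 \<or> B \<noteq> 0"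
  proof (rule ccontr)
    assume "\<not> (A \<noteq> 0 \<or> B \<noteq> 0)"
    moreover have "(a * d - b * c) * u = d * A - b * B" "(a * d - b * c) * v = a * B - c * A"
      by (simp_all add: A_def B_def algebra_simps)
    ultimately have "(a * d - b * c) * u = 0" "(a * d - b * c) * v = 0" by auto
    thus False using det uv(1) by simp
  qed
  hence N: "(norm A)\<^sup>2 + (norm B)\<^sup>2 > 0" by (auto simp: add_pos_nonneg add_nonneg_pos)
  have qn: "quad_norm a b X = (norm A)\<^sup>2 / S" "quad_norm c d X = (norm B)\<^sup>2 / S" "quad_mixed a b c d X = A * cnj B / of_real S"
    using q by (simp_all add: A_def B_def)
  have sum: "quad_norm a b X + quad_norm c d X = ((norm A)\<^sup>2 + (norm B)\<^sup>2) / S" by (simp add: qn add_divide_distrib)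
  show "quad_norm a b X + quad_norm c d X > 0" unfolding sum using S N by simp
  have dif: "quad_norm a b X - quad_norm c d X = ((norm A)\<^sup>2 - (norm B)\<^sup>2) / S" by (simp add: qn diff_divide_distrib)
  have S': "complex_of_real S \<noteq> 0" using S by simp
  have "hom_point A B = (2 * quad_mixed a b c d X / of_real (quad_norm a b X + quad_norm c d X),
           (quad_norm a b X - quad_norm c d X) / (quad_norm a b X + quad_norm c d X))"
    unfolding sum dif qn(3) hom_point_def prod.inject using S S' by (simp only: of_real_divide) simp
  thus "to_unit_sphere (mob a b c d p) = (2 * quad_mixed a b c d X / of_real (quad_norm a b X + quad_norm c d X),
           (quad_norm a b X - quad_norm c d X) / (quad_norm a b X + quad_norm c d X))"
    using uv(3) by (simp add: A_def B_def)
qed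

lemma continuous_on_sphere_iff:
  fixes f :: "'a::metric_space \<Rightarrow> riemann_sphere"
  shows "continuous_on S f \<longleftrightarrow> continuous_on S (\<lambda>x. to_unit_sphere (f x))"
  unfolding continuous_on_iff dist_riemann_sphere_def ..

lemma continuous_to_unit_sphere: "continuous_on S to_unit_sphere"
  using continuous_on_sphere_iff[of S "\<lambda>x. x"] by simp

lemma continuous_Fin: "continuous_on S Fin"
  unfolding continuous_on_sphere_iff to_unit_sphere.simps
  by (intro continuous_intros) (auto simp: add_nonneg_eq_0_iff add_pos_nonneg)

lemma continuous_mob:
  assumes "a * d - b * c \<noteq> 0"
  shows "continuous_on S (mob a b c d)"
  unfolding continuous_on_sphere_iff to_unit_sphere_mob(1)[OF assms]
proof (intro continuous_intros)
  have n: "continuous_on S (\<lambda>x. quad_norm a b (to_unit_sphere x))" for a b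
    unfolding quad_norm_def by (intro continuous_intros continuous_to_unit_sphere) simp_all
  have pos: "quad_norm a b (to_unit_sphere x) + quad_norm c d (to_unit_sphere x) \<noteq> 0" for x
    using to_unit_sphere_mob(2)[OF assms, of x] by simp
  show "continuous_on S (\<lambda>x. quad_mixed a b c d (to_unit_sphere x))"
    unfolding quad_mixed_def by (intro continuous_intros continuous_to_unit_sphere) simp_all
  show "continuous_on S (\<lambda>x. quad_norm a b (to_unit_sphere x))" "continuous_on S (\<lambda>x. quad_norm c d (to_unit_sphere x))"
    using n by auto
  show "\<forall>x\<in>S. complex_of_real (quad_norm a b (to_unit_sphere x) + quad_norm c d (to_unit_sphere x)) \<noteq> 0"
    using pos by (metis of_real_eq_0_iff)
  show "\<forall>x\<in>S. quad_norm a b (to_unit_sphere x) + quad_norm c d (to_unit_sphere x) \<noteq> 0" using pos by blast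
qed (auto simp: quad_norm_def intro!: continuous_intros continuous_to_unit_sphere)

section \<open>Spherical caps\<close>

lemma one_plus_norm_pos: "1 + (norm (z::complex))\<^sup>2 > 0"
  by (simp add: add_pos_nonneg)

lemma Fin_mem_image [simp]: "Fin z \<in> Fin ` A \<longleftrightarrow> z \<in> A" "Infty \<notin> Fin ` A"
  by auto

lemma to_unit_sphere_Fin:
  "to_unit_sphere (Fin z) = ((2 / (1 + (norm z)\<^sup>2)) *\<^sub>R z, ((norm z)\<^sup>2 - 1) / ((norm z)\<^sup>2 + 1))"
  by (simp add: scaleR_conv_of_real)

lemma norm_to_unit_sphere: "norm (to_unit_sphere p) = 1"
proof (cases p)
  case (Fin z)
  define N where "N = (norm z)\<^sup>2"
  have N: "N \<ge> 0" by (simp add: N_def)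
  have "(norm (to_unit_sphere p))\<^sup>2 = (2 / (1 + N))\<^sup>2 * N + ((N - 1) / (N + 1))\<^sup>2"
    unfolding Fin to_unit_sphere_Fin norm_Pair using N by (simp add: power_mult_distrib power_divide N_def)
  also have "\<dots> = ((2\<^sup>2 * N) + (N - 1)\<^sup>2) / (N + 1)\<^sup>2"
    by (simp add: power_divide add_divide_distrib add.commute)
  also have "\<dots> = (N + 1)\<^sup>2 / (N + 1)\<^sup>2" by (simp add: power2_eq_square algebra_simps)
  also have "\<dots> = 1" using N by simp
  finally show ?thesis by (simp add: power2_eq_1_iff) (use norm_ge_zero[of "to_unit_sphere p"] in linarith)
next
  case Infty
  thus ?thesis by (simp add: norm_Pair)
qed

lemma to_unit_sphere_surj:
  assumes "norm X = 1"
  obtains p where "to_unit_sphere p = X"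
proof (cases "snd X = 1")
  case True
  have "(norm (fst X))\<^sup>2 + (snd X)\<^sup>2 = 1" using assms by (cases X) (simp add: norm_Pair)
  hence "fst X = 0" using True by simp
  thus ?thesis using True by (intro that[of Infty]) (simp add: prod_eq_iff)
next
  case False
  have n: "(norm (fst X))\<^sup>2 = 1 - (snd X)\<^sup>2" using assms by (cases X) (simp add: norm_Pair)
  define t where "t = snd X"
  have "\<bar>t\<bar> \<le> 1" using n zero_le_power2[of "norm (fst X)"] unfolding t_def[symmetric]
    by (simp add: abs_square_le_1)
  hence t: "1 - t > 0" using False by (simp add: t_def abs_le_iff)
  define z where "z = fst X / of_real (1 - t)"
  have "(norm z)\<^sup>2 = (1 - t\<^sup>2) / (1 - t)\<^sup>2"
    unfolding z_def norm_divide norm_of_real power_divide n t_def[symmetric] by simp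
  also have "\<dots> = (1 + t) / (1 - t)"
    using t by (simp add: power2_eq_square frac_eq_eq) (simp add: algebra_simps)
  finally have nz: "(norm z)\<^sup>2 = (1 + t) / (1 - t)" .
  have s: "1 + (1 + t) / (1 - t) = 2 / (1 - t)" "(1 + t) / (1 - t) + 1 = 2 / (1 - t)" "(1 + t) / (1 - t) - 1 = 2 * t / (1 - t)"
    using t by (simp_all add: field_simps)
  have ct: "1 - complex_of_real t \<noteq> 0" using t by (metis less_numeral_extra(3) of_real_1 of_real_diff of_real_eq_0_iff)
  have "to_unit_sphere (Fin z) = (of_real (1 - t) * z, t)"
    unfolding to_unit_sphere.simps nz s using t by simp
  also have "\<dots> = X" using t ct by (simp add: z_def prod_eq_iff t_def)
  finally show ?thesis by (rule that)
qed

lemma dist_sphere_inner: "(dist p q)\<^sup>2 = 2 - 2 * (to_unit_sphere p \<bullet> to_unit_sphere q)"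
  by (simp add: dist_riemann_sphere_def dist_norm power2_norm_eq_inner inner_diff inner_commute)
    (simp flip: power2_norm_eq_inner add: norm_to_unit_sphere)

lemma dist_sphere_le_2: "dist p q \<le> (2::real)" for p q :: riemann_sphere
  unfolding dist_riemann_sphere_def using norm_triangle_ineq4[of "to_unit_sphere p" "to_unit_sphere q"]
  by (simp add: dist_norm norm_to_unit_sphere)

lemma inner_to_unit_sphere_Fin:
  "(w, t) \<bullet> to_unit_sphere (Fin z) = (2 * (w \<bullet> z) + t * ((norm z)\<^sup>2 - 1)) / (1 + (norm z)\<^sup>2)"
proof -
  have "(w, t) \<bullet> to_unit_sphere (Fin z) = 2 / (1 + (norm z)\<^sup>2) * (w \<bullet> z) + t * ((norm z)\<^sup>2 - 1) / (1 + (norm z)\<^sup>2)"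
    unfolding to_unit_sphere_Fin inner_prod_def by (simp add: add.commute)
  thus ?thesis by (simp add: add_divide_distrib)
qed

text \<open>The chordal distance is \<open>2 \<bar>z - w\<bar>\<close> divided by a number that is at least
1.\<close>

lemma dist_Fin_le: "dist (Fin z) (Fin w) \<le> 2 * dist z w"
proof -
  define A B where "A = 1 + (norm z)\<^sup>2" and "B = 1 + (norm w)\<^sup>2"
  have AB: "A \<ge> 1" "B \<ge> 1" by (simp_all add: A_def B_def)
  have "(dist (Fin z) (Fin w))\<^sup>2 = 2 - 2 * ((2 * (2 / A * (z \<bullet> w)) + (A - 2) / A * (B - 2)) / B)"
    unfolding dist_sphere_inner to_unit_sphere_Fin[of z] inner_to_unit_sphere_Fin by (simp add: A_def B_def add.commute)
  also have "2 - 2 * ((2 * (2 / A * (z \<bullet> w)) + (A - 2) / A * (B - 2)) / B) = 4 * (A + B - 2 - 2 * (z \<bullet> w)) / (A * B)"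
    using AB by (simp add: field_simps)
  also have "A + B - 2 - 2 * (z \<bullet> w) = (dist z w)\<^sup>2"
    by (simp add: A_def B_def dist_norm power2_norm_eq_inner inner_diff inner_commute)
  also have "4 * (dist z w)\<^sup>2 / (A * B) \<le> 4 * (dist z w)\<^sup>2 / 1"
    using AB mult_mono[of 1 A 1 B] by (intro divide_left_mono) auto
  finally have "(dist (Fin z) (Fin w))\<^sup>2 \<le> (2 * dist z w)\<^sup>2" by (simp add: power_mult_distrib)
  thus ?thesis by (rule power2_le_imp_le) simp
qed

text \<open>The part of the sphere on one side of a plane; it may be empty, a point or the whole
sphere.\<close>

definition cap :: "complex \<times> real \<Rightarrow> real \<Rightarrow> riemann_sphere set" where
  "cap n t = {p. t \<le> n \<bullet> to_unit_sphere p}"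

text \<open>A witness strictly on either side of the plane makes the cap a closed disk.\<close>

definition proper_cap :: "riemann_sphere set \<Rightarrow> bool" where
  "proper_cap B \<longleftrightarrow> (\<exists>n t p q. B = cap n t \<and> t < n \<bullet> to_unit_sphere p \<and> n \<bullet> to_unit_sphere q < t)"

text \<open>If \<open>c\<close> is the unit vector in direction \<open>n\<close>, then \<open>dist c x\<close>
squared is 2 minus twice the inner product of \<open>c\<close> and \<open>x\<close>, so a bound on the inner
product is a bound on the distance from \<open>c\<close>.\<close>

lemma proper_cap_closed_disk:
  assumes "proper_cap B"
  shows "closed_disk B"
proof -
  obtain n t p q where B: "B = cap n t" "t < n \<bullet> to_unit_sphere p" "n \<bullet> to_unit_sphere q < t"
    using assms unfolding proper_cap_def by blast
  have 1: "\<bar>n \<bullet> to_unit_sphere p\<bar> \<le> norm n" for p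
    using Cauchy_Schwarz_ineq2[of n "to_unit_sphere p"] by (simp add: norm_to_unit_sphere)
  have t: "\<bar>t\<bar> < norm n" using B(2,3) 1[of p] 1[of q] by linarith
  hence n: "norm n > 0" by linarith
  have "norm (n /\<^sub>R norm n) = 1" using n by simp
  then obtain c where c: "to_unit_sphere c = n /\<^sub>R norm n" by (rule to_unit_sphere_surj)
  define r where "r = sqrt (2 - 2 * (t / norm n))"
  have tn: "- 1 < t / norm n" "t / norm n < 1" using t n by (simp_all add: field_simps abs_less_iff)
  have r: "r\<^sup>2 = 2 - 2 * (t / norm n)" "r > 0" using tn by (simp_all add: r_def)
  have "r\<^sup>2 < 2\<^sup>2" using r(1) tn by simp
  hence "r < 2" by (rule power2_less_imp_less) simp
  moreover have "x \<in> cball c r \<longleftrightarrow> x \<in> cap n t" for x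
  proof -
    have "x \<in> cball c r \<longleftrightarrow> (dist c x)\<^sup>2 \<le> r\<^sup>2" using r(2) by (simp add: abs_le_square_iff[symmetric])
    also have "\<dots> \<longleftrightarrow> t / norm n \<le> (n \<bullet> to_unit_sphere x) / norm n"
      unfolding dist_sphere_inner r(1) c by (simp add: divide_inverse mult.commute)
    also have "\<dots> \<longleftrightarrow> x \<in> cap n t" using n by (simp add: divide_le_cancel cap_def)
    finally show ?thesis .
  qed
  hence "B = cball c r" unfolding B(1) by blast
  ultimately show ?thesis using r(2) unfolding closed_disk_def by blast
qed

lemma affine_inner:
  fixes G :: "complex \<times> real \<Rightarrow> real"
  assumes "linear (\<lambda>X. G X - G 0)"
  obtains n t where "\<forall>X. G X = n \<bullet> X - t"
proof
  show "\<forall>X. G X = adjoint (\<lambda>X. G X - G 0) 1 \<bullet> X - (- G 0)"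
    using adjoint_works[OF assms, of _ 1] by (simp add: inner_commute)
qed

lemma linear_quad_mixed: "linear (\<lambda>X. quad_mixed a b c d X - quad_mixed a b c d 0)"
  by (rule linearI) (simp_all add: quad_mixed_def field_simps scaleR_conv_of_real)

lemma linear_quad_norm: "linear (\<lambda>X. quad_norm a b X - quad_norm a b 0)"
  by (rule linearI) (simp_all add: quad_norm_def field_simps)

lemma mob_surj: "a * d - b * c \<noteq> 0 \<Longrightarrow> mob a b c d (mob d (- b) (- c) a p) = p"
  using mob_inverse[of d a "- b" "- c" p] by (simp add: mult.commute)

lemma mob_image_vimage: "a * d - b * c \<noteq> 0 \<Longrightarrow> mob a b c d ` A = mob d (- b) (- c) a -` A"
  using mob_inverse[of a d b c] mob_surj[of a d b c] by (auto simp: image_iff) metis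

lemma mob_bij: "a * d - b * c \<noteq> 0 \<Longrightarrow> bij (mob a b c d)"
  using mob_inverse[of a d b c] mob_surj[of a d b c] by (metis bij_betw_byWitness subset_UNIV)

text \<open>The inequality that defines the cap, pulled back by the inverse transformation and multiplied by
the positive denominator, is again affine.\<close>

lemma proper_cap_mob:
  assumes det: "a * d - b * c \<noteq> 0" and B: "proper_cap B"
  shows "proper_cap (mob a b c d ` B)"
proof -
  obtain n t p q where B: "B = cap n t" "t < n \<bullet> to_unit_sphere p" "n \<bullet> to_unit_sphere q < t"
    using B unfolding proper_cap_def by blast
  have det': "d * a - (- b) * (- c) \<noteq> 0" using det by (simp add: mult.commute)
  let ?W1 = "quad_norm d (- b)" and ?W2 = "quad_norm (- c) a" and ?W = "quad_mixed d (- b) (- c) a"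
  define G where "G X = n \<bullet> (2 * ?W X, ?W1 X - ?W2 X) - t * (?W1 X + ?W2 X)" for X
  have "G X - G 0 = 2 * (fst n \<bullet> (?W X - ?W 0)) + (snd n - t) * (?W1 X - ?W1 0) - (snd n + t) * (?W2 X - ?W2 0)" for X
  proof -
    have 2: "n \<bullet> (2 * w, r) = 2 * (fst n \<bullet> w) + snd n * r" for w r
      by (simp add: inner_prod_def inner_complex_def)
    show ?thesis unfolding G_def 2 inner_diff_right by (simp only: algebra_simps)
  qed
  moreover have "linear (\<lambda>X. 2 * (fst n \<bullet> (?W X - ?W 0)) + (snd n - t) * (?W1 X - ?W1 0) - (snd n + t) * (?W2 X - ?W2 0))"
  proof -
    have "linear (\<lambda>X. 2 * (fst n \<bullet> f X) + p * g X - q * h X)" if "linear f" "linear g" "linear h"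
      for f :: "complex \<times> real \<Rightarrow> complex" and g h and p q :: real
      using that unfolding linear_conv_bounded_linear by (intro bounded_linear_intros)
    thus ?thesis using linear_quad_mixed linear_quad_norm by blast
  qed
  ultimately have "linear (\<lambda>X. G X - G 0)" by presburger
  then obtain n' t' where n': "\<forall>X. G X = n' \<bullet> X - t'" by (rule affine_inner)
  have eq: "\<exists>w>0. n' \<bullet> to_unit_sphere x - t' = w * (n \<bullet> to_unit_sphere (mob d (- b) (- c) a x) - t)" for x
  proof -
    let ?X = "to_unit_sphere x"
    have pos: "?W1 ?X + ?W2 ?X > 0" using to_unit_sphere_mob(2)[OF det'] .
    have eq: "to_unit_sphere (mob d (- b) (- c) a x) = (2 * ?W ?X, ?W1 ?X - ?W2 ?X) /\<^sub>R (?W1 ?X + ?W2 ?X)"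
      unfolding to_unit_sphere_mob(1)[OF det'] by (simp add: scaleR_conv_of_real divide_inverse mult.commute)
    have "(?W1 ?X + ?W2 ?X) * (n \<bullet> to_unit_sphere (mob d (- b) (- c) a x) - t) = G ?X"
      unfolding eq inner_scaleR_right G_def using pos by (simp add: field_simps)
    thus ?thesis using pos n' by (metis)
  qed
  have sgn: "t' \<le> n' \<bullet> to_unit_sphere x \<longleftrightarrow> t \<le> n \<bullet> to_unit_sphere (mob d (- b) (- c) a x)"
    "t' < n' \<bullet> to_unit_sphere x \<longleftrightarrow> t < n \<bullet> to_unit_sphere (mob d (- b) (- c) a x)"
    "n' \<bullet> to_unit_sphere x < t' \<longleftrightarrow> n \<bullet> to_unit_sphere (mob d (- b) (- c) a x) < t" for x
  proof -
    obtain w where w: "w > 0" "n' \<bullet> to_unit_sphere x - t' = w * (n \<bullet> to_unit_sphere (mob d (- b) (- c) a x) - t)"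
      using eq by blast
    define A where "A = n \<bullet> to_unit_sphere (mob d (- b) (- c) a x) - t"
    have "0 \<le> w * A \<longleftrightarrow> 0 \<le> A" "0 < w * A \<longleftrightarrow> 0 < A" "w * A < 0 \<longleftrightarrow> A < 0"
      using w(1) by (simp_all add: zero_le_mult_iff zero_less_mult_iff mult_less_0_iff)
    thus "t' \<le> n' \<bullet> to_unit_sphere x \<longleftrightarrow> t \<le> n \<bullet> to_unit_sphere (mob d (- b) (- c) a x)"
      "t' < n' \<bullet> to_unit_sphere x \<longleftrightarrow> t < n \<bullet> to_unit_sphere (mob d (- b) (- c) a x)"
      "n' \<bullet> to_unit_sphere x < t' \<longleftrightarrow> n \<bullet> to_unit_sphere (mob d (- b) (- c) a x) < t"
      using w(2) unfolding A_def by linarith+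
  qed
  have "mob a b c d ` B = cap n' t'" unfolding mob_image_vimage[OF det] B(1) cap_def using sgn(1) by auto
  moreover have "t' < n' \<bullet> to_unit_sphere (mob a b c d p)" "n' \<bullet> to_unit_sphere (mob a b c d q) < t'"
    unfolding sgn mob_inverse[OF det] by (fact B)+
  ultimately show ?thesis unfolding proper_cap_def by blast
qed

lemma proper_cap_cball:
  assumes "r > 0"
  shows "proper_cap (Fin ` cball c r)"
proof -
  \<comment> \<open>times \<open>1 + \<bar>z\<bar>\<^sup>2\<close>, the affine function is \<open>r\<^sup>2 - \<bar>z\<bar>\<^sup>2 + 2 (c \<bullet> z) - \<bar>c\<bar>\<^sup>2\<close>\<close>
  define k where "k = (norm c)\<^sup>2 - r\<^sup>2"
  define n where "n = (c, - (1 - k) / 2)"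
  have fin: "n \<bullet> to_unit_sphere (Fin z) - (1 + k) / 2 = (r\<^sup>2 - (dist c z)\<^sup>2) / (1 + (norm z)\<^sup>2)" for z
  proof -
    have "(dist c z)\<^sup>2 = (norm c)\<^sup>2 + (norm z)\<^sup>2 - 2 * (c \<bullet> z)"
      by (simp add: dist_norm power2_norm_eq_inner inner_diff inner_commute)
    hence "(2 * (c \<bullet> z) + - (1 - k) / 2 * ((norm z)\<^sup>2 - 1)) - (1 + k) / 2 * (1 + (norm z)\<^sup>2) = r\<^sup>2 - (dist c z)\<^sup>2"
      by (simp add: k_def field_simps)
    moreover have "x / m - y = (x - y * m) / m" if "m > 0" for x y m :: real
      using that by (simp add: field_simps)
    ultimately show ?thesis unfolding n_def inner_to_unit_sphere_Fin using one_plus_norm_pos[of z] by simp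
  qed
  have inf: "n \<bullet> to_unit_sphere Infty - (1 + k) / 2 < 0" by (simp add: n_def field_simps)
  have "z \<in> cball c r \<longleftrightarrow> (1 + k) / 2 \<le> n \<bullet> to_unit_sphere (Fin z)" for z
  proof -
    have "z \<in> cball c r \<longleftrightarrow> (dist c z)\<^sup>2 \<le> r\<^sup>2" using assms by (simp add: abs_le_square_iff[symmetric])
    also have "\<dots> \<longleftrightarrow> 0 \<le> n \<bullet> to_unit_sphere (Fin z) - (1 + k) / 2"
      unfolding fin using one_plus_norm_pos[of z] by (simp add: zero_le_divide_iff)
    finally show ?thesis by simp
  qed
  hence "x \<in> Fin ` cball c r \<longleftrightarrow> x \<in> cap n ((1 + k) / 2)" for x
    using inf by (cases x) (auto simp: cap_def simp del: to_unit_sphere.simps mem_cball)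
  hence "Fin ` cball c r = cap n ((1 + k) / 2)" by blast
  moreover have "(1 + k) / 2 < n \<bullet> to_unit_sphere (Fin c)"
  proof -
    have "0 < n \<bullet> to_unit_sphere (Fin c) - (1 + k) / 2" unfolding fin using assms one_plus_norm_pos[of c] by simp
    thus ?thesis by simp
  qed
  moreover have "n \<bullet> to_unit_sphere Infty < (1 + k) / 2" using inf by simp
  ultimately show ?thesis unfolding proper_cap_def by blast
qed

text \<open>This is the image of a disk under the inversion, which settles both claims.\<close>

lemma proper_cap_exterior:
  assumes "R > 0"
  shows "proper_cap (insert Infty (Fin ` {z. R \<le> norm z}))" "connected (insert Infty (Fin ` {z. R \<le> norm z}))"
proof -
  have mem: "x \<in> insert Infty (Fin ` {z. R \<le> norm z}) \<longleftrightarrow> x \<in> mob 0 (- 1) (- 1) 0 -` (Fin ` cball 0 (1 / R))" for x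
  proof (cases x)
    case (Fin z)
    have "R \<le> norm z \<longleftrightarrow> norm (1 / z) \<le> 1 / R" if "z \<noteq> 0"
      using that assms by (simp add: norm_divide field_simps)
    thus ?thesis using Fin assms by auto
  qed (use assms in auto)
  have img: "mob 0 1 1 0 ` A = mob 0 (- 1) (- 1) 0 -` A" for A using mob_image_vimage[of 0 0 1 1 A] by simp
  have eq: "insert Infty (Fin ` {z. R \<le> norm z}) = mob 0 1 1 0 ` (Fin ` cball 0 (1 / R))"
    unfolding img using mem by (intro set_eqI)
  have "proper_cap (mob 0 1 1 0 ` (Fin ` cball 0 (1 / R)))"
    by (intro proper_cap_mob proper_cap_cball) (use assms in simp_all)
  thus "proper_cap (insert Infty (Fin ` {z. R \<le> norm z}))" unfolding eq .
  have "connected (Fin ` cball 0 (1 / R))" by (rule connected_continuous_image[OF continuous_Fin]) simp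
  thus "connected (insert Infty (Fin ` {z. R \<le> norm z}))"
    unfolding eq by (intro connected_continuous_image continuous_mob continuous_Fin) simp_all
qed

section \<open>Circle domains and conformal maps on the sphere\<close>

lemma continuous_fin_part: "continuous_on (- {Infty}) fin_part"
proof -
  have c: "snd (to_unit_sphere p) \<noteq> 1 \<and> (1 / (1 - snd (to_unit_sphere p))) *\<^sub>R fst (to_unit_sphere p) = fin_part p"
    if "p \<in> - {Infty}" for p
  proof (cases p)
    case (Fin z)
    define N where "N = (norm z)\<^sup>2"
    have N: "1 + N > 0" using one_plus_norm_pos[of z] by (simp add: N_def)
    have "1 - (N - 1) / (N + 1) = 2 / (1 + N)" using N by (simp add: field_simps)
    moreover define M where "M = 2 / (1 + N)"
    ultimately have s: "1 - snd (to_unit_sphere p) = M" unfolding Fin to_unit_sphere_Fin N_def by simp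
    have M: "M \<noteq> 0" using N by (simp add: M_def)
    hence "snd (to_unit_sphere p) \<noteq> 1" using s by auto
    moreover have "fst (to_unit_sphere p) = M *\<^sub>R z" unfolding Fin to_unit_sphere_Fin N_def M_def by simp
    ultimately show ?thesis using M Fin unfolding s by simp
  qed (use that in simp)
  have "continuous_on (- {Infty}) (\<lambda>p. (1 / (1 - snd (to_unit_sphere p))) *\<^sub>R fst (to_unit_sphere p))"
    using c by (intro continuous_intros continuous_to_unit_sphere) auto
  thus ?thesis by (rule continuous_on_eq) (use c in blast)
qed

lemma open_image_Fin:
  assumes "open S"
  shows "open (Fin ` S)"
proof -
  have "open (- {Infty} \<inter> fin_part -` S)"
    by (rule continuous_open_preimage[OF continuous_fin_part _ assms]) auto
  moreover have "- {Infty} \<inter> fin_part -` S = Fin ` S"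
  proof (intro set_eqI iffI)
    fix p assume "p \<in> - {Infty} \<inter> fin_part -` S"
    thus "p \<in> Fin ` S" by (cases p) auto
  qed auto
  ultimately show ?thesis by simp
qed

text \<open>Boundedness is essential: it keeps \<open>Infty\<close> out of the closure.\<close>

lemma frontier_image_Fin:
  assumes "open S" "bounded S"
  shows "frontier (Fin ` S) = Fin ` frontier S"
proof -
  have "closure (Fin ` S) = Fin ` closure S"
  proof
    have "compact (Fin ` closure S)"
      using assms by (intro compact_continuous_image continuous_Fin) (simp add: compact_closure)
    thus "closure (Fin ` S) \<subseteq> Fin ` closure S"
      by (intro closure_minimal image_mono closure_subset compact_imp_closed)
    show "Fin ` closure S \<subseteq> closure (Fin ` S)"
      by (rule image_closure_subset[OF continuous_Fin closed_closure closure_subset])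
  qed
  thus ?thesis unfolding frontier_def using interior_open[OF assms(1)] interior_open[OF open_image_Fin[OF assms(1)]]
    by auto
qed

text \<open>Each member is closed and so is the union of the others, so a connected subset of the union cannot
meet two members.\<close>

lemma components_Union_subset:
  assumes "finite \<F>" "\<And>B. B \<in> \<F> \<Longrightarrow> closed B" "\<And>B. B \<in> \<F> \<Longrightarrow> connected B" "pairwise disjnt \<F>"
  shows "components (\<Union>\<F>) \<subseteq> \<F>"
proof
  fix C assume C: "C \<in> components (\<Union>\<F>)"
  then obtain x B where x: "x \<in> C" "x \<in> B" "B \<in> \<F>"
    using in_components_nonempty in_components_subset by blast
  have "B \<subseteq> C" using components_maximal[OF C assms(3)[OF x(3)]] x by blast
  moreover have "C \<subseteq> B"
  proof (rule ccontr)
    assume "\<not> C \<subseteq> B"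
    have "closed (\<Union>(\<F> - {B}))" using assms(1,2) by (intro closed_Union) auto
    moreover have "B \<inter> \<Union>(\<F> - {B}) \<inter> C = {}" using assms(4) x(3) by (auto simp: pairwise_def disjnt_def)
    moreover have "C \<subseteq> B \<union> \<Union>(\<F> - {B})" using in_components_subset[OF C] by blast
    ultimately have "B \<inter> C = {} \<or> \<Union>(\<F> - {B}) \<inter> C = {}"
      using connected_closedD[OF in_components_connected[OF C] _ _ assms(2)[OF x(3)]] by blast
    thus False using x \<open>\<not> C \<subseteq> B\<close> in_components_subset[OF C] by blast
  qed
  ultimately have "C = B" by (rule subset_antisym[rotated])
  thus "C \<in> \<F>" using x(3) by simp
qed

text \<open>In the sphere the complement of the region consists of finitely many disjoint closed caps,
counting the exterior of the large disc together with \<open>Infty\<close>, and Moebius transformations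
preserve this situation.\<close>

lemma circle_domain_discs:
  assumes "finite C" and r: "r > 0" and R: "R > 0" and sub: "\<And>w. w \<in> C \<Longrightarrow> cball w r \<subseteq> ball 0 R"
    and disj: "\<And>w w'. w \<in> C \<Longrightarrow> w' \<in> C \<Longrightarrow> w \<noteq> w' \<Longrightarrow> cball w r \<inter> cball w' r = {}"
    and H: "H = ball 0 R - (\<Union>w\<in>C. cball w r)" "connected H" "H \<noteq> {}"
    and det: "a * d - b * c \<noteq> 0"
  shows "circle_domain (mob a b c d ` Fin ` H)"
proof -
  define outside where "outside = insert Infty (Fin ` {z. R \<le> norm z})"
  define \<B> where "\<B> = insert outside ((\<lambda>w. Fin ` cball w r) ` C)"
  have B: "proper_cap B \<and> connected B" if "B \<in> \<B>" for B
  proof -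
    have "connected (Fin ` cball w r)" for w by (rule connected_continuous_image[OF continuous_Fin]) simp
    thus ?thesis using that proper_cap_cball[OF r] proper_cap_exterior[OF R] unfolding \<B>_def outside_def by blast
  qed
  have opH: "open H" unfolding H(1) using assms(1) by (intro open_Diff closed_UN) auto
  have inj: "inj (mob a b c d)" using mob_bij[OF det] by (rule bij_is_inj)
  have "- (Fin ` H) = \<Union>\<B>"
  proof (intro set_eqI)
    show "p \<in> - (Fin ` H) \<longleftrightarrow> p \<in> \<Union>\<B>" for p
      by (cases p) (auto simp: \<B>_def outside_def H(1) simp del: mem_cball)
  qed
  hence comp: "- (mob a b c d ` Fin ` H) = \<Union>((`) (mob a b c d) ` \<B>)"
    using bij_image_Compl_eq[OF mob_bij[OF det], of "Fin ` H"] by (simp add: image_Union)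
  have disjB: "pairwise disjnt \<B>"
  proof -
    have "disjnt outside (Fin ` cball w r)" "disjnt (Fin ` cball w r) outside" if "w \<in> C" for w
    proof -
      have "norm z < R" if "z \<in> cball w r" for z using sub[OF \<open>w \<in> C\<close>] that by auto
      thus "disjnt outside (Fin ` cball w r)" "disjnt (Fin ` cball w r) outside"
        unfolding disjnt_def outside_def by force+
    qed
    moreover have "disjnt (Fin ` cball w r) (Fin ` cball w' r)" if "w \<in> C" "w' \<in> C" "w \<noteq> w'" for w w'
      using disj[OF that] unfolding disjnt_def by blast
    ultimately show ?thesis unfolding \<B>_def pairwise_def by (metis (no_types, lifting) imageE insertE)
  qed
  have "disjnt (mob a b c d ` B) (mob a b c d ` B')" if "disjnt B B'" for B B'
    using that inj by (auto simp: disjnt_def dest: injD)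
  hence disj': "pairwise disjnt ((`) (mob a b c d) ` \<B>)"
    using disjB unfolding pairwise_def by blast
  have disk: "closed_disk (mob a b c d ` B)" if "B \<in> \<B>" for B
    using B[OF that] proper_cap_mob[OF det] proper_cap_closed_disk by blast
  have "components (\<Union>((`) (mob a b c d) ` \<B>)) \<subseteq> (`) (mob a b c d) ` \<B>"
  proof (rule components_Union_subset[OF _ _ _ disj'])
    show "finite ((`) (mob a b c d) ` \<B>)" using assms(1) by (simp add: \<B>_def)
    show "closed B" if "B \<in> (`) (mob a b c d) ` \<B>" for B
      using that disk unfolding closed_disk_def by fastforce
    show "connected B" if "B \<in> (`) (mob a b c d) ` \<B>" for B
      using that \<open>\<And>B. B \<in> \<B> \<Longrightarrow> proper_cap B \<and> connected B\<close> connected_continuous_image[OF continuous_mob[OF det]] by blast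
  qed
  hence "closed_disk B" if "B \<in> complement_components (mob a b c d ` Fin ` H)" for B
    using that disk unfolding complement_components_def comp by blast
  moreover have "sphere_domain (mob a b c d ` Fin ` H)"
    unfolding sphere_domain_def
  proof (intro conjI)
    show "open (mob a b c d ` Fin ` H)"
      unfolding mob_image_vimage[OF det]
      by (rule open_vimage[OF open_image_Fin[OF opH] continuous_mob]) (use det in \<open>simp add: mult.commute\<close>)
    show "connected (mob a b c d ` Fin ` H)"
      by (intro connected_continuous_image continuous_mob[OF det] continuous_Fin H(2))
  qed (use H(3) in simp)
  ultimately show ?thesis unfolding circle_domain_def by blast
qed

lemma sphere_inv_mob: "a * d - b * c \<noteq> 0 \<Longrightarrow> sphere_inv (mob a b c d p) = mob c d a b p"
  using mob_nonzero[of a d b c] by (cases p) auto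

text \<open>Composition with \<open>sphere_inv\<close> swaps the rows of the matrix, so all coordinate
expressions are quotients of affine functions of \<open>g\<close>.\<close>

lemma conformal_map_mob:
  assumes V: "open V" and g: "g holomorphic_on V" "inj_on g V" and det: "a * d - b * c \<noteq> 0"
  shows "conformal_map (\<lambda>x. mob a b c d (Fin (g (fin_part x)))) (Fin ` V) (mob a b c d ` Fin ` g ` V)"
proof -
  let ?f = "\<lambda>x. mob a b c d (Fin (g (fin_part x)))"
  have gc: "continuous_on V g" using g(1) by (rule holomorphic_on_imp_continuous_on)
  have "continuous_on (Fin ` V) fin_part" by (rule continuous_on_subset[OF continuous_fin_part]) auto
  hence "continuous_on (Fin ` V) (\<lambda>x. g (fin_part x))" by (rule continuous_on_compose2[OF gc]) auto
  hence "continuous_on (Fin ` V) (\<lambda>x. Fin (g (fin_part x)))"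
    by (rule continuous_on_compose2[OF continuous_Fin[of UNIV]]) auto
  hence cont: "continuous_on (Fin ` V) ?f"
    by (rule continuous_on_compose2[OF continuous_mob[OF det, of UNIV]]) auto
  have quot: "(\<lambda>z. fin_part (mob A B C D (Fin (g (fin_part (\<phi> (Fin z)))))))
      holomorphic_on {z. \<phi> (Fin z) \<in> Fin ` V \<and> mob A B C D (Fin (g (fin_part (\<phi> (Fin z))))) \<noteq> Infty}"
    if \<phi>: "\<phi> \<in> {id, sphere_inv}" for A B C D \<phi>
  proof -
    define W where "W = {z. \<phi> (Fin z) \<in> Fin ` V \<and> mob A B C D (Fin (g (fin_part (\<phi> (Fin z))))) \<noteq> Infty}"
    have "(\<lambda>z. fin_part (\<phi> (Fin z))) holomorphic_on W"
    proof (cases "\<phi> = id")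
      case True
      thus ?thesis by simp
    next
      case False
      hence [simp]: "\<phi> = sphere_inv" using \<phi> by blast
      have nz: "z \<noteq> 0" if "z \<in> W" for z using that by (auto simp: W_def)
      have "(\<lambda>z. 1 / z) holomorphic_on W" using nz by (intro holomorphic_intros) auto
      thus ?thesis by (rule holomorphic_transform) (use nz in auto)
    qed
    moreover have "(\<lambda>z. fin_part (\<phi> (Fin z))) ` W \<subseteq> V" by (auto simp: W_def)
    ultimately have h: "(\<lambda>z. g (fin_part (\<phi> (Fin z)))) holomorphic_on W"
      using holomorphic_on_compose_gen[OF _ g(1)] by (simp add: o_def)
    have ne: "C * g (fin_part (\<phi> (Fin z))) + D \<noteq> 0" if "z \<in> W" for z using that by (auto simp: W_def)
    have "(\<lambda>z. (A * g (fin_part (\<phi> (Fin z))) + B) / (C * g (fin_part (\<phi> (Fin z))) + D)) holomorphic_on W"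
      using ne h by (intro holomorphic_intros) auto
    thus ?thesis unfolding W_def[symmetric] by (rule holomorphic_transform) (use ne in auto)
  qed
  have "sphere_holomorphic_on ?f (Fin ` V)"
    unfolding sphere_holomorphic_on_def
  proof (intro conjI ballI)
    fix \<phi> \<psi> :: "riemann_sphere \<Rightarrow> riemann_sphere"
    assume \<phi>: "\<phi> \<in> {id, sphere_inv}" and "\<psi> \<in> {id, sphere_inv}"
    then consider "\<psi> = id" | "\<psi> = sphere_inv" by blast
    thus "(\<lambda>z. fin_part (\<psi> (?f (\<phi> (Fin z))))) holomorphic_on {z. \<phi> (Fin z) \<in> Fin ` V \<and> \<psi> (?f (\<phi> (Fin z))) \<noteq> Infty}"
    proof cases
      case 1
      show ?thesis unfolding 1 id_apply by (rule quot[OF \<phi>])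
    next
      case 2
      show ?thesis unfolding 2 sphere_inv_mob[OF det] by (rule quot[OF \<phi>])
    qed
  qed (rule cont)
  moreover have "bij_betw ?f (Fin ` V) (mob a b c d ` Fin ` g ` V)"
    unfolding bij_betw_def
  proof
    show "inj_on ?f (Fin ` V)"
    proof (rule inj_onI)
      fix x y assume "x \<in> Fin ` V" "y \<in> Fin ` V" and eq: "?f x = ?f y"
      then obtain z w where zw: "z \<in> V" "w \<in> V" "x = Fin z" "y = Fin w" by blast
      have "Fin (g (fin_part x)) = Fin (g (fin_part y))"
        using injD[OF bij_is_inj[OF mob_bij[OF det]] eq] .
      thus "x = y" using g(2) zw by (simp add: inj_on_eq_iff)
    qed
    show "?f ` Fin ` V = mob a b c d ` Fin ` g ` V" unfolding image_image fin_part.simps ..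
  qed
  ultimately show ?thesis unfolding conformal_map_def by blast
qed

section \<open>Normalization at three points\<close>

text \<open>The matrix with rows \<open>(A, B)\<close> and \<open>(C, D)\<close> that takes \<open>p0, p1,
p2\<close> to \<open>a0, a1, a2\<close>: the matrix of the cross-ratio that takes \<open>p0, p1, p2\<close> to
\<open>0, 1, \<infinity>\<close> is multiplied by the adjugate of the same matrix for \<open>a0, a1,
a2\<close>. The entries are polynomials, and for \<open>p = a\<close> the matrix is a multiple of the identity
matrix.\<close>

definition three_point_A :: "complex \<Rightarrow> complex \<Rightarrow> complex \<Rightarrow> complex \<Rightarrow> complex \<Rightarrow> complex \<Rightarrow> complex" where
  "three_point_A a0 a1 a2 p0 p1 p2 = a0 * (a1 - a2) * (p1 - p0) - a2 * (a1 - a0) * (p1 - p2)"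

definition three_point_B :: "complex \<Rightarrow> complex \<Rightarrow> complex \<Rightarrow> complex \<Rightarrow> complex \<Rightarrow> complex \<Rightarrow> complex" where
  "three_point_B a0 a1 a2 p0 p1 p2 = a2 * (a1 - a0) * p0 * (p1 - p2) - a0 * (a1 - a2) * p2 * (p1 - p0)"

definition three_point_C :: "complex \<Rightarrow> complex \<Rightarrow> complex \<Rightarrow> complex \<Rightarrow> complex \<Rightarrow> complex \<Rightarrow> complex" where
  "three_point_C a0 a1 a2 p0 p1 p2 = (a1 - a2) * (p1 - p0) - (a1 - a0) * (p1 - p2)"

definition three_point_D :: "complex \<Rightarrow> complex \<Rightarrow> complex \<Rightarrow> complex \<Rightarrow> complex \<Rightarrow> complex \<Rightarrow> complex" where
  "three_point_D a0 a1 a2 p0 p1 p2 = (a1 - a0) * p0 * (p1 - p2) - (a1 - a2) * p2 * (p1 - p0)"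

definition triple_product :: "complex \<Rightarrow> complex \<Rightarrow> complex \<Rightarrow> complex" where
  "triple_product p0 p1 p2 = (p1 - p2) * (p1 - p0) * (p0 - p2)"

lemmas three_point_defs = three_point_A_def three_point_B_def three_point_C_def three_point_D_def triple_product_def

lemma triple_product_nonzero: "p0 \<noteq> p1 \<Longrightarrow> p0 \<noteq> p2 \<Longrightarrow> p1 \<noteq> p2 \<Longrightarrow> triple_product p0 p1 p2 \<noteq> 0"
  by (simp add: triple_product_def)

lemma three_point_det:
  "three_point_A a0 a1 a2 p0 p1 p2 * three_point_D a0 a1 a2 p0 p1 p2 - three_point_B a0 a1 a2 p0 p1 p2 * three_point_C a0 a1 a2 p0 p1 p2 =
    triple_product a0 a1 a2 * triple_product p0 p1 p2"
  unfolding three_point_defs by algebra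

lemma three_point_maps:
  assumes "a0 \<noteq> a1" "a0 \<noteq> a2" "a1 \<noteq> a2" "p0 \<noteq> p1" "p0 \<noteq> p2" "p1 \<noteq> p2"
  defines "M \<equiv> mob (three_point_A a0 a1 a2 p0 p1 p2) (three_point_B a0 a1 a2 p0 p1 p2) (three_point_C a0 a1 a2 p0 p1 p2) (three_point_D a0 a1 a2 p0 p1 p2)"
  shows "M (Fin p0) = Fin a0" "M (Fin p1) = Fin a1" "M (Fin p2) = Fin a2"
proof -
  have M: "M (Fin p) = Fin a" if "k \<noteq> 0" "three_point_C a0 a1 a2 p0 p1 p2 * p + three_point_D a0 a1 a2 p0 p1 p2 = k"
    "three_point_A a0 a1 a2 p0 p1 p2 * p + three_point_B a0 a1 a2 p0 p1 p2 = a * k" for p a k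
    using that by (simp add: M_def)
  show "M (Fin p0) = Fin a0"
    by (rule M[of "(a1 - a2) * (p1 - p0) * (p0 - p2)"]) (use assms in simp, unfold three_point_defs, algebra, algebra)
  show "M (Fin p1) = Fin a1"
    by (rule M[of "(p1 - p2) * (p1 - p0) * (a0 - a2)"]) (use assms in simp, unfold three_point_defs, algebra, algebra)
  show "M (Fin p2) = Fin a2"
    by (rule M[of "(a1 - a0) * (p1 - p2) * (p0 - p2)"]) (use assms in simp, unfold three_point_defs, algebra, algebra)
qed

lemma uniform_limit_const_tendsto:
  fixes f :: "nat \<Rightarrow> 'b::metric_space"
  shows "f \<longlonglongrightarrow> l \<Longrightarrow> uniform_limit S (\<lambda>n _. f n) (\<lambda>_. l) sequentially"
  unfolding uniform_limit_iff tendsto_iff by (auto elim!: eventually_mono)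

text \<open>The denominators converge uniformly to \<open>\<kappa> \<noteq> 0\<close>, so eventually all
values are finite and the quotients converge uniformly in the plane; the chordal metric is weaker.\<close>

lemma mob_uniform_limit:
  fixes \<kappa> :: complex
  assumes lim: "A \<longlonglongrightarrow> \<kappa>" "B \<longlonglongrightarrow> 0" "C \<longlonglongrightarrow> 0" "D \<longlonglongrightarrow> \<kappa>" and k: "\<kappa> \<noteq> 0"
    and K: "bounded K" and g: "uniform_limit K g (\<lambda>z. z) sequentially"
  shows "uniform_limit (Fin ` K) (\<lambda>j x. mob (A j) (B j) (C j) (D j) (Fin (g j (fin_part x)))) (\<lambda>x. Fin (fin_part x)) sequentially"
proof -
  have b: "bounded ((\<lambda>z. z) ` K)" "bounded ((\<lambda>_. c :: complex) ` K)" for c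
    using K by (auto intro: finite_imp_bounded finite_subset[of _ "{c}"])
  have lin: "uniform_limit K (\<lambda>j z. P j * g j z + Q j) (\<lambda>z. p * z + q) sequentially"
    if "P \<longlonglongrightarrow> p" "Q \<longlonglongrightarrow> q" for P Q :: "nat \<Rightarrow> complex" and p q
    by (intro uniform_limit_add uniform_lim_mult uniform_limit_const_tendsto that g b)
  have den: "uniform_limit K (\<lambda>j z. C j * g j z + D j) (\<lambda>z. \<kappa>) sequentially" using lin[OF lim(3,4)] by simp
  have num: "uniform_limit K (\<lambda>j z. A j * g j z + B j) (\<lambda>z. \<kappa> * z) sequentially" using lin[OF lim(1,2)] by simp
  have "bounded ((\<lambda>z. \<kappa> * z) ` K)" by (rule bounded_linear_image[OF K bounded_linear_mult_right])
  hence quot: "uniform_limit K (\<lambda>j z. (A j * g j z + B j) / (C j * g j z + D j)) (\<lambda>z. \<kappa> * z / \<kappa>) sequentially"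
    by (rule uniform_lim_divide[OF num den, of "norm \<kappa>"]) (use k in auto)
  have ne: "\<forall>\<^sub>F j in sequentially. \<forall>z\<in>K. C j * g j z + D j \<noteq> 0"
    using uniform_limitD[OF den, of "norm \<kappa>"] k by (auto elim!: eventually_mono simp: dist_norm)
  show ?thesis
  proof (rule uniform_limitI)
    fix e :: real assume "e > 0"
    hence "\<forall>\<^sub>F j in sequentially. \<forall>z\<in>K. dist ((A j * g j z + B j) / (C j * g j z + D j)) (\<kappa> * z / \<kappa>) < e / 2"
      using uniform_limitD[OF quot, of "e / 2"] by simp
    thus "\<forall>\<^sub>F j in sequentially. \<forall>x\<in>Fin ` K. dist (mob (A j) (B j) (C j) (D j) (Fin (g j (fin_part x)))) (Fin (fin_part x)) < e"
      using ne
    proof eventually_elim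
      case (elim j)
      show ?case
      proof
        fix x assume "x \<in> Fin ` K"
        then obtain z where z: "z \<in> K" "x = Fin z" by blast
        have "dist (Fin ((A j * g j z + B j) / (C j * g j z + D j))) (Fin z) \<le> 2 * dist ((A j * g j z + B j) / (C j * g j z + D j)) z"
          by (rule dist_Fin_le)
        also have "\<dots> < e" using bspec[OF elim(1) z(1)] k by simp
        finally show "dist (mob (A j) (B j) (C j) (D j) (Fin (g j (fin_part x)))) (Fin (fin_part x)) < e"
          using elim(2) z by simp
      qed
    qed
  qed
qed

section \<open>The limit domain in the sphere\<close>

context tower
begin

definition inverse_map :: "nat \<Rightarrow> complex \<Rightarrow> complex" where
  "inverse_map j = inv_into (inn j) (limit_map j)"

lemma inverse_limit_map: "z \<in> inn j \<Longrightarrow> inverse_map j (limit_map j z) = z"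
  unfolding inverse_map_def by (rule inv_into_f_f[OF limit_inj_open])

lemma inverse_map_image: "inverse_map j ` dom j = inn j"
  unfolding dom_def image_image using inverse_limit_map by force

lemma inverse_inj: "inj_on (inverse_map j) (dom j)"
  unfolding inverse_map_def dom_def by (rule inj_on_inv_into) simp

lemma inverse_holomorphic: "inverse_map j holomorphic_on dom j"
proof -
  obtain g where g: "g holomorphic_on dom j" "\<And>z. z \<in> inn j \<Longrightarrow> g (limit_map j z) = z"
    using holomorphic_has_inverse[OF limit_holomorphic open_open_region[OF valid] limit_inj_open] unfolding dom_def by blast
  show ?thesis by (rule holomorphic_transform[OF g(1)]) (auto simp: dom_def g(2) inverse_limit_map)
qed

lemma iter_mem_open: "z \<in> inn n \<Longrightarrow> iter n k z \<in> inn (n + k)"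
proof (induction k)
  case (Suc k)
  thus ?case using chart_image[of "n + k"] open_subset_closed_region[of "s (n + k)"] by fastforce
qed simp

lemma limit_map_iter: "z \<in> clo n \<Longrightarrow> limit_map (n + k) (iter n k z) = limit_map n z"
proof (induction k)
  case (Suc k)
  thus ?case using limit_map_chart[OF iter_mem[OF Suc.prems, of k]] by simp
qed simp

text \<open>On the \<open>n\<close>-th domain the inverse of a later limit map is a finite composition of
charts.\<close>

lemma inverse_iter:
  assumes "z \<in> inn n"
  shows "inverse_map (n + k) (limit_map n z) = iter n k z"
proof -
  have "limit_map n z = limit_map (n + k) (iter n k z)"
    using limit_map_iter[of z n k] assms open_subset_closed_region[of "s n"] by fastforce
  thus ?thesis using inverse_limit_map[OF iter_mem_open[OF assms]] by simp
qed

lemma dom_mono': "m \<le> n \<Longrightarrow> dom m \<subseteq> dom n"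
  by (rule lift_Suc_mono_le[of dom, OF dom_mono])

text \<open>On the image of \<open>limit_map n\<close> the inverse maps are the partial compositions
\<open>iter n k\<close>, which approach \<open>limit_map n\<close> itself.\<close>

lemma inverse_uniform: "uniform_limit (dom n) inverse_map (\<lambda>z. z) sequentially"
proof (rule uniform_limitI)
  fix e :: real assume "e > 0"
  then obtain N where N: "\<And>k. k \<ge> N \<Longrightarrow> margin (s (n + k)) < e"
    using order_tendstoD(2)[OF margin_tendsto, of e n] unfolding eventually_sequentially by blast
  have "dist (inverse_map j z) z < e" if j: "j \<ge> n + Suc N" and z: "z \<in> dom n" for j z
  proof -
    obtain u where u: "u \<in> inn n" "z = limit_map n u" using z unfolding dom_def by blast
    obtain k where k: "j = n + Suc k" "k \<ge> N" using j by (intro that[of "j - n - 1"]) auto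
    have "dist (limit_map n u) (iter n (Suc k) u) \<le> margin (s (n + k)) / 6"
      using u(1) open_subset_closed_region[of "s n"] by (intro limit_close) blast
    also have "\<dots> < e" using N[OF k(2)] margin_pos[of "n + k"] by linarith
    finally show ?thesis using inverse_iter[OF u(1), of "Suc k"] u(2) k(1) by (simp add: dist_commute)
  qed
  thus "\<forall>\<^sub>F j in sequentially. \<forall>z\<in>dom n. dist (inverse_map j z) z < e"
    unfolding eventually_sequentially by blast
qed

lemma bounded_dom: "bounded (dom n)"
proof -
  have "bounded (limit_map n ` clo n)"
    by (intro compact_imp_bounded compact_continuous_image limit_continuous compact_closed_region)
  thus ?thesis unfolding dom_def by (rule bounded_subset) (intro image_mono open_subset_closed_region)
qed

lemma open_region_nonempty: "inn n \<noteq> {}"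
  using limit_nonconstant[of n] by (auto simp: constant_on_def)

lemma dom_subset: "dom n \<subseteq> limit_dom"
  unfolding limit_dom_def by blast

lemma sphere_domain_dom: "sphere_domain (Fin ` dom n)"
  unfolding sphere_domain_def
  using open_image_Fin[OF open_dom] connected_continuous_image[OF continuous_Fin connected_dom]
    open_region_nonempty[of n] by (simp add: dom_def)

lemma sphere_domain_limit: "sphere_domain (Fin ` limit_dom)"
proof -
  have "connected (\<Union>(range dom))"
  proof (rule connected_Union)
    show "connected A" if "A \<in> range dom" for A using that connected_dom by blast
    have "dom 0 \<subseteq> \<Inter>(range dom)" using dom_mono'[of 0] by blast
    thus "\<Inter>(range dom) \<noteq> {}" using open_region_nonempty[of 0] by (auto simp: dom_def)
  qed
  moreover have "open limit_dom" unfolding limit_dom_def using open_dom by blast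
  moreover have "limit_dom \<noteq> {}" using dom_subset[of 0] open_region_nonempty[of 0] by (auto simp: dom_def)
  ultimately show ?thesis unfolding sphere_domain_def
    using open_image_Fin connected_continuous_image[OF continuous_Fin] by (simp add: limit_dom_def)
qed

definition boundary_circles :: "nat \<Rightarrow> complex set set" where
  "boundary_circles n = insert (sphere 0 (outer (s n))) ((\<lambda>c. sphere c (radius (s n))) ` centres (s n))"

lemma boundary_circles_Union: "\<Union>(boundary_circles n) = clo n - inn n"
  using frontier_region[OF valid[of n]] by (simp add: boundary_circles_def)

lemma boundary_circles_disjoint: "pairwise disjnt (boundary_circles n)"
proof -
  have "disjnt (sphere 0 (outer (s n))) (sphere c (radius (s n)))" if "c \<in> centres (s n)" for c
  proof -
    have sub: "cball c (radius (s n)) \<subseteq> ball 0 (outer (s n))" using valid[of n] that by (simp add: valid_stage_def)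
    have "norm x < outer (s n)" if "dist c x = radius (s n)" for x using subsetD[OF sub, of x] that by simp
    thus ?thesis by (force simp: disjnt_iff)
  qed
  moreover have "disjnt (sphere c (radius (s n))) (sphere c' (radius (s n)))"
    if "c \<in> centres (s n)" "c' \<in> centres (s n)" "c \<noteq> c'" for c c'
  proof -
    have "cball c (radius (s n)) \<inter> cball c' (radius (s n)) = {}"
      using valid[of n] that unfolding valid_stage_def by blast
    thus ?thesis unfolding disjnt_def using sphere_cball[of c] sphere_cball[of c'] by blast
  qed
  ultimately show ?thesis unfolding boundary_circles_def pairwise_insert pairwise_image
    by (auto simp: pairwise_def disjnt_sym)
qed

lemma boundary_circle_jordan:
  assumes "S \<in> boundary_circles n"
  shows "jordan_curve (Fin ` limit_map n ` S)"
proof -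
  obtain c r where S: "S = sphere c r" "r > 0"
    using assms valid[of n] unfolding boundary_circles_def valid_stage_def by force
  have im: "path_image (circlepath c r) = S" using S by simp
  have sub: "S \<subseteq> clo n" using assms boundary_circles_Union[of n] by blast
  have "continuous_on S (Fin \<circ> limit_map n)"
    by (intro continuous_on_compose continuous_on_subset[OF limit_continuous sub] continuous_Fin)
  moreover have "inj_on (Fin \<circ> limit_map n) S"
    by (intro comp_inj_on inj_on_subset[OF limit_inj sub] inj_onI) simp
  ultimately have "simple_path ((Fin \<circ> limit_map n) \<circ> circlepath c r)"
    using S by (intro simple_path_continuous_image) (simp_all only: im simple_path_circlepath)
  moreover have "path_image ((Fin \<circ> limit_map n) \<circ> circlepath c r) = Fin ` limit_map n ` S"
    unfolding path_image_compose im image_comp ..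
  ultimately show ?thesis unfolding jordan_curve_def
    by (intro exI[of _ "(Fin \<circ> limit_map n) \<circ> circlepath c r"]) (simp add: pathstart_compose pathfinish_compose)
qed

text \<open>The boundary curves of the \<open>n\<close>-th domain are the images of the boundary circles under
\<open>limit_map n\<close>, which is still injective there.\<close>

lemma exhaustion_dom: "exhaustion (Fin ` limit_dom) (\<lambda>n. Fin ` dom n)"
  unfolding exhaustion_def
proof (intro conjI allI)
  fix n
  show "sphere_domain (Fin ` dom n)" by (rule sphere_domain_dom)
  show "Fin ` dom n \<subseteq> Fin ` limit_dom" by (intro image_mono dom_subset)
  show "Fin ` dom n \<subseteq> Fin ` dom (Suc n)" by (intro image_mono dom_mono)
  define \<J> where "\<J> = (\<lambda>S. Fin ` limit_map n ` S) ` boundary_circles n"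
  have sub: "S \<subseteq> clo n" if "S \<in> boundary_circles n" for S using that boundary_circles_Union[of n] by blast
  have "finite \<J>" using valid[of n] by (simp add: \<J>_def boundary_circles_def valid_stage_def)
  moreover have "pairwise disjnt \<J>"
  proof -
    have "disjnt (Fin ` limit_map n ` S) (Fin ` limit_map n ` S')"
      if "S \<in> boundary_circles n" "S' \<in> boundary_circles n" "disjnt S S'" for S S'
    proof -
      have "limit_map n ` S \<inter> limit_map n ` S' = {}"
        using inj_on_image_Int[OF limit_inj sub[OF that(1)] sub[OF that(2)]] that(3) by (simp add: disjnt_def)
      thus ?thesis unfolding disjnt_def by blast
    qed
    thus ?thesis using boundary_circles_disjoint[of n] unfolding pairwise_def \<J>_def by blast
  qed
  moreover have "jordan_curve J \<and> J \<subseteq> Fin ` limit_dom" if J: "J \<in> \<J>" for J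
  proof -
    obtain S where S: "S \<in> boundary_circles n" "J = Fin ` limit_map n ` S" using J unfolding \<J>_def by blast
    have "limit_map n ` S \<subseteq> limit_dom"
      using sub[OF S(1)] closed_image_subset[of n] dom_subset[of "Suc n"] by blast
    thus ?thesis using boundary_circle_jordan[OF S(1)] unfolding S(2) by blast
  qed
  moreover have "frontier (Fin ` dom n) = \<Union>\<J>"
    unfolding frontier_image_Fin[OF open_dom bounded_dom] frontier_dom \<J>_def boundary_circles_def by blast
  ultimately show "\<exists>\<J>. finite \<J> \<and> pairwise disjnt \<J> \<and> (\<forall>J\<in>\<J>. jordan_curve J \<and> J \<subseteq> Fin ` limit_dom) \<and> frontier (Fin ` dom n) = \<Union>\<J>"
    by blast
next
  show "Fin ` limit_dom = (\<Union>n. Fin ` dom n)" unfolding limit_dom_def by blast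
qed

lemma compact_subset_dom:
  assumes "compact K" "K \<subseteq> Fin ` limit_dom"
  obtains n where "K \<subseteq> Fin ` dom n"
proof -
  have cov: "K \<subseteq> (\<Union>n\<in>UNIV. Fin ` dom n)" using assms(2) unfolding limit_dom_def by blast
  have op: "open (Fin ` dom n)" for n by (rule open_image_Fin[OF open_dom])
  obtain I where I: "finite I" "K \<subseteq> (\<Union>n\<in>I. Fin ` dom n)"
    by (rule compactE_image[OF assms(1) op cov])
  have "dom n \<subseteq> dom (Max I)" if "n \<in> I" for n by (intro dom_mono' Max_ge I(1) that)
  hence "K \<subseteq> Fin ` dom (Max I)" using I(2) by blast
  thus ?thesis by (rule that)
qed

lemma circle_domain_stage:
  assumes "a * d - b * c \<noteq> 0"
  shows "circle_domain (mob a b c d ` Fin ` inn n)"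
proof (rule circle_domain_discs[of "centres (s n)" "radius (s n)" "outer (s n)"])
  show "finite (centres (s n))" "radius (s n) > 0" "outer (s n) > 0"
    using valid[of n] unfolding valid_stage_def by simp_all
  show "cball w (radius (s n)) \<subseteq> ball 0 (outer (s n))" if "w \<in> centres (s n)" for w
    using valid[of n] that unfolding valid_stage_def by blast
  show "cball w (radius (s n)) \<inter> cball w' (radius (s n)) = {}" if "w \<in> centres (s n)" "w' \<in> centres (s n)" "w \<noteq> w'" for w w'
    using valid[of n] that unfolding valid_stage_def by blast
qed (use assms in \<open>simp_all add: open_region_def[of "s n", symmetric] connected_open_region[OF valid] open_region_nonempty\<close>)

text \<open>The inverse maps already tend to the identity, so the Moebius transformations that restore the
three given points tend to the identity as well.\<close>

lemma normalized_maps_exist: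
  assumes b: "b0 \<in> dom 0" "b1 \<in> dom 0" "b2 \<in> dom 0" "b0 \<noteq> b1" "b0 \<noteq> b2" "b1 \<noteq> b2"
  obtains f where "\<And>j. normalized_circle_map (Fin b0) (Fin b1) (Fin b2) (Fin ` dom j) (f j)"
    "converges_locally_uniformly_on (Fin ` limit_dom) f (\<lambda>x. Fin (fin_part x))"
proof -
  define p where "p b j = inverse_map j b" for b j
  have pne: "p b j \<noteq> p b' j" if "b \<in> dom 0" "b' \<in> dom 0" "b \<noteq> b'" for b b' j
    using that inverse_inj[of j] dom_mono'[of 0 j] unfolding p_def inj_on_def by blast
  have plim: "p b \<longlonglongrightarrow> b" if "b \<in> dom 0" for b
    unfolding p_def using tendsto_uniform_limitI[OF inverse_uniform that] .
  define A where "A j = three_point_A b0 b1 b2 (p b0 j) (p b1 j) (p b2 j)" for j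
  define B where "B j = three_point_B b0 b1 b2 (p b0 j) (p b1 j) (p b2 j)" for j
  define C where "C j = three_point_C b0 b1 b2 (p b0 j) (p b1 j) (p b2 j)" for j
  define D where "D j = three_point_D b0 b1 b2 (p b0 j) (p b1 j) (p b2 j)" for j
  define f where "f j x = mob (A j) (B j) (C j) (D j) (Fin (inverse_map j (fin_part x)))" for j x
  have det: "A j * D j - B j * C j \<noteq> 0" for j
    unfolding A_def B_def C_def D_def three_point_det using triple_product_nonzero[of b0 b1 b2] triple_product_nonzero[of "p b0 j" "p b1 j" "p b2 j"] pne b by simp
  have "A \<longlonglongrightarrow> three_point_A b0 b1 b2 b0 b1 b2" "B \<longlonglongrightarrow> three_point_B b0 b1 b2 b0 b1 b2" "C \<longlonglongrightarrow> three_point_C b0 b1 b2 b0 b1 b2" "D \<longlonglongrightarrow> three_point_D b0 b1 b2 b0 b1 b2"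
    unfolding A_def B_def C_def D_def three_point_A_def three_point_B_def three_point_C_def three_point_D_def by (intro tendsto_intros plim b)+
  moreover have "three_point_A b0 b1 b2 b0 b1 b2 = triple_product b0 b1 b2" "three_point_B b0 b1 b2 b0 b1 b2 = 0" "three_point_C b0 b1 b2 b0 b1 b2 = 0" "three_point_D b0 b1 b2 b0 b1 b2 = triple_product b0 b1 b2"
    unfolding three_point_defs by algebra+
  ultimately have lim: "A \<longlonglongrightarrow> triple_product b0 b1 b2" "B \<longlonglongrightarrow> 0" "C \<longlonglongrightarrow> 0" "D \<longlonglongrightarrow> triple_product b0 b1 b2" by simp_all
  show ?thesis
  proof
    fix j
    have bj: "b \<in> dom j" if "b \<in> dom 0" for b using that dom_mono'[of 0 j] by blast
    have "conformal_map (f j) (Fin ` dom j) (mob (A j) (B j) (C j) (D j) ` Fin ` inn j)"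
      using conformal_map_mob[OF open_dom inverse_holomorphic inverse_inj det] unfolding f_def inverse_map_image .
    moreover have "f j (Fin b0) = Fin b0" "f j (Fin b1) = Fin b1" "f j (Fin b2) = Fin b2"
      unfolding f_def fin_part.simps p_def[symmetric] A_def B_def C_def D_def
      by (rule three_point_maps; use b pne in blast)+
    ultimately show "normalized_circle_map (Fin b0) (Fin b1) (Fin b2) (Fin ` dom j) (f j)"
      unfolding normalized_circle_map_def using circle_domain_stage[OF det] by blast
  next
    show "converges_locally_uniformly_on (Fin ` limit_dom) f (\<lambda>x. Fin (fin_part x))"
      unfolding converges_locally_uniformly_on_def
    proof (intro allI impI)
      fix K assume "compact K \<and> K \<subseteq> Fin ` limit_dom"
      then obtain n where n: "K \<subseteq> Fin ` dom n" using compact_subset_dom by blast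
      have "uniform_limit (Fin ` dom n) f (\<lambda>x. Fin (fin_part x)) sequentially"
        unfolding f_def
        by (rule mob_uniform_limit[OF lim triple_product_nonzero bounded_dom inverse_uniform]) (fact b)+
      thus "uniform_limit K f (\<lambda>x. Fin (fin_part x)) sequentially" by (rule uniform_limit_on_subset[OF _ n])
    qed
  qed
qed

lemma conformal_map_identity: "conformal_map (\<lambda>x. Fin (fin_part x)) (Fin ` limit_dom) (Fin ` limit_dom)"
proof -
  have "open limit_dom" unfolding limit_dom_def using open_dom by blast
  from conformal_map_mob[OF this holomorphic_on_ident inj_on_id2, of 1 1 0 0]
  show ?thesis by (simp add: image_image)
qed

text \<open>In the sphere the image of \<open>E\<close> and the complement of the image of \<open>E \<union>
G\<close> are disjoint open sets which cover the complement of the limit domain, since \<open>G\<close> lies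
in the limit domain.\<close>

lemma component_separation:
  assumes "\<sigma> \<noteq> \<sigma>'" "C \<in> complement_components (Fin ` limit_dom)" "Fin ` branch \<sigma> \<subseteq> C" "Fin ` branch \<sigma>' \<subseteq> C"
  shows False
proof -
  obtain E G where E: "open E" "compact (E \<union> G)" "G \<subseteq> limit_dom" "branch \<sigma> \<subseteq> E" "branch \<sigma>' \<inter> E = {}"
    using branch_separation[OF assms(1)] by blast
  have C: "connected C" "C \<subseteq> - Fin ` limit_dom"
    using assms(2) in_components_connected in_components_subset unfolding complement_components_def by blast+
  have "compact (Fin ` (E \<union> G))" by (intro compact_continuous_image continuous_Fin E)
  hence "open (- Fin ` (E \<union> G))" by (intro open_Compl compact_imp_closed)
  moreover have "Fin ` E \<inter> - Fin ` (E \<union> G) \<inter> C = {}" "C \<subseteq> Fin ` E \<union> - Fin ` (E \<union> G)" using C(2) E(3) by blast+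
  ultimately have "Fin ` E \<inter> C = {} \<or> - Fin ` (E \<union> G) \<inter> C = {}"
    using connectedD[OF C(1) open_image_Fin[OF E(1)]] by blast
  moreover obtain x where x: "x \<in> branch \<sigma>" by (auto simp: branch_def)
  moreover obtain x' where x': "x' \<in> branch \<sigma>'" by (auto simp: branch_def)
  moreover have "x' \<notin> E \<union> G" using x' E(3,5) branch_avoids[of \<sigma>'] by blast
  hence "Fin x' \<in> - Fin ` (E \<union> G) \<inter> C" using x' assms(4) by auto
  moreover have "Fin x \<in> Fin ` E \<inter> C" using x E(4) assms(3) by auto
  ultimately show False by blast
qed

lemma uncountable_sequences: "uncountable (UNIV :: (nat \<Rightarrow> bool) set)"
proof
  assume c: "countable (UNIV :: (nat \<Rightarrow> bool) set)"
  define f where "f = from_nat_into (UNIV :: (nat \<Rightarrow> bool) set)"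
  have "range f = UNIV" unfolding f_def by (rule range_from_nat_into[OF UNIV_not_empty c])
  then obtain n where "f n = (\<lambda>k. \<not> f k k)" by (metis UNIV_I imageE)
  thus False by (metis (full_types))
qed

text \<open>Each branch is a segment of positive length, and different branches lie in different
components.\<close>

lemma uncountable_components: "uncountable {p \<in> complement_components (Fin ` limit_dom). nontrivial p}"
proof -
  have "\<exists>C\<in>complement_components (Fin ` limit_dom). Fin ` branch \<sigma> \<subseteq> C" for \<sigma>
  proof -
    have sub: "Fin ` branch \<sigma> \<subseteq> - Fin ` limit_dom" using branch_avoids[of \<sigma>] by blast
    have "Fin ` branch \<sigma> \<noteq> {}" by (simp add: branch_def)
    moreover have "connected (Fin ` branch \<sigma>)"
      by (rule connected_continuous_image[OF continuous_Fin]) (simp add: branch_def)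
    ultimately show ?thesis using exists_component_superset[OF sub] sub unfolding complement_components_def by blast
  qed
  then obtain C where C: "\<And>\<sigma>. C \<sigma> \<in> complement_components (Fin ` limit_dom)" "\<And>\<sigma>. Fin ` branch \<sigma> \<subseteq> C \<sigma>" by metis
  have "nontrivial (C \<sigma>)" for \<sigma>
  proof -
    have mem: "Fin (Complex 0 (limit_height \<sigma>)) \<in> C \<sigma>" "Fin (Complex 1 (limit_height \<sigma>)) \<in> C \<sigma>"
      using C(2)[of \<sigma>] by (auto simp: branch_def)
    have "bounded (C \<sigma>)" unfolding bounded_def using dist_sphere_le_2 by blast
    note diameter_bounded_bound[OF this mem]
    moreover have "0 < dist (Fin (Complex 0 (limit_height \<sigma>))) (Fin (Complex 1 (limit_height \<sigma>)))"
      by (simp add: complex_eq_iff)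
    ultimately show ?thesis unfolding nontrivial_def by linarith
  qed
  hence sub: "range C \<subseteq> {p \<in> complement_components (Fin ` limit_dom). nontrivial p}" using C(1) by blast
  have "inj C"
  proof (rule injI, rule ccontr)
    fix \<sigma> \<sigma>' assume "C \<sigma> = C \<sigma>'" "\<sigma> \<noteq> \<sigma>'"
    thus False using component_separation[OF _ C(1)[of \<sigma>] C(2)[of \<sigma>]] C(2)[of \<sigma>'] by simp
  qed
  hence "uncountable (range C)" using uncountable_sequences countable_image_inj_on by blast
  thus ?thesis using countable_subset[OF sub] by blast
qed

end

theorem theorem1p2:
  "\<exists>(D :: riemann_sphere set) (\<Phi> :: nat \<Rightarrow> riemann_sphere set).
     sphere_domain D \<and> exhaustion D \<Phi> \<and>
     (\<forall>a0\<in>\<Phi> 0. \<forall>a1\<in>\<Phi> 0. \<forall>a2\<in>\<Phi> 0. a0 \<noteq> a1 \<and> a0 \<noteq> a2 \<and> a1 \<noteq> a2 \<longrightarrow>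
        (\<exists>(f :: nat \<Rightarrow> riemann_sphere \<Rightarrow> riemann_sphere) f\<^sub>\<Phi>.
           (\<forall>j. normalized_circle_map a0 a1 a2 (\<Phi> j) (f j)) \<and>
           converges_locally_uniformly_on D f f\<^sub>\<Phi> \<and>
           conformal_map f\<^sub>\<Phi> D (f\<^sub>\<Phi> ` D) \<and>
           uncountable {p \<in> complement_components (f\<^sub>\<Phi> ` D). nontrivial p}))"
proof -
  obtain s where s: "\<And>n. valid_stage (s n)" "\<And>n. next_stage (s n) (s (Suc n))"
    "heights (s 0) = {0}" "outer (s 0) = 10"
    "\<And>c. c \<in> centres (s 0) \<Longrightarrow> cball c (radius (s 0)) \<subseteq> ball 0 5"
    "\<And>z. 5 \<le> norm z \<Longrightarrow> norm z \<le> 10 \<Longrightarrow> dist (chart (s 0) z) z < 1"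
    by (rule stages_exist) blast
  interpret tower s by unfold_locales (fact s)+
  define \<Phi> where "\<Phi> n = Fin ` dom n" for n
  define g where "g = (\<lambda>x. Fin (fin_part x))"
  have g: "g ` Fin ` limit_dom = Fin ` limit_dom" unfolding g_def image_image by simp
  show ?thesis
  proof (intro exI[of _ "Fin ` limit_dom"] exI[of _ \<Phi>] conjI ballI impI)
    show "sphere_domain (Fin ` limit_dom)" by (rule sphere_domain_limit)
    show "exhaustion (Fin ` limit_dom) \<Phi>" unfolding \<Phi>_def by (rule exhaustion_dom)
    fix a0 a1 a2 assume "a0 \<in> \<Phi> 0" "a1 \<in> \<Phi> 0" "a2 \<in> \<Phi> 0" and ne: "a0 \<noteq> a1 \<and> a0 \<noteq> a2 \<and> a1 \<noteq> a2"
    then obtain b0 b1 b2 where b: "b0 \<in> dom 0" "b1 \<in> dom 0" "b2 \<in> dom 0" and a: "a0 = Fin b0" "a1 = Fin b1" "a2 = Fin b2"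
      unfolding \<Phi>_def by blast
    have "b0 \<noteq> b1" "b0 \<noteq> b2" "b1 \<noteq> b2" using ne a by auto
    then obtain f where f: "\<And>j. normalized_circle_map a0 a1 a2 (\<Phi> j) (f j)" "converges_locally_uniformly_on (Fin ` limit_dom) f g"
      unfolding a \<Phi>_def g_def using normalized_maps_exist[OF b] by blast
    show "\<exists>f g. (\<forall>j. normalized_circle_map a0 a1 a2 (\<Phi> j) (f j)) \<and> converges_locally_uniformly_on (Fin ` limit_dom) f g \<and>
        conformal_map g (Fin ` limit_dom) (g ` Fin ` limit_dom) \<and>
        uncountable {p \<in> complement_components (g ` Fin ` limit_dom). nontrivial p}"
      by (intro exI[of _ f] exI[of _ g] conjI allI f) (simp_all add: g uncountable_components conformal_map_identity[folded g_def])
  qed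
qed

end
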